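(* Let $1<p_1,p_2<\infty$, $1/p=1/p_1+1/p_2$, let $\omega\in A_1$ on $\mathbb{R}^n$, let $b$ be a locally integrable function on $\mathbb{R}^n$ and put $\vec b=(b,b)$. Then the following are equivalent: (A1) $b\in \mathrm{BMO}(\omega)$; (A2) the maximal linear commutator $\mathcal{M}_{\Sigma\vec b}$ is bounded from $L^{p_1}(\omega)\times L^{p_2}(\omega)$ to $L^{p}(\omega^{1-p})$; (A3) the maximal iterated commutator $\mathcal{M}_{\Pi\vec b}$ is bounded from $L^{p_1}(\omega)\times L^{p_2}(\omega)$ to $L^{p}(\omega^{1-2p})$.
   Context: $Q$ denotes a cube in $\mathbb{R}^n$, $|Q|$ its Lebesgue measure, $f_Q=\frac1{|Q|}\int_Q f(x)\,dx$ and $\omega(Q)=\int_Q\omega(x)\,dx$. A weight is a locally integrable function $\omega\ge 0$ on $\mathbb{R}^n$ (positive almost everywhere). $\omega\in A_1$ means there is $C>0$ such that $\frac1{|Q|}\int_Q\omega(x)\,dx\le C\operatorname{ess\,inf}_{x\in Q}\omega(x)$ for every cube $Q$. For $0<q<\infty$ and a weight $v$, $L^q(v)$ is the space of measurable $f$ with $\|f\|_{L^q(v)}=\big(\int_{\mathbb{R}^n}|f(x)|^q v(x)\,dx\big)^{1/q}<\infty$. $\mathrm{BMO}(\omega)$ is the set of $f\in L^1_{\mathrm{loc}}(\mathbb{R}^n)$ with $\|f\|_{\mathrm{BMO}(\omega)}=\sup_Q\frac1{\omega(Q)}\int_Q|f(y)-f_Q|\,dy<\infty$, the supremum being over all cubes.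 For $\vec f=(f_1,f_2)$ a pair of locally integrable functions and $\vec b=(b,b)$: $$\mathcal{M}_{\Sigma\vec b}(\vec f)(x)=\sum_{i=1}^2\mathcal{M}^{(i)}_{b}(\vec f)(x),\qquad \mathcal{M}^{(i)}_{b}(\vec f)(x)=\sup_{Q\ni x}\frac1{|Q|^2}\int_Q\int_Q|b(x)-b(y_i)|\prod_{j=1}^2|f_j(y_j)|\,dy_1dy_2,$$ $$\mathcal{M}_{\Pi\vec b}(\vec f)(x)=\sup_{Q\ni x}\frac1{|Q|^2}\int_Q\int_Q\prod_{i=1}^2|b(x)-b(y_i)||f_i(y_i)|\,dy_1dy_2,$$ suprema over all cubes $Q$ containing $x$. An operator $T$ acting on pairs of functions is bounded from $L^{p_1}(\omega)\times L^{p_2}(\omega)$ to $L^p(v)$ if there is a constant $C$ with $\|T(f_1,f_2)\|_{L^p(v)}\le C\|f_1\|_{L^{p_1}(\omega)}\|f_2\|_{L^{p_2}(\omega)}$ for all $f_1\in L^{p_1}(\omega)$, $f_2\in L^{p_2}(\omega)$. *)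

theory Defs
  imports "HOL-Analysis.Analysis"
begin

definition locally_integrable :: "(real ^ 'n \<Rightarrow> real) \<Rightarrow> bool" where
  "locally_integrable f \<longleftrightarrow> (\<forall>K. compact K \<longrightarrow> set_integrable lebesgue K f)"

text \<open>Closed, axis-parallel, nondegenerate cubes; all suprema below are the same for open cubes.\<close>

definition is_cube :: "(real ^ 'n) set \<Rightarrow> bool" where
  "is_cube Q \<longleftrightarrow> (\<exists>a l. 0 < l \<and> Q = cbox a (a + (\<chi> i. l)))"

definition average :: "(real ^ 'n \<Rightarrow> real) \<Rightarrow> (real ^ 'n) set \<Rightarrow> real" where
  "average f Q = (LINT y:Q|lebesgue. f y) / measure lebesgue Q"

definition weight :: "(real ^ 'n \<Rightarrow> real) \<Rightarrow> bool" where
  "weight w \<longleftrightarrow> locally_integrable w \<and> (\<forall>x. 0 \<le> w x) \<and> (AE x in lebesgue. 0 < w x)"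

definition ess_inf :: "(real ^ 'n \<Rightarrow> real) \<Rightarrow> (real ^ 'n) set \<Rightarrow> ennreal" where
  "ess_inf w Q = Sup {c. AE x in lebesgue. x \<in> Q \<longrightarrow> c \<le> ennreal (w x)}"

definition A1_weight :: "(real ^ 'n \<Rightarrow> real) \<Rightarrow> bool" where
  "A1_weight w \<longleftrightarrow> weight w \<and>
    (\<exists>C>0. \<forall>Q. is_cube Q \<longrightarrow> ennreal (average w Q) \<le> ennreal C * ess_inf w Q)"

definition BMO_norm :: "(real ^ 'n \<Rightarrow> real) \<Rightarrow> (real ^ 'n \<Rightarrow> real) \<Rightarrow> ennreal" where
  "BMO_norm w f = (SUP Q\<in>{Q. is_cube Q}.
     ennreal ((LINT y:Q|lebesgue. \<bar>f y - average f Q\<bar>) / (LINT y:Q|lebesgue. w y)))"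

definition BMO :: "(real ^ 'n \<Rightarrow> real) \<Rightarrow> (real ^ 'n \<Rightarrow> real) set" where
  "BMO w = {f. locally_integrable f \<and> BMO_norm w f < \<infinity>}"

text \<open>Maximal operators take values in \<open>[0, \<infinity>]\<close>, so the weighted quasinorm is defined on
  \<^typ>\<open>ennreal\<close>-valued functions. The power below is only meant for exponents \<open>q > 0\<close>.\<close>

definition ennreal_power :: "ennreal \<Rightarrow> real \<Rightarrow> ennreal" where
  "ennreal_power t q = (if t = \<infinity> then \<infinity> else ennreal (enn2real t powr q))"

definition Lq_norm :: "real \<Rightarrow> (real ^ 'n \<Rightarrow> real) \<Rightarrow> (real ^ 'n \<Rightarrow> ennreal) \<Rightarrow> ennreal" where
  "Lq_norm q v g =
     ennreal_power (\<integral>\<^sup>+x. ennreal_power (g x) q * ennreal (v x) \<partial>lebesgue) (1 / q)"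

definition Lq_space :: "real \<Rightarrow> (real ^ 'n \<Rightarrow> real) \<Rightarrow> (real ^ 'n \<Rightarrow> real) set" where
  "Lq_space q v = {f \<in> borel_measurable lebesgue. Lq_norm q v (\<lambda>x. ennreal \<bar>f x\<bar>) < \<infinity>}"

definition bounded_pair_op ::
  "((real ^ 'n \<Rightarrow> real) \<Rightarrow> (real ^ 'n \<Rightarrow> real) \<Rightarrow> real ^ 'n \<Rightarrow> ennreal) \<Rightarrow>
   real \<Rightarrow> real \<Rightarrow> (real ^ 'n \<Rightarrow> real) \<Rightarrow> real \<Rightarrow> (real ^ 'n \<Rightarrow> real) \<Rightarrow> bool" where
  "bounded_pair_op T p1 p2 w p v \<longleftrightarrow>
     (\<exists>C::real. \<forall>f1\<in>Lq_space p1 w. \<forall>f2\<in>Lq_space p2 w.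
        Lq_norm p v (T f1 f2) \<le>
          ennreal C * Lq_norm p1 w (\<lambda>x. ennreal \<bar>f1 x\<bar>) * Lq_norm p2 w (\<lambda>x. ennreal \<bar>f2 x\<bar>))"

definition sup_avg2 :: "real ^ 'n \<Rightarrow> (real ^ 'n \<Rightarrow> real ^ 'n \<Rightarrow> real) \<Rightarrow> ennreal" where
  "sup_avg2 x F = (SUP Q\<in>{Q. is_cube Q \<and> x \<in> Q}.
     (\<integral>\<^sup>+y2\<in>Q. (\<integral>\<^sup>+y1\<in>Q. ennreal (F y1 y2) \<partial>lebesgue) \<partial>lebesgue) / (emeasure lebesgue Q)\<^sup>2)"

definition M_lin1 ::
  "(real ^ 'n \<Rightarrow> real) \<Rightarrow> (real ^ 'n \<Rightarrow> real) \<Rightarrow> (real ^ 'n \<Rightarrow> real) \<Rightarrow> real ^ 'n \<Rightarrow> ennreal" where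
  "M_lin1 b f1 f2 x = sup_avg2 x (\<lambda>y1 y2. \<bar>b x - b y1\<bar> * (\<bar>f1 y1\<bar> * \<bar>f2 y2\<bar>))"

definition M_lin2 ::
  "(real ^ 'n \<Rightarrow> real) \<Rightarrow> (real ^ 'n \<Rightarrow> real) \<Rightarrow> (real ^ 'n \<Rightarrow> real) \<Rightarrow> real ^ 'n \<Rightarrow> ennreal" where
  "M_lin2 b f1 f2 x = sup_avg2 x (\<lambda>y1 y2. \<bar>b x - b y2\<bar> * (\<bar>f1 y1\<bar> * \<bar>f2 y2\<bar>))"

definition M_Sigma ::
  "(real ^ 'n \<Rightarrow> real) \<Rightarrow> (real ^ 'n \<Rightarrow> real) \<Rightarrow> (real ^ 'n \<Rightarrow> real) \<Rightarrow> real ^ 'n \<Rightarrow> ennreal" where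
  "M_Sigma b f1 f2 x = M_lin1 b f1 f2 x + M_lin2 b f1 f2 x"

definition M_Pi ::
  "(real ^ 'n \<Rightarrow> real) \<Rightarrow> (real ^ 'n \<Rightarrow> real) \<Rightarrow> (real ^ 'n \<Rightarrow> real) \<Rightarrow> real ^ 'n \<Rightarrow> ennreal" where
  "M_Pi b f1 f2 x =
     sup_avg2 x (\<lambda>y1 y2. (\<bar>b x - b y1\<bar> * \<bar>f1 y1\<bar>) * (\<bar>b x - b y2\<bar> * \<bar>f2 y2\<bar>))"

end

theory Submission
  imports Defs
begin

text \<open>Write \<open>\<mu>\<close> for the measure \<open>w dx\<close> and \<open>\<rho>\<^sub>Q = \<bar>b - b\<^sub>Q\<bar> / w\<close>. The \<open>A\<^sub>1\<close> condition says that the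
number \<open>\<mu>(Q)/|Q|\<close> is at most a constant times \<open>w\<close> almost everywhere on \<open>Q\<close>. It turns
every Lebesgue average into a \<open>\<mu>\<close>-average, and it turns the hypothesis
\<open>b \<in> BMO(w)\<close> into the statement that \<open>\<rho>\<^sub>Q\<close> has bounded \<open>\<mu>\<close>-mean on \<open>Q\<close>.

\<^emph>\<open>From oscillation to boundedness.\<close> An average over \<open>Q \<times> Q\<close> of a product is a product of two
averages, so both bilinear operators are dominated by products of the maximal operator and
of the maximal commutator of a single function. Hoelder's inequality with
\<open>p/p\<^sub>1 + p/p\<^sub>2 = 1\<close> distributes the weights: \<open>w powr (1 - p)\<close> and \<open>w powr (1 - 2p)\<close> are exactly what
results if the maximal operator maps \<open>L\<^sup>q(w)\<close> to itself and the commutator maps \<open>L\<^sup>q(w)\<close> to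
\<open>L\<^sup>q(w powr (1 - q))\<close>. The second norm is the \<open>L\<^sup>q(\<mu>)\<close> norm of the commutator divided by \<open>w\<close>,
and at a point \<open>x\<close> of \<open>Q\<close> this quotient is at most a constant times
\<open>\<rho>\<^sub>Q(x) \<langle>u\<rangle>\<^sub>Q + \<langle>\<rho>\<^sub>Q u\<rangle>\<^sub>Q\<close>, where \<open>\<langle>.\<rangle>\<^sub>Q\<close> is the \<open>\<mu>\<close>-mean. Three facts bound it.

\<^item> Selection (\<open>carleson_selection\<close>): from finitely many cubes one selects a subfamily
  with \<open>\<Sum>\<^sub>S \<langle>u\<rangle>\<^sub>S\<^sup>q \<mu>(S) \<le> C \<integral> u\<^sup>q d\<mu>\<close>, such that each cube of positive mean lies in the triple of a
  selected one of at least half its mean. This gives the maximal theorem for \<open>\<mu>\<close>.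

\<^item> Exponential integrability (\<open>weighted_John_Nirenberg\<close>): \<open>exp (c \<rho>\<^sub>Q)\<close> has \<open>\<mu>\<close>-mean at most 2
  on \<open>Q\<close>. All powers of \<open>\<rho>\<^sub>Q\<close> therefore have bounded mean, which bounds
  \<open>\<langle>\<rho>\<^sub>Q u\<rangle>\<^sub>Q\<close> by the maximal function of a power of \<open>u\<close>.

\<^item> Change of cube (\<open>rho_change_cube\<close>): if \<open>Q\<close> lies in the triple \<open>F\<close> of a selected cube, then
  \<open>\<rho>\<^sub>Q(x)\<close> is at most \<open>\<rho>\<^sub>F(x)\<close> plus a maximal function of \<open>\<rho>\<^sub>F\<close>. Both have \<open>L\<^sup>q(\<mu>)\<close> norm at most a
  constant times \<open>\<mu>(F) powr (1/q)\<close> on \<open>F\<close>, so the supremum of \<open>\<rho>\<^sub>Q(x) \<langle>u\<rangle>\<^sub>Q\<close> over all cubes is controlled by the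
  Carleson sum of the selected ones.

Everything is first proved for finitely many cubes and then transferred by monotone
convergence to a countable family that majorizes all cubes.

\<^emph>\<open>From boundedness to oscillation.\<close> Apply the operator to the indicator of \<open>Q\<close> in both
arguments. With \<open>D(x)\<close> the mean of \<open>\<bar>b(x) - b\<bar>\<close> over \<open>Q\<close>, the operators are at
least \<open>D\<close> and \<open>D\<^sup>2\<close> on \<open>Q\<close>, so \<open>D\<^sup>s w powr (1 - s)\<close> has integral at most \<open>C \<mu>(Q)\<close> for \<open>s = p\<close> or
\<open>s = 2p\<close>. At some single point \<open>x\<close> of \<open>Q\<close> both \<open>D\<^sup>s w powr (1 - s)\<close> and \<open>w\<close> are at most a constant
times \<open>\<mu>(Q)/|Q|\<close>, and \<open>w\<close> is also at least a constant times it; hence \<open>D(x) \<le> C \<mu>(Q)/|Q|\<close>. Since the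
mean oscillation of \<open>b\<close> is at most \<open>2 D(x)\<close>, one point suffices, and the argument works for
\<open>p < 1\<close> as well.\<close>

section \<open>Selecting cubes with controlled averages\<close>

text \<open>The exponents are distinct and bounded above in terms of \<open>u\<close>, so the sum is dominated by its
largest term times a geometric series. This is what makes the sum over dyadic levels in the
selection below converge.\<close>

lemma geometric_sum_over_int_set_le:
  fixes K :: "int set" and t u :: real
  assumes "finite K" "0 < t" "0 < u" and small: "\<And>k. k \<in> K \<Longrightarrow> 2 powr (real_of_int k - 1) < u"
  shows "(\<Sum>k\<in>K. 2 powr ((real_of_int k + 1) * t)) \<le> 4 powr t / (1 - 2 powr (-t)) * u powr t"
proof (cases "K = {}")
  case True
  have "2 powr (-t) < (1::real)" using assms by (simp add: powr_less_one)
  then show ?thesis using True by simp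
next
  case False
  define N where "N = Max K"
  have N: "N \<in> K" "\<And>k. k \<in> K \<Longrightarrow> k \<le> N" unfolding N_def using assms False by auto
  let ?r = "2 powr (-t) :: real"
  have r: "0 \<le> ?r" "?r < 1" using assms by (simp_all add: powr_less_one)
  have eq: "2 powr ((real_of_int k + 1) * t) = 2 powr ((real_of_int N + 1) * t) * ?r ^ nat (N - k)" if "k \<in> K" for k
  proof -
    have "?r ^ nat (N - k) = 2 powr (-t * real (nat (N - k)))"
      by (simp add: powr_powr flip: powr_realpow)
    then show ?thesis using N(2)[OF that] by (simp add: algebra_simps flip: powr_add)
  qed
  have inj: "inj_on (\<lambda>k. nat (N - k)) K" using N(2) by (auto simp: inj_on_def) (smt (verit) nat_eq_iff2)
  have "(\<Sum>k\<in>K. ?r ^ nat (N - k)) = (\<Sum>i\<in>(\<lambda>k. nat (N - k)) ` K. ?r ^ i)"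
    using inj by (simp add: sum.reindex)
  also have "\<dots> \<le> (\<Sum>i. ?r ^ i)"
    by (rule sum_le_suminf) (use r assms in \<open>auto intro: summable_geometric\<close>)
  also have "\<dots> = 1 / (1 - ?r)" using r by (simp add: suminf_geometric)
  finally have S: "(\<Sum>k\<in>K. ?r ^ nat (N - k)) \<le> 1 / (1 - ?r)" .
  have "2 powr (real_of_int N + 1) = 4 * 2 powr (real_of_int N - 1)"
    by (simp add: powr_add powr_diff)
  then have "2 powr (real_of_int N + 1) \<le> 4 * u" using small[OF N(1)] by simp
  then have "(2 powr (real_of_int N + 1)) powr t \<le> (4 * u) powr t"
    using assms by (intro powr_mono2) auto
  then have NN: "2 powr ((real_of_int N + 1) * t) \<le> 4 powr t * u powr t"
    using assms by (simp add: powr_powr powr_mult)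
  have "(\<Sum>k\<in>K. 2 powr ((real_of_int k + 1) * t)) = 2 powr ((real_of_int N + 1) * t) * (\<Sum>k\<in>K. ?r ^ nat (N - k))"
    unfolding sum_distrib_left using eq by (intro sum.cong) auto
  also have "\<dots> \<le> (4 powr t * u powr t) * (1 / (1 - ?r))"
    using NN S r by (intro mult_mono) (auto intro: sum_nonneg)
  finally show ?thesis by simp
qed

text \<open>Vitali's argument: pick an element of maximal size, discard everything related to it, and repeat.\<close>

lemma greedy_selection:
  fixes R :: "'i \<Rightarrow> 'i \<Rightarrow> bool" and l :: "'i \<Rightarrow> real"
  assumes "finite A" and "\<And>i. i \<in> A \<Longrightarrow> R i i" and sym: "\<And>i j. R i j \<Longrightarrow> R j i"
  obtains J where "J \<subseteq> A" "\<And>i. i \<in> A \<Longrightarrow> \<exists>j\<in>J. R i j \<and> l i \<le> l j"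
    "\<And>i j. i \<in> J \<Longrightarrow> j \<in> J \<Longrightarrow> R i j \<Longrightarrow> i = j"
proof -
  have "\<exists>J\<subseteq>A. (\<forall>i\<in>A. \<exists>j\<in>J. R i j \<and> l i \<le> l j) \<and> (\<forall>i\<in>J. \<forall>j\<in>J. R i j \<longrightarrow> i = j)"
    using assms(1,2)
  proof (induction A rule: finite_psubset_induct)
    case (psubset A)
    show ?case
    proof (cases "A = {}")
      case False
      then have "finite (l ` A)" "l ` A \<noteq> {}" using psubset by auto
      then have "Max (l ` A) \<in> l ` A" by (rule Max_in)
      then obtain m where m0: "m \<in> A" "Max (l ` A) = l m" by (rule imageE)
      then have m: "m \<in> A" "\<And>i. i \<in> A \<Longrightarrow> l i \<le> l m"
        using \<open>finite (l ` A)\<close> by (auto simp flip: m0(2))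
      let ?A = "{i \<in> A. \<not> R i m}"
      have "?A \<subset> A" using m psubset.prems by auto
      then obtain J where J: "J \<subseteq> ?A" "\<forall>i\<in>?A. \<exists>j\<in>J. R i j \<and> l i \<le> l j" "\<forall>i\<in>J. \<forall>j\<in>J. R i j \<longrightarrow> i = j"
        using psubset.IH[of ?A] psubset.prems by auto
      have "insert m J \<subseteq> A" using J(1) m by auto
      moreover have "\<forall>i\<in>A. \<exists>j\<in>insert m J. R i j \<and> l i \<le> l j" using J(2) m by blast
      moreover have "\<forall>i\<in>insert m J. \<forall>j\<in>insert m J. R i j \<longrightarrow> i = j"
        using J(1,3) sym by blast
      ultimately show ?thesis by blast
    qed auto
  qed
  then show thesis using that by blast
qed

text \<open>Sort the sets by the dyadic level of their mean and select greedily within each level. The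
selected sets of one level are disjoint. On a set of mean \<open>m\<close> the part of \<open>u\<close> below \<open>m/2\<close>
carries at most half of the integral, so \<open>m M(Q)\<close> is at most twice the integral of the part above
half of the level. Multiply by \<open>m powr (s - 1)\<close> and sum: a point \<open>x\<close> is counted only for levels below
\<open>2 u(x)\<close>, at most once per level, which leaves a geometric sum.\<close>

lemma carleson_selection:
  fixes M :: "'a measure" and Q :: "'i \<Rightarrow> 'a set" and l m :: "'i \<Rightarrow> real" and u :: "'a \<Rightarrow> real" and s :: real
  assumes I: "finite I" and Q: "\<And>i. i \<in> I \<Longrightarrow> Q i \<in> sets M" "\<And>i. i \<in> I \<Longrightarrow> Q i \<noteq> {}"
    and fin: "\<And>i. i \<in> I \<Longrightarrow> emeasure M (Q i) < \<infinity>"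
    and u [measurable]: "u \<in> borel_measurable M" and u0: "\<And>x. 0 \<le> u x"
    and m: "\<And>i. i \<in> I \<Longrightarrow> 0 \<le> m i"
       "\<And>i. i \<in> I \<Longrightarrow> ennreal (m i) * emeasure M (Q i) = (\<integral>\<^sup>+x\<in>Q i. ennreal (u x) \<partial>M)"
    and s: "1 < s"
  obtains J where "J \<subseteq> I"
    "\<And>i. i \<in> I \<Longrightarrow> 0 < m i \<Longrightarrow> \<exists>j\<in>J. Q i \<inter> Q j \<noteq> {} \<and> l i \<le> l j \<and> m i \<le> 2 * m j"
    "(\<Sum>j\<in>J. ennreal (m j powr s) * emeasure M (Q j))
       \<le> ennreal (2 * (4 powr (s - 1) / (1 - 2 powr (1 - s)))) * (\<integral>\<^sup>+x. ennreal (u x powr s) \<partial>M)"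
proof -
  define \<kappa> where "\<kappa> i = \<lceil>log 2 (m i)\<rceil> - 1" for i
  have \<kappa>: "2 powr real_of_int (\<kappa> i) < m i" "m i \<le> 2 powr (real_of_int (\<kappa> i) + 1)" if "0 < m i" for i
  proof -
    have "real_of_int (\<kappa> i) < log 2 (m i)" "log 2 (m i) \<le> real_of_int (\<kappa> i) + 1"
      unfolding \<kappa>_def by linarith+
    then show "2 powr real_of_int (\<kappa> i) < m i" "m i \<le> 2 powr (real_of_int (\<kappa> i) + 1)"
      using that by (simp_all add: less_log_iff log_le_iff)
  qed
  define A where "A = {i \<in> I. 0 < m i}"
  \<comment> \<open>only sets of the same level compete, so selected sets of different levels may overlap\<close>
  define R where "R i j \<longleftrightarrow> \<kappa> i = \<kappa> j \<and> Q i \<inter> Q j \<noteq> {}" for i j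
  have "finite A" using I by (simp add: A_def)
  moreover have "R i i" if "i \<in> A" for i using that Q by (auto simp: A_def R_def)
  moreover have "R i j \<Longrightarrow> R j i" for i j by (auto simp: R_def)
  ultimately obtain J where J: "J \<subseteq> A" "\<And>i. i \<in> A \<Longrightarrow> \<exists>j\<in>J. R i j \<and> l i \<le> l j"
    "\<And>i j. i \<in> J \<Longrightarrow> j \<in> J \<Longrightarrow> R i j \<Longrightarrow> i = j" using greedy_selection[of A R l] by blast
  have JI: "J \<subseteq> I" and Jpos: "\<And>j. j \<in> J \<Longrightarrow> 0 < m j" and finJ: "finite J"
    using J(1) finite_subset[OF _ I, of J] by (auto simp: A_def)
  have Jm [measurable]: "\<And>j. j \<in> J \<Longrightarrow> Q j \<in> sets M" using JI Q by blast
  show thesis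
  proof (rule that[OF JI])
    fix i assume i: "i \<in> I" "0 < m i"
    then obtain j where j: "j \<in> J" "R i j" "l i \<le> l j" using J(2)[of i] by (auto simp: A_def)
    have "m i \<le> 2 powr (real_of_int (\<kappa> j) + 1)" using \<kappa>(2)[OF i(2)] j by (simp add: R_def)
    also have "\<dots> = 2 * 2 powr real_of_int (\<kappa> j)" by (simp add: powr_add)
    also have "\<dots> \<le> 2 * m j" using \<kappa>(1)[OF Jpos[OF j(1)]] by simp
    finally show "\<exists>j\<in>J. Q i \<inter> Q j \<noteq> {} \<and> l i \<le> l j \<and> m i \<le> 2 * m j" using j by (auto simp: R_def)
  next
    let ?t = "\<lambda>j. 2 powr (real_of_int (\<kappa> j) - 1) :: real"
    let ?U = "\<lambda>j x. if ?t j < u x then u x else 0"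
    let ?e = "\<lambda>j. 2 powr ((real_of_int (\<kappa> j) + 1) * (s - 1)) :: real"
    let ?C = "4 powr (s - 1) / (1 - 2 powr (1 - s)) :: real"
    have Cpos: "0 \<le> ?C" using s by (simp add: powr_le_one_le powr_less_one less_imp_le)
    have one: "ennreal (m j powr s) * emeasure M (Q j)
        \<le> (\<integral>\<^sup>+x. ennreal (2 * ?e j * ?U j x) * indicator (Q j) x \<partial>M)" if j: "j \<in> J" for j
    proof -
      have jI: "j \<in> I" using j JI by auto
      have mj: "0 < m j" using Jpos j by auto
      define E where "E = measure M (Q j)"
      have E: "emeasure M (Q j) = ennreal E" "0 \<le> E"
        using fin[OF jI] by (auto simp: E_def emeasure_eq_ennreal_measure)
      \<comment> \<open>the truncation level is half of the lower end of the dyadic interval that contains the mean\<close>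
      have half: "?t j \<le> m j / 2" using \<kappa>(1)[OF mj] by (simp add: powr_diff)
      have "ennreal (m j) * emeasure M (Q j) = (\<integral>\<^sup>+x. ennreal (u x) * indicator (Q j) x \<partial>M)"
        using m(2)[OF jI] .
      also have "\<dots> \<le> (\<integral>\<^sup>+x. ennreal (m j / 2) * indicator (Q j) x + ennreal (?U j x) * indicator (Q j) x \<partial>M)"
        using half u0 mj by (intro nn_integral_mono)
          (auto simp: indicator_def ennreal_plus[symmetric] intro!: ennreal_leI simp del: ennreal_plus)
      also have "\<dots> = ennreal (m j / 2) * emeasure M (Q j) + (\<integral>\<^sup>+x. ennreal (?U j x) * indicator (Q j) x \<partial>M)"
        using Jm[OF j] by (subst nn_integral_add) (auto simp: nn_integral_cmult)
      moreover have "ennreal (m j * E) = ennreal (m j) * emeasure M (Q j)"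
        "ennreal (m j / 2 * E) = ennreal (m j / 2) * emeasure M (Q j)"
        unfolding E(1) using E mj by (intro ennreal_mult; simp)+
      ultimately have le: "ennreal (m j * E) \<le> ennreal (m j / 2 * E) + (\<integral>\<^sup>+x. ennreal (?U j x) * indicator (Q j) x \<partial>M)"
        by simp
      have half2: "ennreal (m j * E) \<le> 2 * (\<integral>\<^sup>+x. ennreal (?U j x) * indicator (Q j) x \<partial>M)"
      proof (cases "(\<integral>\<^sup>+x. ennreal (?U j x) * indicator (Q j) x \<partial>M)")
        case (real v)
        then have "m j * E \<le> m j / 2 * E + v"
          using le E mj by (simp add: ennreal_le_iff flip: ennreal_plus)
        then have "m j * E \<le> 2 * v" by (simp add: field_simps)
        then have "ennreal (m j * E) \<le> ennreal (2 * v)" by (rule ennreal_leI)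
        then show ?thesis using real by (simp add: ennreal_mult)
      next
        case top
        then show ?thesis by (simp add: ennreal_mult_top)
      qed
      have mp: "m j powr s = m j powr (s - 1) * m j" using mj by (simp add: powr_diff)
      have "m j powr (s - 1) \<le> (2 powr (real_of_int (\<kappa> j) + 1)) powr (s - 1)"
        using \<kappa>(2)[OF mj] mj s by (intro powr_mono2) auto
      then have e: "m j powr (s - 1) \<le> ?e j" by (simp add: powr_powr)
      have "ennreal (m j powr s) * emeasure M (Q j) = ennreal (m j powr (s - 1)) * ennreal (m j * E)"
        using E mj by (simp add: mp ennreal_mult mult.assoc flip: ennreal_mult)
      also have "\<dots> \<le> ennreal (?e j) * (2 * (\<integral>\<^sup>+x. ennreal (?U j x) * indicator (Q j) x \<partial>M))"
        using e half2 by (intro mult_mono ennreal_leI) auto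
      also have "\<dots> = ennreal (2 * ?e j) * (\<integral>\<^sup>+x. ennreal (?U j x) * indicator (Q j) x \<partial>M)"
        by (simp add: ennreal_mult mult_ac)
      also have "\<dots> = (\<integral>\<^sup>+x. ennreal (2 * ?e j) * (ennreal (?U j x) * indicator (Q j) x) \<partial>M)"
        using Jm[OF j] by (subst nn_integral_cmult) auto
      also have "\<dots> = (\<integral>\<^sup>+x. ennreal (2 * ?e j * ?U j x) * indicator (Q j) x \<partial>M)"
        using u0 by (intro nn_integral_cong) (auto simp: ennreal_mult mult_ac)
      finally show ?thesis .
    qed
    have "(\<Sum>j\<in>J. ennreal (m j powr s) * emeasure M (Q j))
        \<le> (\<Sum>j\<in>J. \<integral>\<^sup>+x. ennreal (2 * ?e j * ?U j x) * indicator (Q j) x \<partial>M)"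
      by (intro sum_mono one)
    also have "\<dots> = (\<integral>\<^sup>+x. (\<Sum>j\<in>J. ennreal (2 * ?e j * ?U j x) * indicator (Q j) x) \<partial>M)"
      by (subst nn_integral_sum) auto
    also have "\<dots> \<le> (\<integral>\<^sup>+x. ennreal (2 * ?C) * ennreal (u x powr s) \<partial>M)"
    proof (intro nn_integral_mono)
      fix x
      define Jx where "Jx = {j \<in> J. x \<in> Q j \<and> ?t j < u x}"
      have inj: "inj_on \<kappa> Jx" using J(3) by (auto simp: inj_on_def Jx_def R_def)
      have eqx: "(\<Sum>j\<in>J. ennreal (2 * ?e j * ?U j x) * indicator (Q j) x) = ennreal (\<Sum>j\<in>Jx. 2 * ?e j * u x)"
      proof -
        have "(\<Sum>j\<in>J. ennreal (2 * ?e j * ?U j x) * indicator (Q j) x) = (\<Sum>j\<in>Jx. ennreal (2 * ?e j * u x))"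
          unfolding Jx_def using finJ by (intro sum.mono_neutral_cong_right) (auto simp: indicator_def)
        then show ?thesis using u0 by (simp add: sum_ennreal)
      qed
      show "(\<Sum>j\<in>J. ennreal (2 * ?e j * ?U j x) * indicator (Q j) x) \<le> ennreal (2 * ?C) * ennreal (u x powr s)"
      proof (cases "0 < u x")
        case True
        have "(\<Sum>j\<in>Jx. ?e j) = (\<Sum>k\<in>\<kappa> ` Jx. 2 powr ((real_of_int k + 1) * (s - 1)))"
          using inj by (simp add: sum.reindex)
        also have "\<dots> \<le> 4 powr (s - 1) / (1 - 2 powr (-(s - 1))) * u x powr (s - 1)"
          using finJ s True by (intro geometric_sum_over_int_set_le) (auto simp: Jx_def)
        finally have "(\<Sum>j\<in>Jx. ?e j) \<le> ?C * u x powr (s - 1)" by simp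
        then have "2 * u x * (\<Sum>j\<in>Jx. ?e j) \<le> 2 * u x * (?C * u x powr (s - 1))"
          using True by (intro mult_left_mono) auto
        also have "\<dots> = 2 * ?C * u x powr s" using True by (simp add: powr_diff)
        finally have "(\<Sum>j\<in>Jx. 2 * ?e j * u x) \<le> 2 * ?C * u x powr s"
          by (simp add: sum_distrib_left mult_ac)
        then show ?thesis unfolding eqx using Cpos by (simp add: ennreal_leI flip: ennreal_mult)
      next
        case False
        then have "u x = 0" using u0[of x] by simp
        then show ?thesis unfolding eqx by simp
      qed
    qed
    also have "\<dots> = ennreal (2 * ?C) * (\<integral>\<^sup>+x. ennreal (u x powr s) \<partial>M)"
      by (subst nn_integral_cmult) auto
    finally show "(\<Sum>j\<in>J. ennreal (m j powr s) * emeasure M (Q j))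
       \<le> ennreal (2 * ?C) * (\<integral>\<^sup>+x. ennreal (u x powr s) \<partial>M)" .
  qed
qed

section \<open>Cubes and their bisection\<close>

definition cube :: "real ^ 'n \<Rightarrow> real \<Rightarrow> (real ^ 'n) set" where
  "cube a l = cbox a (a + (\<chi> i. l))"

lemma is_cube_iff: "is_cube Q \<longleftrightarrow> (\<exists>a l. 0 < l \<and> Q = cube a l)"
  by (simp add: is_cube_def cube_def)

lemma mem_cube: "x \<in> cube a l \<longleftrightarrow> (\<forall>i. a $ i \<le> x $ i \<and> x $ i \<le> a $ i + l)"
  by (simp add: cube_def mem_box_cart)

lemma sets_lebesgue_cube [measurable, simp]: "cube a l \<in> sets lebesgue"
  by (simp add: cube_def)

lemma compact_cube [simp]: "compact (cube a l)"
  by (simp add: cube_def compact_cbox)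

lemma cube_nonempty: "0 \<le> l \<Longrightarrow> a \<in> cube a l"
  by (simp add: mem_cube)

lemma measure_cube: "0 \<le> l \<Longrightarrow> measure lebesgue (cube (a :: real ^ 'n) l) = l ^ CARD('n)"
  using content_cbox_cart[of a "a + (\<chi> i. l)"] cube_nonempty[of l a]
  by (auto simp: cube_def)

lemma emeasure_cube: "0 \<le> l \<Longrightarrow> emeasure lebesgue (cube (a :: real ^ 'n) l) = ennreal (l ^ CARD('n))"
proof -
  assume l: "0 \<le> l"
  have "emeasure lebesgue (cube a l) \<noteq> \<infinity>"
    using emeasure_lborel_cbox_finite[of a "a + (\<chi> i. l)"] by (auto simp: cube_def)
  then show ?thesis using measure_cube[OF l, of a] by (simp add: emeasure_eq_ennreal_measure)
qed

declare emeasure_completion [simp del]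

text \<open>The geometric input of the covering argument; a triple is written by its lower corner.\<close>

lemma cube_subset_triple_cube:
  assumes "cube a l \<inter> cube a' l' \<noteq> {}" "l \<le> l'"
  shows "cube a l \<subseteq> cube (a' - (\<chi> i. l')) (3 * l')"
proof
  fix x assume x: "x \<in> cube a l"
  obtain z where z: "z \<in> cube a l" "z \<in> cube a' l'" using assms(1) by auto
  show "x \<in> cube (a' - (\<chi> i. l')) (3 * l')"
    unfolding mem_cube
  proof
    fix i
    show "(a' - (\<chi> i. l')) $ i \<le> x $ i \<and> x $ i \<le> (a' - (\<chi> i. l')) $ i + 3 * l'"
      using x z assms(2) unfolding mem_cube by (auto dest!: spec[of _ i])
  qed
qed

lemma cube_subset_own_triple: "0 \<le> l \<Longrightarrow> cube a l \<subseteq> cube (a - (\<chi> i. l)) (3 * l)"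
  by (rule cube_subset_triple_cube) (use cube_nonempty in auto)

text \<open>Cubes of side \<open>2\<^sup>k\<^sup>+\<^sup>1\<close> with corners in the lattice of mesh \<open>2\<^sup>k\<close>. The overlap of neighbouring cubes is
what lets every cube of side at most \<open>2\<^sup>k\<close> fit into one of them.\<close>

definition grid_cubes :: "((real ^ 'n) \<times> real) set" where
  "grid_cubes = range (\<lambda>(z :: 'n \<Rightarrow> int, k :: int). ((\<chi> i. of_int (z i) * 2 powr of_int k), 2 powr (of_int k + 1)))"

lemma countable_grid_cubes: "countable grid_cubes"
  unfolding grid_cubes_def by (rule countable_image) simp

lemma grid_cubes_pos: "(a, l) \<in> grid_cubes \<Longrightarrow> 0 < l"
  by (auto simp: grid_cubes_def)

lemma cube_subset_grid_cube:
  fixes a :: "real ^ 'n"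
  assumes "0 < l"
  obtains a' l' where "(a', l') \<in> grid_cubes" "cube a l \<subseteq> cube a' l'" "l' \<le> 4 * l"
proof -
  define k where "k = \<lceil>log 2 l\<rceil>"
  have "log 2 l \<le> real_of_int k" "real_of_int k < log 2 l + 1" unfolding k_def by linarith+
  then have "l \<le> 2 powr real_of_int k" "2 powr real_of_int k < 2 powr (log 2 l + 1)"
    using assms by (simp_all add: log_le_iff)
  then have k: "l \<le> 2 powr real_of_int k" "2 powr real_of_int k < 2 * l"
    using assms by (simp_all add: powr_add)
  let ?h = "2 powr real_of_int k :: real"
  define z where "z i = \<lfloor>a $ i / ?h\<rfloor>" for i
  have z: "real_of_int (z i) * ?h \<le> a $ i" "a $ i < real_of_int (z i) * ?h + ?h" for i
  proof -
    have "real_of_int (z i) \<le> a $ i / ?h" "a $ i / ?h < real_of_int (z i) + 1"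
      unfolding z_def by linarith+
    then show "real_of_int (z i) * ?h \<le> a $ i" "a $ i < real_of_int (z i) * ?h + ?h"
      by (simp_all add: field_simps)
  qed
  show thesis
  proof (rule that[of "\<chi> i. of_int (z i) * ?h" "2 powr (real_of_int k + 1)"])
    show "((\<chi> i. of_int (z i) * ?h), 2 powr (real_of_int k + 1)) \<in> grid_cubes"
      unfolding grid_cubes_def by (rule range_eqI[of _ _ "(z, k)"]) simp
    show "cube a l \<subseteq> cube (\<chi> i. of_int (z i) * ?h) (2 powr (real_of_int k + 1))"
    proof
      fix x assume x: "x \<in> cube a l"
      have "of_int (z i) * ?h \<le> x $ i \<and> x $ i \<le> of_int (z i) * ?h + 2 * ?h" for i
        using z[of i] k x unfolding mem_cube by (auto dest!: spec[of _ i])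
      then show "x \<in> cube (\<chi> i. of_int (z i) * ?h) (2 powr (real_of_int k + 1))"
        by (simp add: mem_cube powr_add mult.commute)
    qed
    show "2 powr (real_of_int k + 1) \<le> 4 * l" using k by (simp add: powr_add)
  qed
qed

text \<open>The \<open>2\<^sup>n\<close> halves of a cube are indexed by the set \<open>S\<close> of coordinates in which the upper half is taken.\<close>

definition corner :: "real ^ 'n \<Rightarrow> real \<Rightarrow> 'n set \<Rightarrow> real ^ 'n" where
  "corner a l S = (\<chi> i. if i \<in> S then a $ i + l / 2 else a $ i)"

lemma child_subset: "0 \<le> l \<Longrightarrow> cube (corner a l S) (l / 2) \<subseteq> cube a l"
proof
  fix x assume "0 \<le> l" and x: "x \<in> cube (corner a l S) (l / 2)"
  have "a $ i \<le> x $ i \<and> x $ i \<le> a $ i + l" for i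
    using x \<open>0 \<le> l\<close> unfolding mem_cube corner_def by (auto dest!: spec[of _ i] split: if_splits)
  then show "x \<in> cube a l" by (simp add: mem_cube)
qed

text \<open>The index of a half containing a given point of the cube; points on the bisecting hyperplanes, which
lie in several halves, are assigned to one of them by this choice.\<close>

definition upper_coords :: "real ^ 'n \<Rightarrow> real \<Rightarrow> real ^ 'n \<Rightarrow> 'n set" where
  "upper_coords a l x = {i. a $ i + l / 2 < x $ i}"

lemma in_selected_child:
  assumes "x \<in> cube a l"
  shows "x \<in> cube (corner a l (upper_coords a l x)) (l / 2)"
  unfolding mem_cube
proof
  fix i
  have "a $ i \<le> x $ i" "x $ i \<le> a $ i + l" using assms by (auto simp: mem_cube)
  then show "corner a l (upper_coords a l x) $ i \<le> x $ i \<and>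
        x $ i \<le> corner a l (upper_coords a l x) $ i + l / 2"
    by (auto simp: corner_def upper_coords_def)
qed

lemma AE_child_iff_selected:
  fixes a :: "real ^ 'n"
  assumes "0 \<le> l"
  shows "AE x in lebesgue. x \<in> cube a l \<longrightarrow> (\<forall>S. x \<in> cube (corner a l S) (l / 2) \<longleftrightarrow> S = upper_coords a l x)"
proof -
  have hyperplane: "negligible {x::real^'n. x $ i = c}" for i c
    using negligible_standard_hyperplane[of "axis i (1::real)" c] by (simp add: cart_eq_inner_axis axis_in_Basis_iff)
  have "negligible (\<Union>i::'n. {x::real^'n. x $ i = a $ i + l / 2})"
    by (rule negligible_Union) (auto simp: hyperplane)
  then have N: "(\<Union>i::'n. {x::real^'n. x $ i = a $ i + l / 2}) \<in> null_sets lebesgue"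
    by (simp add: negligible_iff_null_sets)
  show ?thesis
  proof (rule AE_I'[OF N], rule subsetI, rule ccontr)
    fix x
    assume x: "x \<in> {x \<in> space lebesgue. \<not> (x \<in> cube a l \<longrightarrow>
        (\<forall>S. (x \<in> cube (corner a l S) (l / 2)) = (S = upper_coords a l x)))}"
      and "x \<notin> (\<Union>i. {x. x $ i = a $ i + l / 2})"
    then have ne: "x $ i \<noteq> a $ i + l / 2" for i by auto
    from x obtain S where S: "x \<in> cube a l" "\<not> ((x \<in> cube (corner a l S) (l / 2)) = (S = upper_coords a l x))"
      by auto
    have "S = upper_coords a l x" if "x \<in> cube (corner a l S) (l / 2)"
    proof (rule set_eqI)
      fix i
      have "corner a l S $ i \<le> x $ i \<and> x $ i \<le> corner a l S $ i + l / 2"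
        using that by (simp add: mem_cube)
      then show "i \<in> S \<longleftrightarrow> i \<in> upper_coords a l x"
        using ne[of i] by (auto simp: corner_def upper_coords_def split: if_splits)
    qed
    then show False using S in_selected_child[OF S(1)] by auto
  qed
qed

text \<open>The integrand may depend on the half in which the point lies: the form needed for functions that are
defined by descending through the dyadic subcubes.\<close>

lemma nn_integral_bisect_selected:
  fixes a :: "real ^ 'n" and g :: "'n set \<Rightarrow> real ^ 'n \<Rightarrow> ennreal"
  assumes "0 \<le> l" and [measurable]: "\<And>S. g S \<in> borel_measurable lebesgue"
  shows "(\<integral>\<^sup>+x\<in>cube a l. g (upper_coords a l x) x \<partial>lebesgue)
     = (\<Sum>S\<in>UNIV. \<integral>\<^sup>+x\<in>cube (corner a l S) (l / 2). g S x \<partial>lebesgue)"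
proof -
  have "(\<integral>\<^sup>+x\<in>cube a l. g (upper_coords a l x) x \<partial>lebesgue)
      = (\<integral>\<^sup>+x. (\<Sum>S\<in>UNIV. g S x * indicator (cube (corner a l S) (l / 2)) x) \<partial>lebesgue)"
  proof (rule nn_integral_cong_AE)
    show "AE x in lebesgue. g (upper_coords a l x) x * indicator (cube a l) x
        = (\<Sum>S\<in>UNIV. g S x * indicator (cube (corner a l S) (l / 2)) x)"
      using AE_child_iff_selected[OF assms(1), of a]
    proof eventually_elim
      case (elim x)
      show ?case
      proof (cases "x \<in> cube a l")
        case True
        then have "(\<Sum>S\<in>UNIV. g S x * indicator (cube (corner a l S) (l / 2)) x)
            = (\<Sum>S\<in>UNIV. if S = upper_coords a l x then g S x else 0)"
          using elim by (intro sum.cong) (auto simp: indicator_def)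
        then show ?thesis using True by simp
      next
        case False
        then have "x \<notin> cube (corner a l S) (l / 2)" for S using child_subset[OF assms(1)] by blast
        then show ?thesis using False by simp
      qed
    qed
  qed
  also have "\<dots> = (\<Sum>S\<in>UNIV. \<integral>\<^sup>+x\<in>cube (corner a l S) (l / 2). g S x \<partial>lebesgue)"
    by (rule nn_integral_sum) auto
  finally show ?thesis .
qed

lemma nn_integral_bisect:
  fixes a :: "real ^ 'n"
  assumes "0 \<le> l" and "f \<in> borel_measurable lebesgue"
  shows "(\<integral>\<^sup>+x\<in>cube a l. f x \<partial>lebesgue)
     = (\<Sum>S\<in>UNIV. \<integral>\<^sup>+x\<in>cube (corner a l S) (l / 2). f x \<partial>lebesgue)"
  using nn_integral_bisect_selected[OF assms(1), of "\<lambda>_. f" a] assms(2) by simp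

section \<open>\<open>A\<^sub>1\<close> weights and the weighted maximal operator\<close>

text \<open>The \<open>A\<^sub>1\<close> condition in the form in which it is used: \<open>w(Q) \<le> C\<^sub>1 |Q| w(x)\<close> for almost all \<open>x \<in> Q\<close>.\<close>

locale a1_weight =
  fixes w :: "real ^ 'n \<Rightarrow> real" and C1 :: real
  assumes w_meas [measurable]: "w \<in> borel_measurable lebesgue"
    and w_nonneg: "0 \<le> w x"
    and w_pos: "AE x in lebesgue. 0 < w x"
    and w_finite: "(\<integral>\<^sup>+x\<in>cube a l. ennreal (w x) \<partial>lebesgue) < \<infinity>"
    and C1_ge_1: "1 \<le> C1"
    and A1: "0 < l \<Longrightarrow> AE x in lebesgue. x \<in> cube a l \<longrightarrow>
        enn2real (\<integral>\<^sup>+x\<in>cube a l. ennreal (w x) \<partial>lebesgue) \<le> C1 * w x * l ^ CARD('n)"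
begin

definition \<mu> :: "(real ^ 'n) measure" where "\<mu> = density lebesgue (\<lambda>x. ennreal (w x))"

lemma sets_mu [measurable_cong, simp]: "sets \<mu> = sets lebesgue"
  by (simp add: \<mu>_def)

lemma space_mu [simp]: "space \<mu> = UNIV"
  by (simp add: \<mu>_def)

lemma measurable_mu [simp]: "borel_measurable \<mu> = borel_measurable lebesgue"
  by (rule measurable_cong_sets) auto

lemma AE_mu: "(AE x in lebesgue. P x) \<Longrightarrow> AE x in \<mu>. P x"
  unfolding \<mu>_def by (subst AE_density) auto

lemma nn_integral_mu:
  "f \<in> borel_measurable lebesgue \<Longrightarrow> (\<integral>\<^sup>+x. f x \<partial>\<mu>) = (\<integral>\<^sup>+x. ennreal (w x) * f x \<partial>lebesgue)"
  unfolding \<mu>_def by (rule nn_integral_density) auto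

lemma emeasure_mu: "A \<in> sets lebesgue \<Longrightarrow> emeasure \<mu> A = (\<integral>\<^sup>+x\<in>A. ennreal (w x) \<partial>lebesgue)"
  unfolding \<mu>_def by (subst emeasure_density) auto

definition W :: "real ^ 'n \<Rightarrow> real \<Rightarrow> real" where "W a l = measure \<mu> (cube a l)"

lemma emeasure_mu_cube: "emeasure \<mu> (cube a l) = ennreal (W a l)"
  unfolding W_def using w_finite[where a=a and l=l]
  by (intro emeasure_eq_ennreal_measure) (simp add: emeasure_mu less_top)

lemma W_eq: "W a l = enn2real (\<integral>\<^sup>+x\<in>cube a l. ennreal (w x) \<partial>lebesgue)"
  by (simp add: W_def measure_def emeasure_mu)

lemma W_nonneg: "0 \<le> W a l" by (simp add: W_def)

lemma W_pos: assumes "0 < l" shows "0 < W a l"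
proof (rule ccontr)
  assume "\<not> 0 < W a l"
  then have "W a l = 0" using W_nonneg[of a l] by simp
  then have "(\<integral>\<^sup>+x. ennreal (w x) * indicator (cube a l) x \<partial>lebesgue) = 0"
    using emeasure_mu_cube[of a l] by (simp add: emeasure_mu)
  then have "AE x in lebesgue. ennreal (w x) * indicator (cube a l) x = 0"
    by (subst (asm) nn_integral_0_iff_AE) auto
  with w_pos have "AE x in lebesgue. x \<notin> cube a l"
    by eventually_elim (auto simp: indicator_def split: if_splits)
  then have "emeasure lebesgue (cube a l) = 0"
    by (subst (asm) AE_iff_measurable[OF sets_lebesgue_cube]) auto
  then show False using assms by (simp add: emeasure_cube)
qed

lemma W_le: "0 < l \<Longrightarrow> AE x in lebesgue. x \<in> cube a l \<longrightarrow> W a l / l ^ CARD('n) \<le> C1 * w x"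
  using A1[of l a] by (auto simp: W_eq[symmetric] pos_divide_le_eq elim: eventually_mono)

text \<open>The factor \<open>\<mu>(Q)/|Q|\<close> is below \<open>C\<^sub>1 w\<close>, so it can be moved under the integral, where it becomes the
density of \<open>\<mu>\<close>. Doubling and the comparison of Lebesgue means with \<open>\<mu>\<close>-means are instances.\<close>

lemma nn_integral_cube_le_mu:
  assumes "0 < l" and [measurable]: "f \<in> borel_measurable lebesgue" and "cube a' l' \<subseteq> cube a l"
  shows "ennreal (W a l / l ^ CARD('n)) * (\<integral>\<^sup>+x\<in>cube a' l'. f x \<partial>lebesgue)
      \<le> ennreal C1 * (\<integral>\<^sup>+x\<in>cube a' l'. f x \<partial>\<mu>)"
proof -
  have "ennreal (W a l / l ^ CARD('n)) * (\<integral>\<^sup>+x\<in>cube a' l'. f x \<partial>lebesgue)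
      = (\<integral>\<^sup>+x. ennreal (W a l / l ^ CARD('n)) * (f x * indicator (cube a' l') x) \<partial>lebesgue)"
    by (subst nn_integral_cmult) auto
  also have "\<dots> \<le> (\<integral>\<^sup>+x. ennreal C1 * (ennreal (w x) * (f x * indicator (cube a' l') x)) \<partial>lebesgue)"
  proof (intro nn_integral_mono_AE)
    show "AE x in lebesgue. ennreal (W a l / l ^ CARD('n)) * (f x * indicator (cube a' l') x)
        \<le> ennreal C1 * (ennreal (w x) * (f x * indicator (cube a' l') x))"
      using W_le[OF assms(1), of a]
    proof eventually_elim
      case (elim x)
      show ?case
      proof (cases "x \<in> cube a' l'")
        case True
        then have "ennreal (W a l / l ^ CARD('n)) \<le> ennreal (C1 * w x)"
          using elim assms by (intro ennreal_leI) auto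
        then have "ennreal (W a l / l ^ CARD('n)) * f x \<le> ennreal (C1 * w x) * f x"
          by (rule mult_right_mono) simp
        then show ?thesis using True C1_ge_1 w_nonneg[of x] by (simp add: ennreal_mult mult.assoc)
      qed simp
    qed
  qed
  also have "\<dots> = ennreal C1 * (\<integral>\<^sup>+x\<in>cube a' l'. f x \<partial>\<mu>)"
    by (subst nn_integral_mu) (auto simp: nn_integral_cmult)
  finally show ?thesis .
qed

text \<open>Apply the comparison to the constant function, on the cube as a part of its triple.\<close>

lemma doubling:
  assumes "0 < l"
  shows "W (a - (\<chi> i. l)) (3 * l) \<le> 3 ^ CARD('n) * C1 * W a l"
proof -
  let ?V = "W (a - (\<chi> i. l)) (3 * l)"
  have "ennreal (?V / (3 * l) ^ CARD('n)) * (\<integral>\<^sup>+x\<in>cube a l. 1 \<partial>lebesgue)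
      \<le> ennreal C1 * (\<integral>\<^sup>+x\<in>cube a l. 1 \<partial>\<mu>)"
    using assms cube_subset_own_triple[of l a] by (intro nn_integral_cube_le_mu) auto
  then have "ennreal (?V / (3 * l) ^ CARD('n)) * ennreal (l ^ CARD('n)) \<le> ennreal C1 * ennreal (W a l)"
    using assms by (simp add: emeasure_cube emeasure_mu_cube)
  then have "?V / (3 * l) ^ CARD('n) * l ^ CARD('n) \<le> C1 * W a l"
    using assms C1_ge_1 W_nonneg by (simp add: ennreal_le_iff flip: ennreal_mult)
  then show ?thesis using assms by (simp add: power_mult_distrib field_simps)
qed

definition mean :: "real ^ 'n \<Rightarrow> real \<Rightarrow> (real ^ 'n \<Rightarrow> real) \<Rightarrow> real" where
  "mean a l u = enn2real (\<integral>\<^sup>+x\<in>cube a l. ennreal (u x) \<partial>\<mu>) / W a l"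

lemma mean_nonneg: "0 \<le> mean a l u"
  by (simp add: mean_def W_nonneg)

lemma mean_eq:
  assumes "0 < l" "(\<integral>\<^sup>+x\<in>cube a l. ennreal (u x) \<partial>\<mu>) < \<infinity>"
  shows "ennreal (mean a l u) * ennreal (W a l) = (\<integral>\<^sup>+x\<in>cube a l. ennreal (u x) \<partial>\<mu>)"
  using assms W_pos[OF assms(1), of a]
  by (simp add: mean_def less_top flip: ennreal_mult)

abbreviation pow_int :: "(real ^ 'n \<Rightarrow> real) \<Rightarrow> real \<Rightarrow> ennreal" where
  "pow_int u q \<equiv> \<integral>\<^sup>+x. ennreal (u x powr q) \<partial>\<mu>"

lemma powr_integrable_on_cube:
  assumes [measurable]: "u \<in> borel_measurable lebesgue" and u0: "\<And>x. 0 \<le> u x"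
    and s: "1 \<le> s" and fin: "pow_int u s < \<infinity>"
  shows "(\<integral>\<^sup>+x\<in>cube a l. ennreal (u x) \<partial>\<mu>) < \<infinity>"
proof -
  have "(\<integral>\<^sup>+x\<in>cube a l. ennreal (u x) \<partial>\<mu>)
      \<le> (\<integral>\<^sup>+x. indicator (cube a l) x + ennreal (u x powr s) \<partial>\<mu>)"
  proof (intro nn_integral_mono)
    fix x
    have "u x \<le> 1 + u x powr s"
    proof (cases "u x \<le> 1")
      case False
      then have "u x powr 1 \<le> u x powr s" using s by (intro powr_mono) auto
      then show ?thesis using False by simp
    qed (use powr_ge_zero[of "u x" s] in linarith)
    then have "ennreal (u x) \<le> 1 + ennreal (u x powr s)"
      using ennreal_leI[of "u x" "1 + u x powr s"] by (simp add: ennreal_plus)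
    then show "ennreal (u x) * indicator (cube a l) x \<le> indicator (cube a l) x + ennreal (u x powr s)"
      by (auto simp: indicator_def)
  qed
  also have "\<dots> = emeasure \<mu> (cube a l) + pow_int u s"
    by (subst nn_integral_add) auto
  also have "\<dots> < \<infinity>" using fin by (simp add: emeasure_mu_cube)
  finally show ?thesis .
qed

definition Cmax :: "real \<Rightarrow> real" where
  "Cmax s = 3 ^ CARD('n) * C1 * 2 powr s * (2 * (4 powr (s - 1) / (1 - 2 powr (1 - s))))"

lemma Cmax_nonneg: "1 < s \<Longrightarrow> 0 \<le> Cmax s"
  using C1_ge_1 by (simp add: Cmax_def powr_less_one less_imp_le)

text \<open>The selection for cubes and \<open>\<mu>\<close>, with the Carleson sum taken over the triples, which doubling allows.
The factor 2 in front of the mean compensates for the loss in comparing means.\<close>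

lemma tripled_selection:
  fixes u :: "real ^ 'n \<Rightarrow> real"
  assumes I: "finite I" "\<forall>i\<in>I. 0 < snd i"
    and [measurable]: "u \<in> borel_measurable lebesgue" and u0: "\<And>x. 0 \<le> u x"
    and s: "1 < s" and fin: "pow_int u s < \<infinity>"
  obtains J where "J \<subseteq> I"
    "\<forall>(a, l)\<in>I. 0 < mean a l u \<longrightarrow>
       (\<exists>(a', l')\<in>J. cube a l \<subseteq> cube (a' - (\<chi> i. l')) (3 * l') \<and> mean a l u \<le> 2 * mean a' l' u)"
    "(\<Sum>(a, l)\<in>J. ennreal ((2 * mean a l u) powr s) * emeasure \<mu> (cube (a - (\<chi> i. l)) (3 * l)))
       \<le> ennreal (Cmax s) * pow_int u s"
proof -
  let ?K = "2 * (4 powr (s - 1) / (1 - 2 powr (1 - s))) :: real"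
  have K0: "0 \<le> ?K" using s by (simp add: powr_less_one less_imp_le)
  obtain J where J: "J \<subseteq> I"
    "\<And>i. i \<in> I \<Longrightarrow> 0 < mean (fst i) (snd i) u \<Longrightarrow>
       \<exists>j\<in>J. cube (fst i) (snd i) \<inter> cube (fst j) (snd j) \<noteq> {} \<and> snd i \<le> snd j \<and>
         mean (fst i) (snd i) u \<le> 2 * mean (fst j) (snd j) u"
    "(\<Sum>j\<in>J. ennreal (mean (fst j) (snd j) u powr s) * emeasure \<mu> (cube (fst j) (snd j)))
       \<le> ennreal ?K * pow_int u s"
  proof (rule carleson_selection[of I "\<lambda>i. cube (fst i) (snd i)" \<mu> u "\<lambda>i. mean (fst i) (snd i) u" s snd])
    fix i assume i: "i \<in> I"
    then have p: "0 < snd i" using I(2) by simp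
    show "cube (fst i) (snd i) \<noteq> {}" using cube_nonempty[of "snd i" "fst i"] p by auto
    show "ennreal (mean (fst i) (snd i) u) * emeasure \<mu> (cube (fst i) (snd i))
        = (\<integral>\<^sup>+x\<in>cube (fst i) (snd i). ennreal (u x) \<partial>\<mu>)"
      unfolding emeasure_mu_cube
      using s by (intro mean_eq p powr_integrable_on_cube[OF _ u0 _ fin]) auto
  qed (use I s u0 in \<open>auto simp: emeasure_mu_cube mean_nonneg\<close>)
  show thesis
  proof (rule that[OF J(1)])
    show "\<forall>(a, l)\<in>I. 0 < mean a l u \<longrightarrow>
       (\<exists>(a', l')\<in>J. cube a l \<subseteq> cube (a' - (\<chi> i. l')) (3 * l') \<and> mean a l u \<le> 2 * mean a' l' u)"
    proof (clarify)
      fix a l assume "(a, l) \<in> I" "0 < mean a l u"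
      then obtain j where j: "j \<in> J" "cube a l \<inter> cube (fst j) (snd j) \<noteq> {}" "l \<le> snd j"
        "mean a l u \<le> 2 * mean (fst j) (snd j) u" using J(2)[of "(a, l)"] by auto
      show "\<exists>(a', l')\<in>J. cube a l \<subseteq> cube (a' - (\<chi> i. l')) (3 * l') \<and> mean a l u \<le> 2 * mean a' l' u"
        using cube_subset_triple_cube[OF j(2,3)] j(1,4) by (intro bexI[of _ j]) (auto simp: case_prod_beta)
    qed
  next
    let ?D = "3 ^ CARD('n) * C1 * 2 powr s"
    have D0: "0 \<le> ?D" using C1_ge_1 by simp
    have "(\<Sum>(a, l)\<in>J. ennreal ((2 * mean a l u) powr s) * emeasure \<mu> (cube (a - (\<chi> i. l)) (3 * l)))
       \<le> (\<Sum>(a, l)\<in>J. ennreal ?D * (ennreal (mean a l u powr s) * emeasure \<mu> (cube a l)))"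
    proof (intro sum_mono, clarify)
      fix a l assume "(a, l) \<in> J"
      then have "(a, l) \<in> I" using J(1) by blast
      then have "0 < l" using I(2) by auto
      then have "(2 * mean a l u) powr s * W (a - (\<chi> i. l)) (3 * l) \<le> ?D * (mean a l u powr s * W a l)"
        using mult_left_mono[OF doubling[of l a], of "(2 * mean a l u) powr s"]
        by (simp add: powr_mult mean_nonneg mult_ac)
      then have "ennreal ((2 * mean a l u) powr s * W (a - (\<chi> i. l)) (3 * l)) \<le> ennreal (?D * (mean a l u powr s * W a l))"
        by (rule ennreal_leI)
      then show "ennreal ((2 * mean a l u) powr s) * emeasure \<mu> (cube (a - (\<chi> i. l)) (3 * l))
          \<le> ennreal ?D * (ennreal (mean a l u powr s) * emeasure \<mu> (cube a l))"
        using D0 W_nonneg by (simp add: emeasure_mu_cube flip: ennreal_mult)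
    qed
    also have "\<dots> = ennreal ?D * (\<Sum>j\<in>J. ennreal (mean (fst j) (snd j) u powr s) * emeasure \<mu> (cube (fst j) (snd j)))"
      by (simp add: sum_distrib_left case_prod_beta)
    also have "\<dots> \<le> ennreal ?D * (ennreal ?K * pow_int u s)"
      using J(3) by (rule mult_left_mono) simp
    also have "\<dots> = ennreal (Cmax s) * pow_int u s"
      unfolding Cmax_def mult.assoc[symmetric] using ennreal_mult[OF D0 K0] by (simp only: mult.assoc)
    finally show "(\<Sum>(a, l)\<in>J. ennreal ((2 * mean a l u) powr s) * emeasure \<mu> (cube (a - (\<chi> i. l)) (3 * l)))
       \<le> ennreal (Cmax s) * pow_int u s" .
  qed
qed

text \<open>The maximal theorem for \<open>\<mu>\<close>. The maximal function is replaced by the measurable majorant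
\<open>\<Sum> (2 \<langle>u\<rangle>\<^sub>S)\<^sup>s\<close>, summed over the triples that contain the point.\<close>

lemma finite_maximal_majorant:
  fixes u :: "real ^ 'n \<Rightarrow> real"
  assumes I: "finite I" "\<forall>i\<in>I. 0 < snd i"
    and [measurable]: "u \<in> borel_measurable lebesgue" and u0: "\<And>x. 0 \<le> u x"
    and s: "1 < s" and fin: "pow_int u s < \<infinity>"
  obtains G :: "real ^ 'n \<Rightarrow> real" where "G \<in> borel_measurable lebesgue" "\<forall>x. 0 \<le> G x"
    "\<forall>(a, l)\<in>I. \<forall>x\<in>cube a l. mean a l u powr s \<le> G x"
    "(\<integral>\<^sup>+x. ennreal (G x) \<partial>\<mu>) \<le> ennreal (Cmax s) * pow_int u s"
proof -
  obtain J where J: "J \<subseteq> I"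
    "\<forall>(a, l)\<in>I. 0 < mean a l u \<longrightarrow>
       (\<exists>(a', l')\<in>J. cube a l \<subseteq> cube (a' - (\<chi> i. l')) (3 * l') \<and> mean a l u \<le> 2 * mean a' l' u)"
    "(\<Sum>(a, l)\<in>J. ennreal ((2 * mean a l u) powr s) * emeasure \<mu> (cube (a - (\<chi> i. l)) (3 * l)))
       \<le> ennreal (Cmax s) * pow_int u s"
    by (rule tripled_selection[OF I assms(3) u0 s fin])
  have finJ: "finite J" using J(1) I(1) finite_subset by blast
  let ?T = "\<lambda>j. cube (fst j - (\<chi> i. snd j)) (3 * snd j)"
  let ?m = "\<lambda>j. (2 * mean (fst j) (snd j) u) powr s"
  let ?G = "\<lambda>x. \<Sum>j\<in>J. ?m j * indicator (?T j) x"
  show thesis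
  proof (rule that[of ?G])
    show "?G \<in> borel_measurable lebesgue" by measurable
    show "\<forall>x. 0 \<le> ?G x" by (auto intro: sum_nonneg)
    have "mean a l u powr s \<le> ?G x" if ax: "(a, l) \<in> I" "x \<in> cube a l" for a l x
    proof (cases "0 < mean a l u")
      case True
      obtain j where j: "j \<in> J" "cube a l \<subseteq> ?T j" "mean a l u \<le> 2 * mean (fst j) (snd j) u"
        using bspec[OF J(2) ax(1)] True by (auto simp: case_prod_beta)
      have "mean a l u powr s \<le> ?m j"
        using j(3) True s by (intro powr_mono2) auto
      also have "\<dots> = ?m j * indicator (?T j) x" using j(2) ax(2) by auto
      also have "\<dots> \<le> ?G x" using j(1) finJ by (intro member_le_sum) auto
      finally show ?thesis .
    next
      case False
      then have "mean a l u = 0" using mean_nonneg[of a l u] by simp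
      then show ?thesis using sum_nonneg[of J "\<lambda>j. ?m j * indicator (?T j) x"] by simp
    qed
    then show "\<forall>(a, l)\<in>I. \<forall>x\<in>cube a l. mean a l u powr s \<le> ?G x" by auto
    have "(\<integral>\<^sup>+x. ennreal (?G x) \<partial>\<mu>) = (\<integral>\<^sup>+x. (\<Sum>j\<in>J. ennreal (?m j) * indicator (?T j) x) \<partial>\<mu>)"
      by (intro nn_integral_cong) (simp add: ennreal_mult ennreal_indicator flip: sum_ennreal)
    also have "\<dots> = (\<Sum>j\<in>J. ennreal (?m j) * emeasure \<mu> (?T j))"
      by (subst nn_integral_sum) (auto simp: nn_integral_cmult)
    finally show "(\<integral>\<^sup>+x. ennreal (?G x) \<partial>\<mu>) \<le> ennreal (Cmax s) * pow_int u s"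
      using J(3) by (simp add: case_prod_beta)
  qed
qed

end

section \<open>Convergence of dyadic averages\<close>

lemma set_integrable_cube_iff:
  fixes f :: "real ^ 'n \<Rightarrow> real"
  assumes [measurable]: "f \<in> borel_measurable lebesgue"
  shows "set_integrable lebesgue (cube a l) f \<longleftrightarrow> (\<integral>\<^sup>+x\<in>cube a l. ennreal \<bar>f x\<bar> \<partial>lebesgue) < \<infinity>"
proof -
  have "(\<integral>\<^sup>+x. ennreal (norm (indicator (cube a l) x *\<^sub>R f x)) \<partial>lebesgue) = (\<integral>\<^sup>+x\<in>cube a l. ennreal \<bar>f x\<bar> \<partial>lebesgue)"
    by (intro nn_integral_cong) (auto simp: indicator_def)
  then show ?thesis unfolding set_integrable_def integrable_iff_bounded by auto
qed

lemma emeasure_cube_finite: "emeasure lebesgue (cube a l) < \<infinity>"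
  using fmeasurableD2[OF lmeasurable_cbox, of a "a + (\<chi> i. l)"] by (simp add: cube_def less_top)

lemma set_integrable_const_cube: "set_integrable lebesgue (cube a l) (\<lambda>_. c :: real)"
  by (subst absolutely_integrable_on_const[of "cube a l" c, THEN eq_True[THEN iffD2]]) 
     (auto simp: cube_def)

text \<open>Multiplied by the volume of the cube, so that the right-hand side is monotone in the cube.\<close>

lemma average_diff_le:
  fixes f :: "real ^ 'n \<Rightarrow> real"
  assumes "0 < l" "set_integrable lebesgue (cube a l) f"
  shows "ennreal \<bar>average f (cube a l) - c\<bar> * ennreal (l ^ CARD('n)) \<le> (\<integral>\<^sup>+x\<in>cube a l. ennreal \<bar>f x - c\<bar> \<partial>lebesgue)"
proof -
  let ?Q = "cube a l"
  have ic: "set_integrable lebesgue ?Q (\<lambda>_. c)" by (rule set_integrable_const_cube)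
  have m: "measure lebesgue ?Q = l ^ CARD('n)" using assms(1) by (simp add: measure_cube)
  have "emeasure lebesgue ?Q < \<infinity>" using assms(1) by (simp add: emeasure_cube)
  then have const: "(LINT y:?Q|lebesgue. c) = c * l ^ CARD('n)"
    unfolding set_lebesgue_integral_def by (subst integral_scaleR_left) (auto simp: m)
  have "(LINT y:?Q|lebesgue. f y - c) = (LINT y:?Q|lebesgue. f y) - c * l ^ CARD('n)"
    using assms(2) ic by (simp add: set_integral_diff(2) const)
  then have "(average f ?Q - c) * l ^ CARD('n) = (LINT y:?Q|lebesgue. f y - c)"
    using assms(1) by (simp add: average_def m left_diff_distrib)
  then have "\<bar>average f ?Q - c\<bar> * l ^ CARD('n) = \<bar>LINT y:?Q|lebesgue. f y - c\<bar>"
    using assms(1) by (metis abs_mult abs_of_pos zero_less_power)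
  also have "ennreal \<dots> \<le> (\<integral>\<^sup>+x. ennreal (norm (indicator ?Q x *\<^sub>R (f x - c))) \<partial>lebesgue)"
    unfolding set_lebesgue_integral_def real_norm_def[symmetric]
    using set_integral_diff(1)[OF assms(2) ic] unfolding set_integrable_def
    by (intro integral_norm_bound_ennreal)
  also have "\<dots> = (\<integral>\<^sup>+x\<in>?Q. ennreal \<bar>f x - c\<bar> \<partial>lebesgue)"
    by (intro nn_integral_cong) (auto simp: indicator_def)
  finally show ?thesis using assms(1) by (simp add: ennreal_mult)
qed

lemma average_close:
  fixes f :: "real ^ 'n \<Rightarrow> real"
  assumes "0 < l" "set_integrable lebesgue (cube a l) f" "0 \<le> e"
    and "\<And>x. x \<in> cube a l \<Longrightarrow> \<bar>f x - c\<bar> \<le> e"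
  shows "\<bar>average f (cube a l) - c\<bar> \<le> e"
proof -
  have "ennreal \<bar>average f (cube a l) - c\<bar> * ennreal (l ^ CARD('n)) \<le> (\<integral>\<^sup>+x\<in>cube a l. ennreal \<bar>f x - c\<bar> \<partial>lebesgue)"
    by (rule average_diff_le[OF assms(1,2)])
  also have "\<dots> \<le> (\<integral>\<^sup>+x\<in>cube a l. ennreal e \<partial>lebesgue)"
    using assms(4) by (intro nn_integral_mono) (auto simp: indicator_def intro: ennreal_leI)
  also have "\<dots> = ennreal e * ennreal (l ^ CARD('n))"
    using assms(1) by (simp add: nn_integral_cmult emeasure_cube)
  finally have "\<bar>average f (cube a l) - c\<bar> * l ^ CARD('n) \<le> e * l ^ CARD('n)"
    using assms(1,3) by (simp add: ennreal_le_iff flip: ennreal_mult)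
  then show ?thesis using assms(1) by simp
qed

text \<open>The conditional expectation of \<open>f\<close> with respect to the dyadic subcubes of generation \<open>m\<close> of the cube.\<close>

primrec dyadic_avg :: "nat \<Rightarrow> (real ^ 'n \<Rightarrow> real) \<Rightarrow> real ^ 'n \<Rightarrow> real \<Rightarrow> real ^ 'n \<Rightarrow> real" where
  "dyadic_avg 0 f a l x = average f (cube a l)"
| "dyadic_avg (Suc m) f a l x = dyadic_avg m f (corner a l (upper_coords a l x)) (l / 2) x"

lemma dyadic_avg_measurable [measurable]: "dyadic_avg m f a l \<in> borel_measurable lebesgue"
proof (induction m arbitrary: a l)
  case (Suc m)
  note Suc [measurable]
  have S [measurable]: "{x. upper_coords a l x = S} \<in> sets lebesgue" for S :: "'a set"
  proof -
    have *: "{x. upper_coords a l x = S} = (\<Inter>i. if i \<in> S then {x. a $ i + l / 2 < x $ i} else - {x. a $ i + l / 2 < x $ i})"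
      by (auto simp: upper_coords_def split: if_splits)
    have "{x. a $ i + l / 2 < x $ i} \<in> sets lebesgue" for i
      by (intro sets_completionI_sets) (simp add: borel_open open_halfspace_component_gt_cart)
    then show ?thesis unfolding * by (intro sets.finite_INT) auto
  qed
  have eq: "dyadic_avg (Suc m) f a l
      = (\<lambda>x. \<Sum>S\<in>UNIV. indicator {x. upper_coords a l x = S} x * dyadic_avg m f (corner a l S) (l / 2) x)"
  proof
    fix x
    have "(\<Sum>S\<in>UNIV. indicator {x. upper_coords a l x = S} x * dyadic_avg m f (corner a l S) (l / 2) x)
        = (\<Sum>S\<in>UNIV. if S = upper_coords a l x then dyadic_avg m f (corner a l S) (l / 2) x else 0)"
      by (intro sum.cong) (auto simp: indicator_def)
    then show "dyadic_avg (Suc m) f a l x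
        = (\<Sum>S\<in>UNIV. indicator {x. upper_coords a l x = S} x * dyadic_avg m f (corner a l S) (l / 2) x)"
      by simp
  qed
  show ?case unfolding eq by measurable
next
  case 0
  have "dyadic_avg 0 f a l = (\<lambda>_. average f (cube a l))" by (rule ext) simp
  then show ?case by simp
qed

lemma set_integrable_subcube:
  fixes f :: "real ^ 'n \<Rightarrow> real"
  shows "set_integrable lebesgue (cube a l) f \<Longrightarrow> cube a' l' \<subseteq> cube a l \<Longrightarrow> set_integrable lebesgue (cube a' l') f"
  by (rule set_integrable_subset) auto

text \<open>Averaging is a contraction in \<open>L\<^sup>1\<close>, cube by cube.\<close>

lemma dyadic_avg_contraction:
  fixes f g :: "real ^ 'n \<Rightarrow> real"
  assumes "0 < l" and [measurable]: "f \<in> borel_measurable lebesgue" "g \<in> borel_measurable lebesgue"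
    and "set_integrable lebesgue (cube a l) f" "set_integrable lebesgue (cube a l) g"
  shows "(\<integral>\<^sup>+x\<in>cube a l. ennreal \<bar>dyadic_avg m f a l x - dyadic_avg m g a l x\<bar> \<partial>lebesgue)
      \<le> (\<integral>\<^sup>+x\<in>cube a l. ennreal \<bar>f x - g x\<bar> \<partial>lebesgue)"
  using assms(1,4,5)
proof (induction m arbitrary: a l)
  case 0
  let ?h = "\<lambda>x. f x - g x"
  have "average f (cube a l) - average g (cube a l) = average ?h (cube a l)"
    using 0 by (simp add: average_def set_integral_diff diff_divide_distrib)
  moreover have "ennreal \<bar>average ?h (cube a l) - 0\<bar> * ennreal (l ^ CARD('n))
      \<le> (\<integral>\<^sup>+x\<in>cube a l. ennreal \<bar>?h x - 0\<bar> \<partial>lebesgue)"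
    using 0 by (intro average_diff_le set_integral_diff)
  ultimately show ?case using 0(1) by (simp add: nn_integral_cmult emeasure_cube)
next
  case (Suc m)
  have "(\<integral>\<^sup>+x\<in>cube a l. ennreal \<bar>dyadic_avg (Suc m) f a l x - dyadic_avg (Suc m) g a l x\<bar> \<partial>lebesgue)
     = (\<Sum>S\<in>UNIV. \<integral>\<^sup>+x\<in>cube (corner a l S) (l / 2).
          ennreal \<bar>dyadic_avg m f (corner a l S) (l / 2) x - dyadic_avg m g (corner a l S) (l / 2) x\<bar> \<partial>lebesgue)"
    using Suc.prems by (subst nn_integral_bisect_selected[symmetric]) auto
  also have "\<dots> \<le> (\<Sum>S\<in>UNIV. \<integral>\<^sup>+x\<in>cube (corner a l S) (l / 2). ennreal \<bar>f x - g x\<bar> \<partial>lebesgue)"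
  proof (intro sum_mono Suc.IH)
    fix S :: "'n set"
    have "cube (corner a l S) (l / 2) \<subseteq> cube a l" using Suc.prems by (intro child_subset) auto
    then show "set_integrable lebesgue (cube (corner a l S) (l / 2)) f"
      "set_integrable lebesgue (cube (corner a l S) (l / 2)) g"
      using Suc.prems set_integrable_subcube by blast+
  qed (use Suc.prems in simp)
  also have "\<dots> = (\<integral>\<^sup>+x\<in>cube a l. ennreal \<bar>f x - g x\<bar> \<partial>lebesgue)"
    using Suc.prems by (subst nn_integral_bisect) auto
  finally show ?case .
qed

lemma dyadic_avg_is_average:
  assumes "0 < l" "x \<in> cube a l"
  shows "\<exists>a'. x \<in> cube a' (l / 2 ^ m) \<and> cube a' (l / 2 ^ m) \<subseteq> cube a l \<and>
    dyadic_avg m f a l x = average f (cube a' (l / 2 ^ m))"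
  using assms
proof (induction m arbitrary: a l)
  case 0
  then show ?case by (intro exI[of _ a]) simp
next
  case (Suc m)
  let ?a = "corner a l (upper_coords a l x)"
  have sub: "cube ?a (l / 2) \<subseteq> cube a l" using Suc.prems by (intro child_subset) auto
  have "x \<in> cube ?a (l / 2)" using Suc.prems by (intro in_selected_child)
  then obtain a' where "x \<in> cube a' (l / 2 / 2 ^ m)" "cube a' (l / 2 / 2 ^ m) \<subseteq> cube ?a (l / 2)"
    "dyadic_avg m f ?a (l / 2) x = average f (cube a' (l / 2 / 2 ^ m))"
    using Suc.IH[of "l / 2" ?a] Suc.prems by auto
  then show ?case using sub by (intro exI[of _ a']) auto
qed

lemma cube_dist_le:
  assumes "x \<in> cube a l" "y \<in> cube (a :: real ^ 'n) l"
  shows "dist x y \<le> real CARD('n) * l"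
proof -
  have "dist x y \<le> (\<Sum>i\<in>UNIV. \<bar>(x - y) $ i\<bar>)" unfolding dist_norm by (rule norm_le_l1_cart)
  also have "\<dots> \<le> (\<Sum>i\<in>(UNIV::'n set). l)"
  proof (rule sum_mono)
    fix i
    show "\<bar>(x - y) $ i\<bar> \<le> l"
      using assms unfolding mem_cube by (auto dest!: spec[of _ i])
  qed
  finally show ?thesis by simp
qed

lemma continuous_set_integrable_cube:
  "continuous_on UNIV (g :: real ^ 'n \<Rightarrow> real) \<Longrightarrow> set_integrable lebesgue (cube a l) g"
  unfolding cube_def by (intro absolutely_integrable_continuous) (auto intro: continuous_on_subset)

lemma dyadic_avg_continuous:
  fixes g :: "real ^ 'n \<Rightarrow> real"
  assumes l: "0 < l" and g: "continuous_on UNIV g" and e: "0 < e"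
  shows "\<forall>\<^sub>F m in sequentially. \<forall>x\<in>cube a l. \<bar>dyadic_avg m g a l x - g x\<bar> \<le> e"
proof -
  have "uniformly_continuous_on (cube a l) g"
    using g by (intro compact_uniformly_continuous) (auto intro: continuous_on_subset)
  then obtain d where d: "0 < d" "\<And>x y. x \<in> cube a l \<Longrightarrow> y \<in> cube a l \<Longrightarrow> dist y x < d \<Longrightarrow> dist (g y) (g x) < e"
    unfolding uniformly_continuous_on_def using e by meson
  have "(\<lambda>m. real CARD('n) * l * (1 / 2) ^ m) \<longlonglongrightarrow> real CARD('n) * l * 0"
    by (intro tendsto_intros LIMSEQ_power_zero) simp
  then have "\<forall>\<^sub>F m in sequentially. real CARD('n) * l * (1 / 2) ^ m < d"
    using d(1) by (intro order_tendstoD) auto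
  then show ?thesis
  proof eventually_elim
    case (elim m)
    show ?case
    proof
      fix x assume x: "x \<in> cube a l"
      obtain a' where a': "x \<in> cube a' (l / 2 ^ m)" "cube a' (l / 2 ^ m) \<subseteq> cube a l"
        "dyadic_avg m g a l x = average g (cube a' (l / 2 ^ m))"
        using dyadic_avg_is_average[OF l x] by blast
      have "\<bar>average g (cube a' (l / 2 ^ m)) - g x\<bar> \<le> e"
      proof (rule average_close)
        show "\<bar>g y - g x\<bar> \<le> e" if "y \<in> cube a' (l / 2 ^ m)" for y
        proof -
          have "dist y x \<le> real CARD('n) * (l / 2 ^ m)" using that a'(1) by (rule cube_dist_le)
          also have "\<dots> < d" using elim by (simp add: power_divide)
          finally have "dist (g y) (g x) < e" using d(2) x a'(2) that by blast
          then show ?thesis by (simp add: dist_real_def)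
        qed
      qed (use l e g continuous_set_integrable_cube in auto)
      then show "\<bar>dyadic_avg m g a l x - g x\<bar> \<le> e" using a'(3) by simp
    qed
  qed
qed

text \<open>A measurable function is an almost everywhere limit of continuous ones. Truncating at a high level
first makes dominated convergence applicable to that limit.\<close>

lemma continuous_dense_L1_cube:
  fixes f :: "real ^ 'n \<Rightarrow> real"
  assumes [measurable]: "f \<in> borel_measurable lebesgue" and f: "set_integrable lebesgue (cube a l) f" and e: "0 < e"
  obtains g where "continuous_on UNIV g" "(\<integral>\<^sup>+x\<in>cube a l. ennreal \<bar>f x - g x\<bar> \<partial>lebesgue) < ennreal e"
proof -
  let ?Q = "cube a l"
  define clip where "clip k x = max (- real k) (min (real k) x)" for k x
  have [measurable]: "clip k \<in> borel_measurable borel" for k unfolding clip_def by measurable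
  have cont: "continuous_on UNIV (clip k)" for k unfolding clip_def by (intro continuous_intros)
  have fin: "(\<integral>\<^sup>+x\<in>?Q. ennreal \<bar>f x\<bar> \<partial>lebesgue) < \<infinity>"
    using f by (simp add: set_integrable_cube_iff)
  have "(\<lambda>k. \<integral>\<^sup>+x\<in>?Q. ennreal \<bar>f x - clip k (f x)\<bar> \<partial>lebesgue) \<longlonglongrightarrow> (\<integral>\<^sup>+x. 0 \<partial>(lebesgue :: (real ^ 'n) measure))"
  proof (rule nn_integral_dominated_convergence[where w = "\<lambda>x. ennreal \<bar>f x\<bar> * indicator ?Q x"])
    show "AE x in lebesgue. ennreal \<bar>f x - clip k (f x)\<bar> * indicator ?Q x \<le> ennreal \<bar>f x\<bar> * indicator ?Q x" for k
      by (intro AE_I2 mult_right_mono ennreal_leI) (auto simp: clip_def)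
    show "AE x in lebesgue. (\<lambda>k. ennreal \<bar>f x - clip k (f x)\<bar> * indicator ?Q x) \<longlonglongrightarrow> 0"
    proof (rule AE_I2)
      fix x
      obtain k0 :: nat where "\<bar>f x\<bar> \<le> real k0" using real_arch_simple by blast
      then have "\<forall>\<^sub>F k in sequentially. ennreal \<bar>f x - clip k (f x)\<bar> * indicator ?Q x = 0"
        unfolding eventually_sequentially by (intro exI[of _ k0]) (auto simp: clip_def)
      then show "(\<lambda>k. ennreal \<bar>f x - clip k (f x)\<bar> * indicator ?Q x) \<longlonglongrightarrow> 0"
        by (rule tendsto_eventually)
    qed
  qed (use fin in auto)
  then have "\<forall>\<^sub>F k in sequentially. (\<integral>\<^sup>+x\<in>?Q. ennreal \<bar>f x - clip k (f x)\<bar> \<partial>lebesgue) < ennreal (e / 2)"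
    using e by (intro order_tendstoD(2)) auto
  then obtain k where k: "(\<integral>\<^sup>+x\<in>?Q. ennreal \<bar>f x - clip k (f x)\<bar> \<partial>lebesgue) < ennreal (e / 2)"
    using eventually_happens'[OF sequentially_bot] by blast
  \<comment> \<open>a measurable function is an a.e. limit of continuous functions, which are truncated at the same level\<close>
  have "f measurable_on UNIV"
    by (rule lebesgue_measurable_imp_measurable_on) auto
  then obtain N g where N: "negligible N" and gc: "\<And>n. continuous_on UNIV (g n :: real ^ 'n \<Rightarrow> real)"
    and lim: "\<And>x. x \<notin> N \<Longrightarrow> (\<lambda>n. g n x) \<longlonglongrightarrow> f x"
    unfolding measurable_on_def by auto
  have [measurable]: "g n \<in> borel_measurable lebesgue" for n
    using gc[of n] by (intro measurable_completion) (simp add: borel_measurable_continuous_onI)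
  have "(\<lambda>n. \<integral>\<^sup>+x\<in>?Q. ennreal \<bar>clip k (f x) - clip k (g n x)\<bar> \<partial>lebesgue) \<longlonglongrightarrow> (\<integral>\<^sup>+x. 0 \<partial>(lebesgue :: (real ^ 'n) measure))"
  proof (rule nn_integral_dominated_convergence[where w = "\<lambda>x. ennreal (2 * real k) * indicator ?Q x"])
    show "AE x in lebesgue. ennreal \<bar>clip k (f x) - clip k (g n x)\<bar> * indicator ?Q x \<le> ennreal (2 * real k) * indicator ?Q x" for n
      by (intro AE_I2 mult_right_mono ennreal_leI) (auto simp: clip_def)
    have "emeasure lebesgue ?Q < \<infinity>" by (rule emeasure_cube_finite)
    then show "(\<integral>\<^sup>+x\<in>?Q. ennreal (2 * real k) \<partial>lebesgue) < \<infinity>"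
      by (simp add: nn_integral_cmult ennreal_mult_less_top)
    have "AE x in lebesgue. x \<notin> N" using N by (simp add: negligible_iff_null_sets AE_not_in)
    then show "AE x in lebesgue. (\<lambda>n. ennreal \<bar>clip k (f x) - clip k (g n x)\<bar> * indicator ?Q x) \<longlonglongrightarrow> 0"
    proof eventually_elim
      case (elim x)
      have "(\<lambda>n. clip k (g n x)) \<longlonglongrightarrow> clip k (f x)"
        unfolding clip_def by (intro tendsto_intros lim[OF elim])
      then have "(\<lambda>n. \<bar>clip k (f x) - clip k (g n x)\<bar>) \<longlonglongrightarrow> \<bar>clip k (f x) - clip k (f x)\<bar>"
        by (intro tendsto_intros)
      then have "(\<lambda>n. ennreal \<bar>clip k (f x) - clip k (g n x)\<bar>) \<longlonglongrightarrow> ennreal 0"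
        by (intro tendsto_ennrealI) simp
      then show ?case by (cases "x \<in> ?Q") auto
    qed
  qed auto
  then have "\<forall>\<^sub>F n in sequentially. (\<integral>\<^sup>+x\<in>?Q. ennreal \<bar>clip k (f x) - clip k (g n x)\<bar> \<partial>lebesgue) < ennreal (e / 2)"
    using e by (intro order_tendstoD(2)) auto
  then obtain n where n: "(\<integral>\<^sup>+x\<in>?Q. ennreal \<bar>clip k (f x) - clip k (g n x)\<bar> \<partial>lebesgue) < ennreal (e / 2)"
    using eventually_happens'[OF sequentially_bot] by blast
  show thesis
  proof (rule that[of "\<lambda>x. clip k (g n x)"])
    show "continuous_on UNIV (\<lambda>x. clip k (g n x))"
      unfolding clip_def by (intro continuous_intros gc)
    have "(\<integral>\<^sup>+x\<in>?Q. ennreal \<bar>f x - clip k (g n x)\<bar> \<partial>lebesgue)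
        \<le> (\<integral>\<^sup>+x. ennreal \<bar>f x - clip k (f x)\<bar> * indicator ?Q x + ennreal \<bar>clip k (f x) - clip k (g n x)\<bar> * indicator ?Q x \<partial>lebesgue)"
      by (intro nn_integral_mono)
        (auto simp: indicator_def ennreal_plus[symmetric] simp del: ennreal_plus intro!: ennreal_leI)
    also have "\<dots> = (\<integral>\<^sup>+x\<in>?Q. ennreal \<bar>f x - clip k (f x)\<bar> \<partial>lebesgue) + (\<integral>\<^sup>+x\<in>?Q. ennreal \<bar>clip k (f x) - clip k (g n x)\<bar> \<partial>lebesgue)"
      by (rule nn_integral_add) auto
    also have "\<dots> < ennreal (e / 2) + ennreal (e / 2)" using k n by (rule add_strict_mono)
    also have "\<dots> = ennreal e" using e by (simp flip: ennreal_plus)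
    finally show "(\<integral>\<^sup>+x\<in>?Q. ennreal \<bar>f x - clip k (g n x)\<bar> \<partial>lebesgue) < ennreal e" .
  qed
qed

text \<open>Averages of continuous functions converge uniformly; density and contraction transfer this to \<open>L\<^sup>1\<close>.\<close>

lemma dyadic_avg_L1_close:
  fixes f :: "real ^ 'n \<Rightarrow> real"
  assumes l: "0 < l" and [measurable]: "f \<in> borel_measurable lebesgue"
    and f: "set_integrable lebesgue (cube a l) f" and e: "0 < e"
  shows "\<forall>\<^sub>F m in sequentially. (\<integral>\<^sup>+x\<in>cube a l. ennreal \<bar>dyadic_avg m f a l x - f x\<bar> \<partial>lebesgue) \<le> ennreal e"
proof -
  let ?Q = "cube a l"
  obtain g where g: "continuous_on UNIV g" "(\<integral>\<^sup>+x\<in>?Q. ennreal \<bar>f x - g x\<bar> \<partial>lebesgue) < ennreal (e / 3)"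
    using continuous_dense_L1_cube[OF assms(2) f, of "e / 3"] e by auto
  have [measurable]: "g \<in> borel_measurable lebesgue"
    using g(1) by (intro measurable_completion) (simp add: borel_measurable_continuous_onI)
  have gi: "set_integrable lebesgue ?Q g" by (rule continuous_set_integrable_cube[OF g(1)])
  define d where "d = e / 3 / l ^ CARD('n)"
  have d: "0 < d" using e l by (simp add: d_def)
  show ?thesis
    using dyadic_avg_continuous[OF l g(1) d, of a]
  proof eventually_elim
    case (elim m)
    have "(\<integral>\<^sup>+x\<in>?Q. ennreal \<bar>dyadic_avg m f a l x - f x\<bar> \<partial>lebesgue)
        \<le> (\<integral>\<^sup>+x. ennreal \<bar>dyadic_avg m f a l x - dyadic_avg m g a l x\<bar> * indicator ?Q x
            + (ennreal \<bar>f x - g x\<bar> * indicator ?Q x + ennreal d * indicator ?Q x) \<partial>lebesgue)"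
    proof (intro nn_integral_mono)
      fix x
      have "\<bar>dyadic_avg m f a l x - f x\<bar> \<le> \<bar>dyadic_avg m f a l x - dyadic_avg m g a l x\<bar> + (\<bar>f x - g x\<bar> + d)" if "x \<in> ?Q"
        using elim that by fastforce
      then show "ennreal \<bar>dyadic_avg m f a l x - f x\<bar> * indicator ?Q x
          \<le> ennreal \<bar>dyadic_avg m f a l x - dyadic_avg m g a l x\<bar> * indicator ?Q x
            + (ennreal \<bar>f x - g x\<bar> * indicator ?Q x + ennreal d * indicator ?Q x)"
        using d by (auto simp: indicator_def ennreal_plus[symmetric] simp del: ennreal_plus intro!: ennreal_leI)
    qed
    also have "\<dots> = (\<integral>\<^sup>+x\<in>?Q. ennreal \<bar>dyadic_avg m f a l x - dyadic_avg m g a l x\<bar> \<partial>lebesgue)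
        + ((\<integral>\<^sup>+x\<in>?Q. ennreal \<bar>f x - g x\<bar> \<partial>lebesgue) + ennreal d * emeasure lebesgue ?Q)"
      by (simp add: nn_integral_add nn_integral_cmult)
    also have "\<dots> \<le> ennreal (e / 3) + (ennreal (e / 3) + ennreal (e / 3))"
    proof (intro add_mono)
      show "(\<integral>\<^sup>+x\<in>?Q. ennreal \<bar>dyadic_avg m f a l x - dyadic_avg m g a l x\<bar> \<partial>lebesgue) \<le> ennreal (e / 3)"
        using dyadic_avg_contraction[OF l _ _ f gi, of m] g(2) by simp
      show "(\<integral>\<^sup>+x\<in>?Q. ennreal \<bar>f x - g x\<bar> \<partial>lebesgue) \<le> ennreal (e / 3)" using g(2) by simp
      show "ennreal d * emeasure lebesgue ?Q \<le> ennreal (e / 3)"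
        using l d by (simp add: emeasure_cube d_def flip: ennreal_mult)
    qed
    also have "\<dots> = ennreal e" using e by (simp flip: ennreal_plus)
    finally show ?case .
  qed
qed

text \<open>A substitute for the Lebesgue differentiation theorem that suffices for Fatou's lemma.\<close>

lemma dyadic_avg_AE_subseq:
  fixes f :: "real ^ 'n \<Rightarrow> real"
  assumes l: "0 < l" and [measurable]: "f \<in> borel_measurable lebesgue"
    and f: "set_integrable lebesgue (cube a l) f"
  obtains r :: "nat \<Rightarrow> nat" where
    "AE x in lebesgue. x \<in> cube a l \<longrightarrow> (\<lambda>k. dyadic_avg (r k) f a l x) \<longlonglongrightarrow> f x"
proof -
  let ?Q = "cube a l"
  have "\<exists>m. (\<integral>\<^sup>+x\<in>?Q. ennreal \<bar>dyadic_avg m f a l x - f x\<bar> \<partial>lebesgue) \<le> ennreal (1 / (real k + 1))" for k :: nat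
    using eventually_happens'[OF sequentially_bot dyadic_avg_L1_close[OF l assms(2) f, of "1 / (real k + 1)"]] by simp
  then obtain s where s: "\<And>k :: nat. (\<integral>\<^sup>+x\<in>?Q. ennreal \<bar>dyadic_avg (s k) f a l x - f x\<bar> \<partial>lebesgue) \<le> ennreal (1 / (real k + 1))"
    by metis
  define u where "u k x = indicator ?Q x * (dyadic_avg (s k) f a l x - f x)" for k x
  have [measurable]: "u k \<in> borel_measurable lebesgue" for k unfolding u_def by measurable
  have nu: "(\<integral>\<^sup>+x. ennreal (norm (u k x)) \<partial>lebesgue) \<le> ennreal (1 / (real k + 1))" for k
  proof -
    have "(\<integral>\<^sup>+x. ennreal (norm (u k x)) \<partial>lebesgue) = (\<integral>\<^sup>+x\<in>?Q. ennreal \<bar>dyadic_avg (s k) f a l x - f x\<bar> \<partial>lebesgue)"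
      unfolding u_def by (intro nn_integral_cong) (auto simp: indicator_def)
    then show ?thesis using s by simp
  qed
  have int: "integrable lebesgue (u k)" for k
    unfolding integrable_iff_bounded using order.strict_trans1[OF nu[of k]] by auto
  have "(\<integral>x. norm (u k x) \<partial>lebesgue) \<le> 1 / (real k + 1)" for k
    using nu[of k] nn_integral_eq_integral[OF integrable_norm[OF int[of k]]] by (simp add: ennreal_le_iff)
  then have "(\<lambda>k. \<integral>x. norm (u k x) \<partial>lebesgue) \<longlonglongrightarrow> 0"
    by (intro tendsto_sandwich[OF _ _ tendsto_const LIMSEQ_inverse_real_of_nat])
      (auto simp: inverse_eq_divide add.commute intro!: always_eventually)
  then obtain r where "strict_mono r" "AE x in lebesgue. (\<lambda>k. u (r k) x) \<longlonglongrightarrow> 0"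
    using tendsto_L1_AE_subseq[of lebesgue u] int by blast
  then have "AE x in lebesgue. x \<in> ?Q \<longrightarrow> (\<lambda>k. dyadic_avg (s (r k)) f a l x) \<longlonglongrightarrow> f x"
    by (auto simp: u_def LIM_zero_iff elim!: eventually_mono)
  then show thesis by (rule that)
qed

section \<open>The weighted John--Nirenberg inequality\<close>

text \<open>The hypothesis \<open>b \<in> BMO(w)\<close> with an explicit bound \<open>B\<close> of the weighted oscillation.\<close>

locale bmo_weight = a1_weight w C1 for w :: "real ^ 'n \<Rightarrow> real" and C1 +
  fixes b :: "real ^ 'n \<Rightarrow> real" and B :: real
  assumes b_meas [measurable]: "b \<in> borel_measurable lebesgue"
    and b_int: "set_integrable lebesgue (cube a l) b"
    and B_pos: "0 < B"
    and osc: "0 < l \<Longrightarrow> (\<integral>\<^sup>+x\<in>cube a l. ennreal \<bar>b x - average b (cube a l)\<bar> \<partial>lebesgue) \<le> ennreal (B * W a l)"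
begin

text \<open>\<open>K w\<close> bounds how far the average of \<open>b\<close> has moved at a stopping cube. \<open>E\<close> is the growth factor
of the exponential that a single stopping step may cost: the \<open>A\<^sub>1\<close> condition keeps a proportion
\<open>1/(2 C\<^sub>1)\<close> of the weighted mass out of the stopping cubes, and \<open>E (2 - 1/(2 C\<^sub>1)) = 2\<close> closes the
induction. The exponent \<open>cJN\<close> is chosen such that \<open>exp (cJN * K) = E\<close>.\<close>

definition K :: real where "K = (2 + 2 ^ CARD('n)) * B * C1"
definition E :: real where "E = 2 / (2 - 1 / (2 * C1))"
definition cJN :: real where "cJN = ln E / K"

lemma K_pos: "0 < K" using B_pos C1_ge_1 by (simp add: K_def add_pos_pos)

lemma E_gt_1: "1 < E"
proof -
  have "1 / (2 * C1) \<le> 1 / 2" "0 < 1 / (2 * C1)" using C1_ge_1 by (auto simp: field_simps)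
  then show ?thesis unfolding E_def by (simp add: less_divide_eq)
qed

lemma cJN_pos: "0 < cJN" using K_pos E_gt_1 by (simp add: cJN_def)

lemma exp_cJN_K: "exp (cJN * K) = E" using K_pos E_gt_1 by (simp add: cJN_def)

text \<open>The exponential integral of the dyadic averages of generation \<open>m\<close>, centred at \<open>\<beta>\<close>. Bounding it uniformly in
\<open>m\<close> avoids any a priori finiteness assumption.\<close>

definition \<Phi> :: "nat \<Rightarrow> real ^ 'n \<Rightarrow> real \<Rightarrow> real \<Rightarrow> ennreal" where
  "\<Phi> m a l \<beta> = (\<integral>\<^sup>+x\<in>cube a l. ennreal (w x * exp (cJN * \<bar>dyadic_avg m b a l x - \<beta>\<bar> / w x)) \<partial>lebesgue)"

lemma Phi_Suc:
  assumes "0 < l"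
  shows "\<Phi> (Suc m) a l \<beta> = (\<Sum>S\<in>UNIV. \<Phi> m (corner a l S) (l / 2) \<beta>)"
  unfolding \<Phi>_def using assms by (subst nn_integral_bisect_selected[symmetric]) auto

lemma Phi_0: "\<Phi> 0 a l (average b (cube a l)) = (\<integral>\<^sup>+x\<in>cube a l. ennreal (w x) \<partial>lebesgue)"
  by (simp add: \<Phi>_def)

lemma Phi_shift:
  assumes "AE x in lebesgue. x \<in> cube a l \<longrightarrow> \<bar>\<beta>' - \<beta>\<bar> \<le> K * w x"
  shows "\<Phi> m a l \<beta> \<le> ennreal E * \<Phi> m a l \<beta>'"
proof -
  have "\<Phi> m a l \<beta> \<le> (\<integral>\<^sup>+x. ennreal E * (ennreal (w x * exp (cJN * \<bar>dyadic_avg m b a l x - \<beta>'\<bar> / w x)) * indicator (cube a l) x) \<partial>lebesgue)"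
    unfolding \<Phi>_def
  proof (rule nn_integral_mono_AE)
    show "AE x in lebesgue. ennreal (w x * exp (cJN * \<bar>dyadic_avg m b a l x - \<beta>\<bar> / w x)) * indicator (cube a l) x
        \<le> ennreal E * (ennreal (w x * exp (cJN * \<bar>dyadic_avg m b a l x - \<beta>'\<bar> / w x)) * indicator (cube a l) x)"
      using assms w_pos
    proof eventually_elim
      case (elim x)
      show ?case
      proof (cases "x \<in> cube a l")
        case True
        let ?d = "dyadic_avg m b a l x"
        have "\<bar>?d - \<beta>\<bar> \<le> \<bar>?d - \<beta>'\<bar> + K * w x" using elim True by fastforce
        then have "cJN * \<bar>?d - \<beta>\<bar> / w x \<le> cJN * (\<bar>?d - \<beta>'\<bar> + K * w x) / w x"
          using cJN_pos elim by (intro divide_right_mono mult_left_mono) auto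
        also have "\<dots> = cJN * K + cJN * \<bar>?d - \<beta>'\<bar> / w x" using elim by (simp add: field_simps)
        finally have "exp (cJN * \<bar>?d - \<beta>\<bar> / w x) \<le> E * exp (cJN * \<bar>?d - \<beta>'\<bar> / w x)"
          unfolding exp_cJN_K[symmetric] exp_add[symmetric] by simp
        then have "w x * exp (cJN * \<bar>?d - \<beta>\<bar> / w x) \<le> E * (w x * exp (cJN * \<bar>?d - \<beta>'\<bar> / w x))"
          using elim by (simp add: mult.left_commute)
        then show ?thesis using True E_gt_1 elim by (simp add: ennreal_leI flip: ennreal_mult)
      qed simp
    qed
  qed
  also have "\<dots> = ennreal E * \<Phi> m a l \<beta>'"
    unfolding \<Phi>_def by (rule nn_integral_cmult) auto
  finally show ?thesis .
qed

lemma child_average_diff: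
  assumes "0 < l"
  shows "\<bar>average b (cube (corner a l S) (l / 2)) - average b (cube a l)\<bar> \<le> 2 ^ CARD('n) * B * (W a l / l ^ CARD('n))"
proof -
  let ?P = "cube (corner a l S) (l / 2)" and ?m = "average b (cube a l)"
  have sub: "?P \<subseteq> cube a l" using assms by (intro child_subset) auto
  have "ennreal \<bar>average b ?P - ?m\<bar> * ennreal ((l / 2) ^ CARD('n)) \<le> (\<integral>\<^sup>+x\<in>?P. ennreal \<bar>b x - ?m\<bar> \<partial>lebesgue)"
    using assms b_int by (intro average_diff_le) auto
  also have "\<dots> \<le> (\<integral>\<^sup>+x\<in>cube a l. ennreal \<bar>b x - ?m\<bar> \<partial>lebesgue)"
    using sub by (intro nn_integral_mono) (auto simp: indicator_def)
  also have "\<dots> \<le> ennreal (B * W a l)" by (rule osc[OF assms])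
  finally have "\<bar>average b ?P - ?m\<bar> * (l / 2) ^ CARD('n) \<le> B * W a l"
    using assms B_pos W_nonneg by (simp add: ennreal_le_iff flip: ennreal_mult)
  then show ?thesis using assms by (simp add: power_divide field_simps)
qed

text \<open>The invariant of the descent from a reference cube \<open>(a0, l0)\<close>: the average of \<open>b\<close> over the current subcube
has moved by at most \<open>K w\<close>. It holds for the halves of every cube whose average has moved by at most
the threshold below.\<close>

definition admissible :: "real ^ 'n \<Rightarrow> real \<Rightarrow> real ^ 'n \<Rightarrow> real \<Rightarrow> bool" where
  "admissible a0 l0 a l \<longleftrightarrow> 0 < l \<and> cube a l \<subseteq> cube a0 l0 \<and>
     (AE x in lebesgue. x \<in> cube a l \<longrightarrow> \<bar>average b (cube a l) - average b (cube a0 l0)\<bar> \<le> K * w x)"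

text \<open>The descent stops at a subcube where the average has moved by more than \<open>thr\<close>. The weight is at least
\<open>low\<close> almost everywhere on the reference cube.\<close>

definition thr :: "real ^ 'n \<Rightarrow> real \<Rightarrow> real" where "thr a0 l0 = 2 * B * (W a0 l0 / l0 ^ CARD('n))"
definition low :: "real ^ 'n \<Rightarrow> real \<Rightarrow> real" where "low a0 l0 = W a0 l0 / l0 ^ CARD('n) / C1"

text \<open>Up to the factor \<open>E\<close>, the stopped subcubes count twice their mass and the rest counts once. The mass of the
rest is at least \<open>low\<close> times its volume, and the volume of the stopped subcubes is at most
\<open>1/thr\<close> times the integral of \<open>\<bar>b - b\<^sub>F\<bar>\<close>, with \<open>F\<close> the reference cube. Writing the
bound in terms of these additive quantities makes it pass from the halves of a cube to the cube, so
that no family of stopping cubes has to be constructed.\<close>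

definition stopping_bound :: "nat \<Rightarrow> real ^ 'n \<Rightarrow> real \<Rightarrow> real ^ 'n \<Rightarrow> real \<Rightarrow> bool" where
  "stopping_bound j a0 l0 a l \<longleftrightarrow>
     \<Phi> j a l (average b (cube a0 l0)) + ennreal (E * low a0 l0) * (\<integral>\<^sup>+x\<in>cube a l. 1 \<partial>lebesgue)
     \<le> ennreal (2 * E) * (\<integral>\<^sup>+x\<in>cube a l. ennreal (w x) \<partial>lebesgue)
       + ennreal (E * low a0 l0 / thr a0 l0) * (\<integral>\<^sup>+x\<in>cube a l. ennreal \<bar>b x - average b (cube a0 l0)\<bar> \<partial>lebesgue)"

lemma thr_pos: "0 < l0 \<Longrightarrow> 0 < thr a0 l0" using W_pos B_pos by (simp add: thr_def)
lemma low_pos: "0 < l0 \<Longrightarrow> 0 < low a0 l0" using W_pos C1_ge_1 by (simp add: low_def)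

lemma low_le:
  assumes "0 < l0" "cube a l \<subseteq> cube a0 l0"
  shows "ennreal (low a0 l0) * (\<integral>\<^sup>+x\<in>cube a l. 1 \<partial>lebesgue) \<le> (\<integral>\<^sup>+x\<in>cube a l. ennreal (w x) \<partial>lebesgue)"
proof -
  have "ennreal (1 / C1) * (ennreal (W a0 l0 / l0 ^ CARD('n)) * (\<integral>\<^sup>+x\<in>cube a l. 1 \<partial>lebesgue))
      \<le> ennreal (1 / C1) * (ennreal C1 * (\<integral>\<^sup>+x\<in>cube a l. 1 \<partial>\<mu>))"
    using assms by (intro mult_left_mono nn_integral_cube_le_mu) auto
  moreover have "ennreal (1 / C1) * ennreal C1 = 1" using C1_ge_1 by (simp flip: ennreal_mult)
  moreover have "ennreal (1 / C1) * ennreal (W a0 l0 / l0 ^ CARD('n)) = ennreal (low a0 l0)"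
    using C1_ge_1 W_nonneg[of a0 l0] assms by (simp add: low_def flip: ennreal_mult)
  moreover have "(\<integral>\<^sup>+x\<in>cube a l. 1 \<partial>\<mu>) = (\<integral>\<^sup>+x\<in>cube a l. ennreal (w x) \<partial>lebesgue)"
    by (subst nn_integral_mu) auto
  ultimately show ?thesis by (simp flip: mult.assoc)
qed

lemma stopping_bound_0: assumes "0 < l0" "admissible a0 l0 a l" shows "stopping_bound 0 a0 l0 a l"
proof -
  let ?w = "\<integral>\<^sup>+x\<in>cube a l. ennreal (w x) \<partial>lebesgue"
  have 1: "\<Phi> 0 a l (average b (cube a0 l0)) \<le> ennreal E * ?w"
    using Phi_shift[of a l "average b (cube a l)" "average b (cube a0 l0)" 0] assms(2)
    by (simp add: admissible_def Phi_0)
  have 2: "ennreal (E * low a0 l0) * (\<integral>\<^sup>+x\<in>cube a l. 1 \<partial>lebesgue) \<le> ennreal E * ?w"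
    using mult_left_mono[OF low_le[of l0 a l a0], of "ennreal E"] assms E_gt_1 low_pos[of l0 a0]
    by (simp add: admissible_def ennreal_mult mult.assoc)
  have 3: "ennreal (2 * E) * ?w = ennreal E * ?w + ennreal E * ?w"
  proof -
    have "ennreal (2 * E) = ennreal E + ennreal E" using E_gt_1 by (simp flip: ennreal_plus)
    then show ?thesis by (simp add: distrib_right)
  qed
  have "\<Phi> 0 a l (average b (cube a0 l0)) + ennreal (E * low a0 l0) * (\<integral>\<^sup>+x\<in>cube a l. 1 \<partial>lebesgue)
     \<le> ennreal (2 * E) * ?w" unfolding 3 by (rule add_mono[OF 1 2])
  then show ?thesis unfolding stopping_bound_def by (rule order_trans) simp
qed

text \<open>On a stopped cube the exponential may be centred anew at the cube's own average, at the cost of the factor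
\<open>E\<close>; and the volume of the cube is paid for by the integral of \<open>\<bar>b - b\<^sub>F\<bar>\<close>.\<close>

lemma stopping_bound_stopped:
  assumes "0 < l0" "admissible a0 l0 a l" and bad: "thr a0 l0 < \<bar>average b (cube a l) - average b (cube a0 l0)\<bar>"
    and main: "\<Phi> j a l (average b (cube a l)) \<le> 2 * (\<integral>\<^sup>+x\<in>cube a l. ennreal (w x) \<partial>lebesgue)"
  shows "stopping_bound j a0 l0 a l"
proof -
  have l: "0 < l" using assms(2) by (simp add: admissible_def)
  have "\<Phi> j a l (average b (cube a0 l0)) \<le> ennreal E * \<Phi> j a l (average b (cube a l))"
    using assms(2) by (intro Phi_shift) (simp add: admissible_def)
  also have "\<dots> \<le> ennreal E * (2 * (\<integral>\<^sup>+x\<in>cube a l. ennreal (w x) \<partial>lebesgue))"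
    using main by (rule mult_left_mono) simp
  also have "\<dots> = ennreal (2 * E) * (\<integral>\<^sup>+x\<in>cube a l. ennreal (w x) \<partial>lebesgue)"
    using E_gt_1 by (simp add: ennreal_mult mult_ac)
  finally have 1: "\<Phi> j a l (average b (cube a0 l0)) \<le> ennreal (2 * E) * (\<integral>\<^sup>+x\<in>cube a l. ennreal (w x) \<partial>lebesgue)" .
  have "ennreal (thr a0 l0) * ennreal (l ^ CARD('n)) \<le> ennreal \<bar>average b (cube a l) - average b (cube a0 l0)\<bar> * ennreal (l ^ CARD('n))"
    using bad by (intro mult_right_mono ennreal_leI) auto
  also have "\<dots> \<le> (\<integral>\<^sup>+x\<in>cube a l. ennreal \<bar>b x - average b (cube a0 l0)\<bar> \<partial>lebesgue)"
    using l b_int by (rule average_diff_le)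
  finally have 2: "ennreal (thr a0 l0) * (\<integral>\<^sup>+x\<in>cube a l. 1 \<partial>lebesgue) \<le> \<dots>"
    using l by (simp add: emeasure_cube)
  have "ennreal (E * low a0 l0) = ennreal (E * low a0 l0 / thr a0 l0) * ennreal (thr a0 l0)"
    using thr_pos[OF assms(1), of a0] low_pos[OF assms(1), of a0] E_gt_1 by (simp flip: ennreal_mult)
  then have "ennreal (E * low a0 l0) * (\<integral>\<^sup>+x\<in>cube a l. 1 \<partial>lebesgue)
      = ennreal (E * low a0 l0 / thr a0 l0) * (ennreal (thr a0 l0) * (\<integral>\<^sup>+x\<in>cube a l. 1 \<partial>lebesgue))"
    by (simp add: mult.assoc)
  also have "\<dots> \<le> ennreal (E * low a0 l0 / thr a0 l0) * (\<integral>\<^sup>+x\<in>cube a l. ennreal \<bar>b x - average b (cube a0 l0)\<bar> \<partial>lebesgue)"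
    using 2 by (rule mult_left_mono) simp
  finally show ?thesis unfolding stopping_bound_def using 1 by (intro add_mono)
qed

lemma admissible_child:
  assumes "0 < l0" "admissible a0 l0 a l" and good: "\<bar>average b (cube a l) - average b (cube a0 l0)\<bar> \<le> thr a0 l0"
  shows "admissible a0 l0 (corner a l S) (l / 2)"
  unfolding admissible_def
proof (intro conjI)
  have l: "0 < l" and sub: "cube a l \<subseteq> cube a0 l0" using assms(2) by (auto simp: admissible_def)
  then show "0 < l / 2" by simp
  have csub: "cube (corner a l S) (l / 2) \<subseteq> cube a l" using l by (intro child_subset) auto
  then show "cube (corner a l S) (l / 2) \<subseteq> cube a0 l0" using sub by blast
  show "AE x in lebesgue. x \<in> cube (corner a l S) (l / 2) \<longrightarrow>
      \<bar>average b (cube (corner a l S) (l / 2)) - average b (cube a0 l0)\<bar> \<le> K * w x"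
    using W_le[OF l, of a] W_le[OF assms(1), of a0]
  proof eventually_elim
    case (elim x)
    show ?case
    proof
      assume "x \<in> cube (corner a l S) (l / 2)"
      then have 1: "W a l / l ^ CARD('n) \<le> C1 * w x" and 2: "W a0 l0 / l0 ^ CARD('n) \<le> C1 * w x"
        using elim csub sub by auto
      have "thr a0 l0 \<le> 2 * B * (C1 * w x)"
        unfolding thr_def using 2 B_pos by (intro mult_left_mono) auto
      moreover have "2 ^ CARD('n) * B * (W a l / l ^ CARD('n)) \<le> 2 ^ CARD('n) * B * (C1 * w x)"
        using 1 B_pos by (intro mult_left_mono) auto
      moreover have "K * w x = 2 * B * (C1 * w x) + 2 ^ CARD('n) * B * (C1 * w x)"
        by (simp add: K_def algebra_simps)
      ultimately show "\<bar>average b (cube (corner a l S) (l / 2)) - average b (cube a0 l0)\<bar> \<le> K * w x"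
        using child_average_diff[OF l, of a S] good by linarith
    qed
  qed
qed

lemma stopping_bound_of_children:
  assumes "0 < l0" "admissible a0 l0 a l" "\<bar>average b (cube a l) - average b (cube a0 l0)\<bar> \<le> thr a0 l0"
    and IH: "\<And>a l. admissible a0 l0 a l \<Longrightarrow> stopping_bound j a0 l0 a l"
  shows "stopping_bound (Suc j) a0 l0 a l"
proof -
  have l: "0 < l" using assms(2) by (simp add: admissible_def)
  have child: "stopping_bound j a0 l0 (corner a l S) (l / 2)" for S by (intro IH admissible_child assms)
  have split: "(\<integral>\<^sup>+x\<in>cube a l. f x \<partial>lebesgue) = (\<Sum>S\<in>UNIV. \<integral>\<^sup>+x\<in>cube (corner a l S) (l / 2). f x \<partial>lebesgue)"
    if "f \<in> borel_measurable lebesgue" for f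
    using l that by (intro nn_integral_bisect) auto
  have "(\<Sum>S\<in>UNIV. \<Phi> j (corner a l S) (l / 2) (average b (cube a0 l0))
        + ennreal (E * low a0 l0) * (\<integral>\<^sup>+x\<in>cube (corner a l S) (l / 2). 1 \<partial>lebesgue))
     \<le> (\<Sum>S\<in>UNIV. ennreal (2 * E) * (\<integral>\<^sup>+x\<in>cube (corner a l S) (l / 2). ennreal (w x) \<partial>lebesgue)
       + ennreal (E * low a0 l0 / thr a0 l0)
         * (\<integral>\<^sup>+x\<in>cube (corner a l S) (l / 2). ennreal \<bar>b x - average b (cube a0 l0)\<bar> \<partial>lebesgue))"
    by (intro sum_mono child[unfolded stopping_bound_def])
  then show ?thesis
    unfolding stopping_bound_def Phi_Suc[OF l]
    by (subst (1 2 3) split) (measurable, simp only: sum.distrib sum_distrib_left)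
qed

text \<open>On the reference cube itself the integral of \<open>\<bar>b - b\<^sub>F\<bar>\<close> is at most \<open>B \<mu>(F)\<close>, and with the
chosen threshold the stopped subcubes fill at most half of the volume.\<close>

lemma exponential_bound_from_stopping_bound:
  assumes "0 < l0" "stopping_bound j a0 l0 a0 l0"
  shows "\<Phi> j a0 l0 (average b (cube a0 l0)) \<le> 2 * (\<integral>\<^sup>+x\<in>cube a0 l0. ennreal (w x) \<partial>lebesgue)"
proof -
  let ?v = "W a0 l0" and ?L = "l0 ^ CARD('n)"
  have v: "(\<integral>\<^sup>+x\<in>cube a0 l0. ennreal (w x) \<partial>lebesgue) = ennreal ?v"
    using emeasure_mu_cube[of a0 l0] by (simp add: emeasure_mu)
  have L: "(\<integral>\<^sup>+x\<in>cube a0 l0. 1 \<partial>lebesgue) = ennreal ?L" "0 < ?L" using assms(1) by (simp_all add: emeasure_cube)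
  note pos = thr_pos[OF assms(1), of a0] low_pos[OF assms(1), of a0] E_gt_1 W_pos[OF assms(1), of a0] B_pos
  have "\<Phi> j a0 l0 (average b (cube a0 l0)) + ennreal (E * low a0 l0) * ennreal ?L
     \<le> ennreal (2 * E) * ennreal ?v + ennreal (E * low a0 l0 / thr a0 l0) * ennreal (B * ?v)"
    using assms(2) unfolding stopping_bound_def v L
    by (rule order_trans) (intro add_left_mono mult_left_mono osc assms(1), simp)
  also have "\<dots> = ennreal (2 * E * ?v + E * low a0 l0 / thr a0 l0 * (B * ?v))"
  proof -
    have "ennreal (2 * E) * ennreal ?v = ennreal (2 * E * ?v)"
      "ennreal (E * low a0 l0 / thr a0 l0) * ennreal (B * ?v) = ennreal (E * low a0 l0 / thr a0 l0 * (B * ?v))"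
      using pos by (intro ennreal_mult[symmetric]; simp)+
    moreover have "0 \<le> 2 * E * ?v" "0 \<le> E * low a0 l0 / thr a0 l0 * (B * ?v)" using pos by auto
    ultimately show ?thesis by (simp only: ennreal_plus)
  qed
  finally have le: "\<Phi> j a0 l0 (average b (cube a0 l0)) + ennreal (E * low a0 l0 * ?L)
      \<le> ennreal (2 * E * ?v + E * low a0 l0 / thr a0 l0 * (B * ?v))"
    using pos L by (simp add: ennreal_mult)
  then obtain \<phi> where \<phi>: "\<Phi> j a0 l0 (average b (cube a0 l0)) = ennreal \<phi>" "0 \<le> \<phi>"
    by (cases "\<Phi> j a0 l0 (average b (cube a0 l0))") (auto simp: top_unique)
  have "0 \<le> 2 * E * ?v + E * low a0 l0 / thr a0 l0 * (B * ?v)" "0 \<le> E * low a0 l0 * ?L" using pos L by auto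
  then have "\<phi> + E * low a0 l0 * ?L \<le> 2 * E * ?v + E * low a0 l0 / thr a0 l0 * (B * ?v)"
    using le \<phi> by (simp add: ennreal_le_iff flip: ennreal_plus)
  moreover have "low a0 l0 * ?L = ?v / C1" using L assms(1) by (simp add: low_def)
  moreover have "low a0 l0 / thr a0 l0 * (B * ?v) = ?v / C1 / 2" using L assms(1) pos C1_ge_1 by (simp add: low_def thr_def field_simps)
  ultimately have "\<phi> + E * (?v / C1) \<le> 2 * E * ?v + E * (?v / C1 / 2)" by (simp add: mult.assoc times_divide_eq_right[symmetric] del: times_divide_eq_right)
  moreover have "E * (?v / C1 / 2) = E * (?v / C1) / 2"
    "E * ((2 - 1 / (2 * C1)) * ?v) = 2 * E * ?v - E * (?v / C1) / 2"
    by (simp_all add: algebra_simps)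
  moreover have "p + x \<le> y + z \<Longrightarrow> z = x / 2 \<Longrightarrow> q = y - x / 2 \<Longrightarrow> p \<le> q" for p x y z q :: real
    by linarith
  ultimately have "\<phi> \<le> E * ((2 - 1 / (2 * C1)) * ?v)" by blast
  also have "\<dots> = 2 * ?v"
  proof -
    have "1 / (2 * C1) < 2" using C1_ge_1 by (simp add: field_simps)
    then show ?thesis by (simp add: E_def)
  qed
  finally have "ennreal \<phi> \<le> ennreal (2 * ?v)" by (rule ennreal_leI)
  then show ?thesis using \<phi> v W_nonneg[of a0 l0] by (simp add: ennreal_mult)
qed

text \<open>A simultaneous induction on the generation: a stopped cube needs the final bound for the same
generation with the cube itself as reference, a cube that is not stopped needs the stopping bound for the
previous generation on its halves.\<close>

lemma dyadic_exponential_bound: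
  "(\<forall>a0 l0 a l. 0 < l0 \<longrightarrow> admissible a0 l0 a l \<longrightarrow> stopping_bound j a0 l0 a l) \<and>
   (\<forall>a l. 0 < l \<longrightarrow> \<Phi> j a l (average b (cube a l)) \<le> 2 * (\<integral>\<^sup>+x\<in>cube a l. ennreal (w x) \<partial>lebesgue))"
proof (induction j)
  case 0
  have "x \<le> 2 * x" for x :: ennreal by (simp add: mult_2)
  then show ?case by (simp add: Phi_0 stopping_bound_0)
next
  case (Suc j)
  then have IH: "\<And>a0 l0 a l. 0 < l0 \<Longrightarrow> admissible a0 l0 a l \<Longrightarrow> stopping_bound j a0 l0 a l" by simp
  have main: "\<Phi> (Suc j) a l (average b (cube a l)) \<le> 2 * (\<integral>\<^sup>+x\<in>cube a l. ennreal (w x) \<partial>lebesgue)" if l: "0 < l" for a l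
  proof -
    have "admissible a l a l" using l K_pos w_nonneg by (simp add: admissible_def)
    moreover have "\<bar>average b (cube a l) - average b (cube a l)\<bar> \<le> thr a l" using thr_pos[OF l, of a] by simp
    ultimately have "stopping_bound (Suc j) a l a l" using IH[OF l] by (intro stopping_bound_of_children[OF l]) auto
    then show ?thesis by (rule exponential_bound_from_stopping_bound[OF l])
  qed
  have "stopping_bound (Suc j) a0 l0 a l" if "0 < l0" "admissible a0 l0 a l" for a0 l0 a l
  proof (cases "\<bar>average b (cube a l) - average b (cube a0 l0)\<bar> \<le> thr a0 l0")
    case True
    then show ?thesis using that IH by (intro stopping_bound_of_children) auto
  next
    case False
    then show ?thesis using that main[of l a] by (intro stopping_bound_stopped) (auto simp: admissible_def)
  qed
  then show ?case using main by blast
qed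

definition rho :: "real ^ 'n \<Rightarrow> real \<Rightarrow> real ^ 'n \<Rightarrow> real" where
  "rho a l x = \<bar>b x - average b (cube a l)\<bar> / w x"

lemma rho_measurable [measurable]: "rho a l \<in> borel_measurable lebesgue"
  unfolding rho_def by measurable

lemma rho_nonneg: "0 \<le> rho a l x" by (simp add: rho_def w_nonneg)

text \<open>Fatou's lemma along a subsequence of generations for which the dyadic averages converge to \<open>b\<close>.\<close>

theorem weighted_John_Nirenberg:
  assumes l: "0 < l"
  shows "(\<integral>\<^sup>+x\<in>cube a l. ennreal (exp (cJN * rho a l x)) \<partial>\<mu>) \<le> ennreal (2 * W a l)"
proof -
  let ?m = "average b (cube a l)"
  obtain r where r: "AE x in lebesgue. x \<in> cube a l \<longrightarrow> (\<lambda>k. dyadic_avg (r k) b a l x) \<longlonglongrightarrow> b x"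
    by (rule dyadic_avg_AE_subseq[OF l b_meas b_int])
  let ?f = "\<lambda>k x. ennreal (w x * exp (cJN * \<bar>dyadic_avg (r k) b a l x - ?m\<bar> / w x)) * indicator (cube a l) x"
  have "(\<integral>\<^sup>+x\<in>cube a l. ennreal (exp (cJN * rho a l x)) \<partial>\<mu>)
      = (\<integral>\<^sup>+x. ennreal (w x) * (ennreal (exp (cJN * rho a l x)) * indicator (cube a l) x) \<partial>lebesgue)"
    by (rule nn_integral_mu) auto
  also have "\<dots> = (\<integral>\<^sup>+x. liminf (\<lambda>k. ?f k x) \<partial>lebesgue)"
  proof (rule nn_integral_cong_AE)
    show "AE x in lebesgue. ennreal (w x) * (ennreal (exp (cJN * rho a l x)) * indicator (cube a l) x) = liminf (\<lambda>k. ?f k x)"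
      using r w_pos
    proof eventually_elim
      case (elim x)
      show ?case
      proof (cases "x \<in> cube a l")
        case True
        then have "(\<lambda>k. dyadic_avg (r k) b a l x) \<longlonglongrightarrow> b x" using elim by blast
        then have "(\<lambda>k. ennreal (w x * exp (cJN * \<bar>dyadic_avg (r k) b a l x - ?m\<bar> / w x)))
            \<longlonglongrightarrow> ennreal (w x * exp (cJN * \<bar>b x - ?m\<bar> / w x))"
          using elim by (intro tendsto_ennrealI tendsto_intros) auto
        then have "liminf (\<lambda>k. ennreal (w x * exp (cJN * \<bar>dyadic_avg (r k) b a l x - ?m\<bar> / w x)))
            = ennreal (w x * exp (cJN * \<bar>b x - ?m\<bar> / w x))"
          by (intro lim_imp_Liminf) auto
        then show ?thesis using True elim by (simp add: rho_def ennreal_mult)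
      qed (simp add: Liminf_const)
    qed
  qed
  also have "\<dots> \<le> liminf (\<lambda>k. \<integral>\<^sup>+x. ?f k x \<partial>lebesgue)"
    by (rule nn_integral_liminf) auto
  also have "\<dots> \<le> liminf (\<lambda>k. 2 * (\<integral>\<^sup>+x\<in>cube a l. ennreal (w x) \<partial>lebesgue))"
    using dyadic_exponential_bound l unfolding \<Phi>_def by (intro Liminf_mono always_eventually) blast
  also have "\<dots> = ennreal (2 * W a l)"
    using emeasure_mu_cube[of a l] W_nonneg[of a l] by (simp add: Liminf_const emeasure_mu ennreal_mult)
  finally show ?thesis .
qed

definition Kmom :: "real \<Rightarrow> real" where "Kmom s = 2 * (s / cJN) powr s"

lemma rho_moment:
  assumes l: "0 < l" and s: "0 < s"
  shows "(\<integral>\<^sup>+x\<in>cube a l. ennreal (rho a l x powr s) \<partial>\<mu>) \<le> ennreal (Kmom s * W a l)"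
proof -
  have pt: "rho a l x powr s \<le> (s / cJN) powr s * exp (cJN * rho a l x)" for x
  proof -
    let ?t = "cJN / s * rho a l x"
    have t: "0 \<le> ?t" using cJN_pos s rho_nonneg[of a l x] by simp
    have "y \<le> exp y" for y :: real using exp_ge_add_one_self[of y] by linarith
    then have "?t \<le> exp ?t" .
    then have "?t powr s \<le> exp ?t powr s" using t s by (intro powr_mono2) auto
    also have "\<dots> = exp (cJN * rho a l x)" using s by (simp add: powr_def)
    finally have "(s / cJN) powr s * ?t powr s \<le> (s / cJN) powr s * exp (cJN * rho a l x)"
      by (rule mult_left_mono) simp
    moreover have "(s / cJN) powr s * ?t powr s = rho a l x powr s"
      using t s cJN_pos rho_nonneg[of a l x] by (subst powr_mult[symmetric]) auto
    ultimately show ?thesis by simp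
  qed
  have "(\<integral>\<^sup>+x\<in>cube a l. ennreal (rho a l x powr s) \<partial>\<mu>)
      \<le> (\<integral>\<^sup>+x. ennreal ((s / cJN) powr s) * (ennreal (exp (cJN * rho a l x)) * indicator (cube a l) x) \<partial>\<mu>)"
    using pt by (intro nn_integral_mono) (auto simp: indicator_def simp flip: ennreal_mult intro!: ennreal_leI)
  also have "\<dots> = ennreal ((s / cJN) powr s) * (\<integral>\<^sup>+x\<in>cube a l. ennreal (exp (cJN * rho a l x)) \<partial>\<mu>)"
    by (rule nn_integral_cmult) auto
  also have "\<dots> \<le> ennreal ((s / cJN) powr s) * ennreal (2 * W a l)"
    by (intro mult_left_mono weighted_John_Nirenberg l) simp
  also have "\<dots> = ennreal (Kmom s * W a l)"
    using W_nonneg[of a l] by (simp add: Kmom_def mult_ac flip: ennreal_mult)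
  finally show ?thesis .
qed

end

section \<open>From finitely many cubes to all cubes\<close>

lemma powr_add_le:
  fixes x y q :: real
  assumes "0 \<le> x" "0 \<le> y" "0 \<le> q"
  shows "(x + y) powr q \<le> 2 powr q * (x powr q + y powr q)"
proof -
  have "(x + y) powr q \<le> (2 * max x y) powr q" using assms by (intro powr_mono2) auto
  also have "\<dots> = 2 powr q * max x y powr q" using assms by (simp add: powr_mult)
  also have "\<dots> \<le> 2 powr q * (x powr q + y powr q)" by (intro mult_left_mono) (auto simp: max_def)
  finally show ?thesis .
qed

lemma powr_mult_powr_le_add:
  fixes A B s t :: real
  assumes "0 \<le> A" "0 \<le> B" "0 \<le> s" "0 \<le> t" "s + t = 1"
  shows "A powr s * B powr t \<le> A + B"
proof -
  have "A powr s * B powr t \<le> max A B powr s * max A B powr t"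
    using assms by (intro mult_mono powr_mono2) auto
  also have "\<dots> = max A B" using assms by (simp flip: powr_add)
  also have "\<dots> \<le> A + B" using assms by auto
  finally show ?thesis .
qed

text \<open>Young's inequality for conjugate exponents without its constants.\<close>

lemma mult_le_powr_add_powr:
  fixes x y r :: real
  assumes "0 \<le> x" "0 \<le> y" "1 < r"
  shows "x * y \<le> x powr (r / (r - 1)) + y powr r"
proof -
  have "x * y = (x powr (r / (r - 1))) powr ((r - 1) / r) * (y powr r) powr (1 / r)"
    using assms by (simp add: powr_powr)
  also have "\<dots> \<le> x powr (r / (r - 1)) + y powr r"
    using assms by (intro powr_mult_powr_le_add) (auto simp: field_simps)
  finally show ?thesis .
qed

lemma nn_integral_SUP_countable_le:
  fixes h :: "'i \<Rightarrow> 'a \<Rightarrow> ennreal"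
  assumes "countable D" and [measurable]: "\<And>i. h i \<in> borel_measurable M"
    and fin: "\<And>I. finite I \<Longrightarrow> I \<subseteq> D \<Longrightarrow> (\<integral>\<^sup>+x. (SUP i\<in>I. h i x) \<partial>M) \<le> c"
  shows "(\<integral>\<^sup>+x. (SUP i\<in>D. h i x) \<partial>M) \<le> c"
proof (cases "D = {}")
  case False
  define e where "e = from_nat_into D"
  have e: "range e = D" using assms(1) False by (simp add: e_def range_from_nat_into)
  let ?g = "\<lambda>N x. SUP i\<in>e ` {..N}. h i x"
  have "(SUP i\<in>D. h i x) = (SUP N. ?g N x)" for x
  proof (rule antisym)
    show "(SUP i\<in>D. h i x) \<le> (SUP N. ?g N x)"
    proof (rule SUP_least)
      fix i assume "i \<in> D"
      then obtain N where "i = e N" using e by auto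
      then have "h i x \<le> ?g N x" by (intro SUP_upper) auto
      also have "\<dots> \<le> (SUP N. ?g N x)" by (rule SUP_upper) auto
      finally show "h i x \<le> (SUP N. ?g N x)" .
    qed
    show "(SUP N. ?g N x) \<le> (SUP i\<in>D. h i x)"
      using e by (intro SUP_least SUP_subset_mono) auto
  qed
  then have "(\<integral>\<^sup>+x. (SUP i\<in>D. h i x) \<partial>M) = (\<integral>\<^sup>+x. (SUP N. ?g N x) \<partial>M)" by simp
  also have "\<dots> = (SUP N. \<integral>\<^sup>+x. ?g N x \<partial>M)"
  proof (rule nn_integral_monotone_convergence_SUP)
    show "incseq ?g" by (auto simp: incseq_def le_fun_def intro!: SUP_subset_mono)
    show "?g N \<in> borel_measurable M" for N by (intro borel_measurable_SUP) auto
  qed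
  also have "\<dots> \<le> c" using e by (intro SUP_least fin) auto
  finally show ?thesis .
qed (simp add: bot_ennreal)

text \<open>The intended \<open>d\<close> is \<open>w\<close> or 1, according to whether \<open>g\<close> contains a factor \<open>\<bar>b x - b y\<bar>\<close>. Stating
the bound cube by cube, with a measurable \<open>H\<close>, avoids measurability of the maximal
function itself.\<close>

definition controls :: "(real ^ 'n \<Rightarrow> real) \<Rightarrow> real \<Rightarrow> (real ^ 'n \<Rightarrow> real ^ 'n \<Rightarrow> real) \<Rightarrow> (real ^ 'n \<Rightarrow> ennreal) \<Rightarrow> bool" where
  "controls d e g H \<longleftrightarrow> (\<forall>x a l. 0 < l \<longrightarrow> x \<in> cube a l \<longrightarrow> (\<exists>z\<ge>0.
       (\<integral>\<^sup>+y\<in>cube a l. ennreal (g x y) \<partial>lebesgue) \<le> ennreal (z * l ^ CARD('n)) \<and> ennreal ((z / d x) powr e) \<le> H x))"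

lemma controls_mono: "controls d e g H \<Longrightarrow> (\<And>x. H x \<le> H' x) \<Longrightarrow> controls d e g H'"
  unfolding controls_def by (meson order_trans)

context a1_weight begin

lemma lebesgue_mean_le:
  assumes l: "0 < l" and [measurable]: "u \<in> borel_measurable lebesgue"
    and fin: "(\<integral>\<^sup>+x\<in>cube a l. ennreal (u x) \<partial>\<mu>) < \<infinity>"
  shows "(\<integral>\<^sup>+x\<in>cube a l. ennreal (u x) \<partial>lebesgue) \<le> ennreal (C1 * mean a l u * l ^ CARD('n))"
proof -
  let ?I = "\<integral>\<^sup>+x\<in>cube a l. ennreal (u x) \<partial>lebesgue" and ?v = "W a l" and ?L = "l ^ CARD('n)"
  have v: "0 < ?v" "0 < ?L" using W_pos[OF l] l by auto
  have "ennreal (?v / ?L) * ?I \<le> ennreal C1 * (\<integral>\<^sup>+x\<in>cube a l. ennreal (u x) \<partial>\<mu>)"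
    using l by (intro nn_integral_cube_le_mu) auto
  also have "\<dots> = ennreal (C1 * (mean a l u * ?v))"
    using mean_eq[OF l fin] C1_ge_1 mean_nonneg[of a l u] v by (simp add: ennreal_mult)
  finally have "ennreal (?L / ?v) * (ennreal (?v / ?L) * ?I) \<le> ennreal (?L / ?v) * ennreal (C1 * (mean a l u * ?v))"
    by (rule mult_left_mono) simp
  moreover have "ennreal (?L / ?v) * (ennreal (?v / ?L) * ?I) = ?I"
    using v l by (simp flip: mult.assoc ennreal_mult)
  moreover have "ennreal (?L / ?v) * ennreal (C1 * (mean a l u * ?v)) = ennreal (C1 * mean a l u * ?L)"
    using v C1_ge_1 mean_nonneg[of a l u] by (subst ennreal_mult[symmetric]) auto
  ultimately show ?thesis by simp
qed

text \<open>Monotone convergence extends a bound that is uniform over finite families to the countable family of grid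
cubes, and enlarging a cube to a grid cube costs a factor \<open>4\<^sup>n\<close> in its averages.\<close>

lemma majorant_over_all_cubes:
  fixes \<tau> :: "real ^ 'n \<Rightarrow> real \<Rightarrow> real ^ 'n \<Rightarrow> real" and g :: "real ^ 'n \<Rightarrow> real ^ 'n \<Rightarrow> real"
  assumes [measurable]: "\<And>a l. \<tau> a l \<in> borel_measurable lebesgue" "d \<in> borel_measurable lebesgue"
    and pos: "\<And>a l x. 0 < l \<Longrightarrow> 0 \<le> \<tau> a l x" "\<And>x. 0 \<le> d x"
    and avg: "\<And>a l x. 0 < l \<Longrightarrow> (\<integral>\<^sup>+y\<in>cube a l. ennreal (g x y) \<partial>lebesgue) \<le> ennreal (\<tau> a l x * l ^ CARD('n))"
    and fin: "\<And>I. finite I \<Longrightarrow> \<forall>i\<in>I. 0 < snd i \<Longrightarrow>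
       (\<integral>\<^sup>+x. (SUP i\<in>I. ennreal ((\<tau> (fst i) (snd i) x / d x) powr q) * indicator (cube (fst i) (snd i)) x) \<partial>\<mu>) \<le> c"
  obtains H where "H \<in> borel_measurable lebesgue" "(\<integral>\<^sup>+x. H x \<partial>\<mu>) \<le> ennreal ((4 ^ CARD('n)) powr q) * c"
    "controls d q g H"
proof -
  let ?h = "\<lambda>i x. ennreal ((\<tau> (fst i) (snd i) x / d x) powr q) * indicator (cube (fst i) (snd i)) x"
  let ?S = "\<lambda>x. SUP i\<in>grid_cubes. ?h i x" and ?k = "4 ^ CARD('n) :: real"
  have hm: "?h i \<in> borel_measurable lebesgue" for i by measurable
  have le: "(\<integral>\<^sup>+x. ?S x \<partial>\<mu>) \<le> c"
  proof (rule nn_integral_SUP_countable_le[OF countable_grid_cubes])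
    show "?h i \<in> borel_measurable \<mu>" for i using hm by simp
    fix I :: "((real ^ 'n) \<times> real) set" assume I: "finite I" "I \<subseteq> grid_cubes"
    then have "\<forall>i\<in>I. 0 < snd i" using grid_cubes_pos by (metis prod.collapse subsetD)
    with I(1) show "(\<integral>\<^sup>+x. (SUP i\<in>I. ?h i x) \<partial>\<mu>) \<le> c" by (rule fin)
  qed
  show thesis
  proof (rule that[of "\<lambda>x. ennreal (?k powr q) * ?S x"])
    have [measurable]: "?S \<in> borel_measurable lebesgue"
      by (intro borel_measurable_SUP countable_grid_cubes hm)
    show "(\<lambda>x. ennreal (?k powr q) * ?S x) \<in> borel_measurable lebesgue" by measurable
    have "(\<integral>\<^sup>+x. ennreal (?k powr q) * ?S x \<partial>\<mu>) = ennreal (?k powr q) * (\<integral>\<^sup>+x. ?S x \<partial>\<mu>)"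
      by (rule nn_integral_cmult) simp
    also have "\<dots> \<le> ennreal (?k powr q) * c" using le by (rule mult_left_mono) simp
    finally show "(\<integral>\<^sup>+x. ennreal (?k powr q) * ?S x \<partial>\<mu>) \<le> \<dots>" .
    show "controls d q g (\<lambda>x. ennreal (?k powr q) * ?S x)"
      unfolding controls_def
    proof (intro allI impI)
      fix x a :: "real ^ 'n" and l :: real assume l: "0 < l" and x: "x \<in> cube a l"
      obtain a' l' where Q: "(a', l') \<in> grid_cubes" "cube a l \<subseteq> cube a' l'" "l' \<le> 4 * l"
        by (rule cube_subset_grid_cube[OF l])
      have l': "0 < l'" using grid_cubes_pos[OF Q(1)] .
      let ?m = "\<tau> a' l' x"
      have m0: "0 \<le> ?m" using pos(1)[OF l'] .
      have "(\<integral>\<^sup>+y\<in>cube a l. ennreal (g x y) \<partial>lebesgue) \<le> (\<integral>\<^sup>+y\<in>cube a' l'. ennreal (g x y) \<partial>lebesgue)"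
        using Q(2) by (intro nn_integral_mono) (auto simp: indicator_def)
      also have "\<dots> \<le> ennreal (?m * l' ^ CARD('n))" by (rule avg[OF l'])
      also have "\<dots> \<le> ennreal (?m * (4 * l) ^ CARD('n))"
        using Q(3) l' m0 by (intro ennreal_leI mult_left_mono power_mono) auto
      also have "?m * (4 * l) ^ CARD('n) = (?k * ?m) * l ^ CARD('n)"
        by (simp add: power_mult_distrib)
      finally have 1: "(\<integral>\<^sup>+y\<in>cube a l. ennreal (g x y) \<partial>lebesgue) \<le> ennreal ((?k * ?m) * l ^ CARD('n))" .
      have "ennreal ((?m / d x) powr q) = ?h (a', l') x" using x Q(2) by auto
      also have "\<dots> \<le> ?S x" using Q(1) by (rule SUP_upper)
      finally have "ennreal (?k powr q) * ennreal ((?m / d x) powr q) \<le> ennreal (?k powr q) * ?S x"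
        by (rule mult_left_mono) simp
      moreover have "(?k * ?m / d x) powr q = ?k powr q * (?m / d x) powr q"
        using m0 pos(2)[of x] by (subst powr_mult[symmetric]) auto
      then have "ennreal ((?k * ?m / d x) powr q) = ennreal (?k powr q) * ennreal ((?m / d x) powr q)"
        by (simp add: ennreal_mult)
      ultimately show "\<exists>z\<ge>0. (\<integral>\<^sup>+y\<in>cube a l. ennreal (g x y) \<partial>lebesgue) \<le> ennreal (z * l ^ CARD('n)) \<and>
          ennreal ((z / d x) powr q) \<le> ennreal (?k powr q) * ?S x"
        using 1 m0 by (intro exI[of _ "?k * ?m"]) auto
    qed
  qed
qed

lemma maximal_majorant:
  assumes [measurable]: "u \<in> borel_measurable lebesgue" and u0: "\<And>x. 0 \<le> u x"
    and q: "1 < q" and fin: "pow_int u q < \<infinity>"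
  obtains H where "H \<in> borel_measurable lebesgue"
    "(\<integral>\<^sup>+x. H x \<partial>\<mu>) \<le> ennreal ((4 ^ CARD('n)) powr q) * (ennreal (C1 powr q * Cmax q) * pow_int u q)"
    "controls (\<lambda>_. 1) q (\<lambda>_. u) H"
proof -
  let ?\<tau> = "\<lambda>a l _. C1 * mean a l u" and ?U = "pow_int u q"
  have avg: "(\<integral>\<^sup>+y\<in>cube a l. ennreal (u y) \<partial>lebesgue) \<le> ennreal (C1 * mean a l u * l ^ CARD('n))" if "0 < l" for a l
    using q that by (intro lebesgue_mean_le powr_integrable_on_cube[OF _ u0 _ fin]) auto
  have finite_bound: "(\<integral>\<^sup>+x. (SUP i\<in>I. ennreal ((C1 * mean (fst i) (snd i) u / 1) powr q) * indicator (cube (fst i) (snd i)) x) \<partial>\<mu>)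
      \<le> ennreal (C1 powr q * Cmax q) * ?U" if I: "finite I" "\<forall>i\<in>I. 0 < snd i" for I
  proof -
    obtain G :: "real ^ 'n \<Rightarrow> real" where G: "G \<in> borel_measurable lebesgue" "\<forall>x. 0 \<le> G x"
      "\<forall>(a, l)\<in>I. \<forall>x\<in>cube a l. mean a l u powr q \<le> G x"
      "(\<integral>\<^sup>+x. ennreal (G x) \<partial>\<mu>) \<le> ennreal (Cmax q) * ?U"
      by (rule finite_maximal_majorant[OF I assms(1) u0 q fin])
    note G(1) [measurable]
    have le: "ennreal ((C1 * mean a l u) powr q) \<le> ennreal (C1 powr q) * ennreal (G x)"
      if "(a, l) \<in> I" "x \<in> cube a l" for a l x
    proof -
      have "(C1 * mean a l u) powr q = C1 powr q * mean a l u powr q"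
        using C1_ge_1 mean_nonneg by (simp add: powr_mult)
      also have "\<dots> \<le> C1 powr q * G x" using bspec[OF G(3) that(1)] that(2) by (intro mult_left_mono) auto
      finally show ?thesis by (simp add: ennreal_leI flip: ennreal_mult')
    qed
    have "(\<integral>\<^sup>+x. (SUP i\<in>I. ennreal ((C1 * mean (fst i) (snd i) u / 1) powr q) * indicator (cube (fst i) (snd i)) x) \<partial>\<mu>)
        \<le> (\<integral>\<^sup>+x. ennreal (C1 powr q) * ennreal (G x) \<partial>\<mu>)"
      by (intro nn_integral_mono SUP_least) (use le in \<open>auto simp: indicator_def\<close>)
    also have "\<dots> = ennreal (C1 powr q) * (\<integral>\<^sup>+x. ennreal (G x) \<partial>\<mu>)" by (rule nn_integral_cmult) simp
    also have "\<dots> \<le> ennreal (C1 powr q) * (ennreal (Cmax q) * ?U)"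
      using G(4) by (rule mult_left_mono) simp
    finally show ?thesis using Cmax_nonneg[OF q] by (simp add: ennreal_mult mult.assoc)
  qed
  show thesis
    by (rule majorant_over_all_cubes[of ?\<tau> "\<lambda>_. 1" "\<lambda>_. u" q "ennreal (C1 powr q * Cmax q) * ?U", OF _ _ _ _ avg finite_bound])
      (use C1_ge_1 mean_nonneg that in auto)
qed

end

section \<open>Oscillation relative to the weight\<close>

context bmo_weight begin

text \<open>Young's inequality for \<open>\<rho> (u/t)\<close>, with the scale \<open>t\<close> just above the \<open>L\<^sup>r\<close> mean of \<open>u\<close>; taking \<open>t\<close> strictly
larger covers the case in which that mean vanishes.\<close>

lemma mean_rho_le_aux:
  assumes l: "0 < l" and [measurable]: "u \<in> borel_measurable lebesgue" and u0: "\<And>x. 0 \<le> u x"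
    and r: "1 < r" and fin: "(\<integral>\<^sup>+x\<in>cube a l. ennreal (u x powr r) \<partial>\<mu>) < \<infinity>"
    and t: "mean a l (\<lambda>x. u x powr r) powr (1 / r) < t"
  shows "(\<integral>\<^sup>+x\<in>cube a l. ennreal (rho a l x * u x) \<partial>\<mu>) \<le> ennreal ((Kmom (r / (r - 1)) + 1) * t * W a l)"
proof -
  let ?M = "mean a l (\<lambda>x. u x powr r)" and ?r = "r / (r - 1)"
  have t0: "0 < t" using t order.strict_trans1[OF powr_ge_zero] by blast
  have r': "0 < ?r" using r by simp
  have M: "?M \<le> t powr r"
  proof -
    have "(?M powr (1 / r)) powr r \<le> t powr r" using t r by (intro powr_mono2) auto
    then show ?thesis using mean_nonneg[of a l "\<lambda>x. u x powr r"] r by (simp add: powr_powr)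
  qed
  have Km: "0 \<le> Kmom ?r" by (simp add: Kmom_def)
  have pt: "rho a l x * u x \<le> t * (rho a l x powr ?r) + t powr (1 - r) * u x powr r" for x
  proof -
    have "rho a l x * (u x / t) \<le> rho a l x powr ?r + (u x / t) powr r"
      using rho_nonneg u0 t0 r by (intro mult_le_powr_add_powr) auto
    then have "t * (rho a l x * (u x / t)) \<le> t * (rho a l x powr ?r + (u x / t) powr r)"
      using t0 by (intro mult_left_mono) auto
    moreover have "t * (u x / t) powr r = t powr (1 - r) * u x powr r"
      using t0 u0[of x] by (simp add: powr_divide powr_diff)
    ultimately show ?thesis using t0 by (simp add: distrib_left)
  qed
  have "(\<integral>\<^sup>+x\<in>cube a l. ennreal (rho a l x * u x) \<partial>\<mu>)
      \<le> (\<integral>\<^sup>+x. ennreal t * (ennreal (rho a l x powr ?r) * indicator (cube a l) x)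
          + ennreal (t powr (1 - r)) * (ennreal (u x powr r) * indicator (cube a l) x) \<partial>\<mu>)"
    using pt t0 by (intro nn_integral_mono)
      (auto simp: indicator_def simp flip: ennreal_mult ennreal_plus intro!: ennreal_leI)
  also have "\<dots> = ennreal t * (\<integral>\<^sup>+x\<in>cube a l. ennreal (rho a l x powr ?r) \<partial>\<mu>)
      + ennreal (t powr (1 - r)) * (\<integral>\<^sup>+x\<in>cube a l. ennreal (u x powr r) \<partial>\<mu>)"
    by (subst nn_integral_add) (auto simp: nn_integral_cmult)
  also have "\<dots> \<le> ennreal t * ennreal (Kmom ?r * W a l) + ennreal (t powr (1 - r)) * ennreal (t powr r * W a l)"
  proof (intro add_mono mult_left_mono)
    show "(\<integral>\<^sup>+x\<in>cube a l. ennreal (rho a l x powr ?r) \<partial>\<mu>) \<le> ennreal (Kmom ?r * W a l)"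
      by (rule rho_moment[OF l r'])
    have "(\<integral>\<^sup>+x\<in>cube a l. ennreal (u x powr r) \<partial>\<mu>) = ennreal ?M * ennreal (W a l)"
      by (rule mean_eq[OF l fin, symmetric])
    also have "\<dots> \<le> ennreal (t powr r * W a l)"
      using M W_nonneg mean_nonneg by (auto simp flip: ennreal_mult intro!: ennreal_leI mult_right_mono)
    finally show "(\<integral>\<^sup>+x\<in>cube a l. ennreal (u x powr r) \<partial>\<mu>) \<le> ennreal (t powr r * W a l)" .
  qed auto
  also have "\<dots> = ennreal (t * (Kmom ?r * W a l) + t powr (1 - r) * (t powr r * W a l))"
    using t0 Km W_nonneg[of a l] by (subst ennreal_plus) (auto simp: ennreal_mult)
  also have "t powr (1 - r) * (t powr r * W a l) = t * W a l"
    using t0 by (simp add: powr_diff)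
  finally show ?thesis by (simp add: algebra_simps)
qed

lemma mean_rho_finite:
  assumes "0 < l" "u \<in> borel_measurable lebesgue" "\<And>x. 0 \<le> u x" "1 < r"
    "(\<integral>\<^sup>+x\<in>cube a l. ennreal (u x powr r) \<partial>\<mu>) < \<infinity>"
  shows "(\<integral>\<^sup>+x\<in>cube a l. ennreal (rho a l x * u x) \<partial>\<mu>) < \<infinity>"
  by (rule order.strict_trans1[OF mean_rho_le_aux[OF assms, of "mean a l (\<lambda>x. u x powr r) powr (1 / r) + 1"]]) auto

text \<open>Hoelder's inequality for means, with the moments of \<open>\<rho>\<close> inserted.\<close>

lemma mean_rho_le:
  assumes "0 < l" "u \<in> borel_measurable lebesgue" "\<And>x. 0 \<le> u x" "1 < r"
    "(\<integral>\<^sup>+x\<in>cube a l. ennreal (u x powr r) \<partial>\<mu>) < \<infinity>"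
  shows "mean a l (\<lambda>x. rho a l x * u x) \<le> (Kmom (r / (r - 1)) + 1) * mean a l (\<lambda>x. u x powr r) powr (1 / r)"
proof -
  let ?m = "mean a l (\<lambda>x. rho a l x * u x)" and ?M = "mean a l (\<lambda>x. u x powr r) powr (1 / r)"
  let ?k = "Kmom (r / (r - 1)) + 1"
  have k: "0 < ?k" by (simp add: Kmom_def add_nonneg_pos)
  have "?m / ?k \<le> ?M"
  proof (rule dense_ge)
    fix t assume t: "?M < t"
    then have t0: "0 < t" using order.strict_trans1[OF powr_ge_zero] by blast
    have "ennreal (?m * W a l) = (\<integral>\<^sup>+x\<in>cube a l. ennreal (rho a l x * u x) \<partial>\<mu>)"
      using mean_eq[OF assms(1) mean_rho_finite[OF assms]] mean_nonneg W_nonneg by (simp add: ennreal_mult)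
    also have "\<dots> \<le> ennreal (?k * t * W a l)" by (rule mean_rho_le_aux[OF assms t])
    finally have "?m * W a l \<le> ?k * t * W a l"
      using k t0 W_nonneg[of a l] by (subst (asm) ennreal_le_iff) auto
    then have "?m \<le> ?k * t" using W_pos[OF assms(1), of a] by simp
    then show "?m / ?k \<le> t" using k by (simp add: pos_divide_le_eq mult.commute)
  qed
  then show ?thesis using k by (simp add: pos_divide_le_eq mult.commute)
qed

text \<open>The weight in the denominator of \<open>rho\<close> cancels against the density of \<open>\<mu>\<close>.\<close>

lemma nn_integral_osc_eq:
  assumes [measurable]: "u \<in> borel_measurable lebesgue" "A \<in> sets lebesgue" and u0: "\<And>x. 0 \<le> u x"
  shows "(\<integral>\<^sup>+x\<in>A. ennreal (\<bar>b x - average b (cube a l)\<bar> * u x) \<partial>lebesgue) = (\<integral>\<^sup>+x\<in>A. ennreal (rho a l x * u x) \<partial>\<mu>)"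
proof -
  have "(\<integral>\<^sup>+x\<in>A. ennreal (rho a l x * u x) \<partial>\<mu>) = (\<integral>\<^sup>+x. ennreal (w x) * (ennreal (rho a l x * u x) * indicator A x) \<partial>lebesgue)"
    by (rule nn_integral_mu) auto
  also have "\<dots> = (\<integral>\<^sup>+x\<in>A. ennreal (\<bar>b x - average b (cube a l)\<bar> * u x) \<partial>lebesgue)"
  proof (rule nn_integral_cong_AE)
    show "AE x in lebesgue. ennreal (w x) * (ennreal (rho a l x * u x) * indicator A x)
        = ennreal (\<bar>b x - average b (cube a l)\<bar> * u x) * indicator A x"
      using w_pos
    proof eventually_elim
      case (elim x)
      have "ennreal (w x) * ennreal (rho a l x * u x) = ennreal (w x * (rho a l x * u x))"
        using u0[of x] rho_nonneg[of a l x] w_nonneg[of x] by (simp add: ennreal_mult)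
      also have "w x * (rho a l x * u x) = \<bar>b x - average b (cube a l)\<bar> * u x" using elim by (simp add: rho_def)
      finally show ?case by (simp flip: mult.assoc)
    qed
  qed
  finally show ?thesis by simp
qed

text \<open>The averages of \<open>b\<close> over the two cubes differ by at most the mean of \<open>\<bar>b - b\<^sub>F\<bar>\<close> over the smaller cube. After
division by \<open>w(x)\<close> the \<open>A\<^sub>1\<close> condition turns it into a \<open>\<mu>\<close>-mean of \<open>\<rho>\<^sub>F\<close>. The function is cut off outside
the larger cube \<open>F\<close> so that its maximal function is controlled by \<open>\<mu>(F)\<close>.\<close>

lemma rho_change_cube:
  assumes l: "0 < l" "0 < l'" and sub: "cube a l \<subseteq> cube a' l'"
  shows "AE x in lebesgue. x \<in> cube a l \<longrightarrow>
     rho a l x \<le> rho a' l' x + C1 * mean a l (\<lambda>y. indicator (cube a' l') y * rho a' l' y)"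
proof -
  let ?v = "\<lambda>y. indicator (cube a' l') y * rho a' l' y" and ?F = "average b (cube a' l')" and ?Q = "average b (cube a l)"
  have "(\<integral>\<^sup>+y\<in>cube a l. ennreal (?v y) \<partial>\<mu>) = (\<integral>\<^sup>+y\<in>cube a l. ennreal (rho a' l' y * 1) \<partial>\<mu>)"
    using sub by (intro nn_integral_cong) (auto simp: indicator_def)
  also have "\<dots> = (\<integral>\<^sup>+y\<in>cube a l. ennreal (\<bar>b y - ?F\<bar> * 1) \<partial>lebesgue)"
    by (rule nn_integral_osc_eq[symmetric]) auto
  finally have eq: "(\<integral>\<^sup>+y\<in>cube a l. ennreal (?v y) \<partial>\<mu>) = (\<integral>\<^sup>+y\<in>cube a l. ennreal \<bar>b y - ?F\<bar> \<partial>lebesgue)" by simp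
  have "\<dots> \<le> (\<integral>\<^sup>+y\<in>cube a' l'. ennreal \<bar>b y - ?F\<bar> \<partial>lebesgue)"
    using sub by (intro nn_integral_mono) (auto simp: indicator_def)
  also have "\<dots> < \<infinity>" using osc[OF l(2), of a'] by (rule order.strict_trans1) simp
  finally have fin: "(\<integral>\<^sup>+y\<in>cube a l. ennreal (?v y) \<partial>\<mu>) < \<infinity>" using eq by simp
  have "ennreal \<bar>?Q - ?F\<bar> * ennreal (l ^ CARD('n)) \<le> (\<integral>\<^sup>+y\<in>cube a l. ennreal \<bar>b y - ?F\<bar> \<partial>lebesgue)"
    by (rule average_diff_le[OF l(1) b_int])
  also have "\<dots> = ennreal (mean a l ?v) * ennreal (W a l)" using mean_eq[OF l(1) fin] eq by simp
  finally have "\<bar>?Q - ?F\<bar> * l ^ CARD('n) \<le> mean a l ?v * W a l"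
    using l mean_nonneg[of a l ?v] W_nonneg[of a l] by (simp add: ennreal_le_iff flip: ennreal_mult)
  then have d: "\<bar>?Q - ?F\<bar> \<le> mean a l ?v * (W a l / l ^ CARD('n))" using l by (simp add: field_simps)
  show ?thesis
    using w_pos W_le[OF l(1), of a]
  proof eventually_elim
    case (elim x)
    show ?case
    proof
      assume "x \<in> cube a l"
      then have "mean a l ?v * (W a l / l ^ CARD('n)) \<le> mean a l ?v * (C1 * w x)"
        using elim mean_nonneg[of a l ?v] by (intro mult_left_mono) auto
      then have "\<bar>b x - ?Q\<bar> \<le> \<bar>b x - ?F\<bar> + mean a l ?v * (C1 * w x)" using d by linarith
      then have "\<bar>b x - ?Q\<bar> / w x \<le> (\<bar>b x - ?F\<bar> + mean a l ?v * (C1 * w x)) / w x"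
        using elim by (intro divide_right_mono) auto
      then show "rho a l x \<le> rho a' l' x + C1 * mean a l ?v"
        using elim by (simp add: rho_def add_divide_distrib mult.commute)
    qed
  qed
qed

end

section \<open>The maximal commutator of one function\<close>

context bmo_weight begin

lemma Kmom_nonneg: "0 \<le> Kmom s" by (simp add: Kmom_def)

definition Cosc :: "real \<Rightarrow> real" where
  "Cosc q = 2 powr q * Kmom q * (1 + C1 powr q * Cmax q) * Cmax q"

lemma Cosc_nonneg: "1 < q \<Longrightarrow> 0 \<le> Cosc q"
  using C1_ge_1 Cmax_nonneg[of q] by (simp add: Cosc_def Kmom_nonneg)

text \<open>Group the cubes by a selected cube whose triple \<open>F\<close> contains them. Within a group the means of \<open>u\<close> are
comparable to one number and \<open>\<rho>\<^sub>Q\<close> is replaced by \<open>\<rho>\<^sub>F\<close> and its maximal function, whose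
\<open>q\<close>-th powers integrate to a multiple of \<open>\<mu>(F)\<close>. The Carleson sum over the selected cubes remains.\<close>

lemma finite_rho_mean_majorant:
  assumes I: "finite I" "\<forall>i\<in>I. 0 < snd i"
    and [measurable]: "u \<in> borel_measurable lebesgue" and u0: "\<And>x. 0 \<le> u x"
    and q: "1 < q" and fin: "pow_int u q < \<infinity>"
  obtains G :: "real ^ 'n \<Rightarrow> real" where "G \<in> borel_measurable lebesgue" "\<forall>x. 0 \<le> G x"
    "AE x in lebesgue. \<forall>(a, l)\<in>I. x \<in> cube a l \<longrightarrow> (rho a l x * mean a l u) powr q \<le> G x"
    "(\<integral>\<^sup>+x. ennreal (G x) \<partial>\<mu>) \<le> ennreal (Cosc q) * pow_int u q"
proof -
  let ?T = "\<lambda>j. cube (fst j - (\<chi> i. snd j)) (3 * snd j)"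
  let ?\<rho> = "\<lambda>j. rho (fst j - (\<chi> i. snd j)) (3 * snd j)"
  let ?m = "\<lambda>j. mean (fst j) (snd j) u"
  let ?v = "\<lambda>j x. indicator (?T j) x * ?\<rho> j x"
  let ?V = "\<lambda>j. W (fst j - (\<chi> i. snd j)) (3 * snd j)"
  obtain J where J: "J \<subseteq> I"
    "\<forall>(a, l)\<in>I. 0 < mean a l u \<longrightarrow>
       (\<exists>(a', l')\<in>J. cube a l \<subseteq> cube (a' - (\<chi> i. l')) (3 * l') \<and> mean a l u \<le> 2 * mean a' l' u)"
    "(\<Sum>(a, l)\<in>J. ennreal ((2 * mean a l u) powr q) * emeasure \<mu> (cube (a - (\<chi> i. l)) (3 * l)))
       \<le> ennreal (Cmax q) * pow_int u q"
    by (rule tripled_selection[OF I assms(3) u0 q fin])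
  have finJ: "finite J" using J(1) I(1) finite_subset by blast
  have posJ: "0 < snd j" if "j \<in> J" for j using that J(1) I(2) by blast
  have v0: "0 \<le> ?v j x" for j x using rho_nonneg by (simp add: indicator_def)
  have vq: "pow_int (?v j) q \<le> ennreal (Kmom q * ?V j)" if "j \<in> J" for j
  proof -
    have "pow_int (?v j) q = (\<integral>\<^sup>+x\<in>?T j. ennreal (?\<rho> j x powr q) \<partial>\<mu>)"
      by (intro nn_integral_cong) (auto simp: indicator_def)
    also have "\<dots> \<le> ennreal (Kmom q * ?V j)" using posJ[OF that] q by (intro rho_moment) auto
    finally show ?thesis .
  qed
  \<comment> \<open>a majorant of the maximal function of the cut-off oscillation, one for each selected cube\<close>
  define P where "P j G \<longleftrightarrow> G \<in> borel_measurable lebesgue \<and> (\<forall>x. 0 \<le> (G x :: real)) \<and>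
      (\<forall>(a, l)\<in>I. \<forall>x\<in>cube a l. mean a l (?v j) powr q \<le> G x) \<and>
      (\<integral>\<^sup>+x. ennreal (G x) \<partial>\<mu>) \<le> ennreal (Cmax q) * ennreal (Kmom q * ?V j)" for j G
  have "\<forall>j\<in>J. \<exists>G. P j G"
  proof
    fix j assume j: "j \<in> J"
    have vfin: "pow_int (?v j) q < \<infinity>"
      by (rule order.strict_trans1[OF vq[OF j]]) simp
    have vm: "?v j \<in> borel_measurable lebesgue" by measurable
    obtain G :: "real ^ 'n \<Rightarrow> real" where G: "G \<in> borel_measurable lebesgue" "\<forall>x. 0 \<le> G x"
      "\<forall>(a, l)\<in>I. \<forall>x\<in>cube a l. mean a l (?v j) powr q \<le> G x"
      "(\<integral>\<^sup>+x. ennreal (G x) \<partial>\<mu>) \<le> ennreal (Cmax q) * pow_int (?v j) q"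
      by (rule finite_maximal_majorant[OF I vm v0 q vfin])
    have "(\<integral>\<^sup>+x. ennreal (G x) \<partial>\<mu>) \<le> ennreal (Cmax q) * ennreal (Kmom q * ?V j)"
      by (rule order_trans[OF G(4) mult_left_mono[OF vq[OF j]]]) simp
    with G(1-3) have "P j G" unfolding P_def by (intro conjI)
    then show "\<exists>G. P j G" by (intro exI[of _ G])
  qed
  then obtain GF where GFP: "\<forall>j\<in>J. P j (GF j)" using bchoice by meson
  have GF: "\<And>j. j \<in> J \<Longrightarrow> GF j \<in> borel_measurable lebesgue"
    "\<And>j x. j \<in> J \<Longrightarrow> 0 \<le> GF j x"
    "\<And>j. j \<in> J \<Longrightarrow> \<forall>(a, l)\<in>I. \<forall>x\<in>cube a l. mean a l (?v j) powr q \<le> GF j x"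
    "\<And>j. j \<in> J \<Longrightarrow> (\<integral>\<^sup>+x. ennreal (GF j x) \<partial>\<mu>) \<le> ennreal (Cmax q) * ennreal (Kmom q * ?V j)"
    using bspec[OF GFP] unfolding P_def by auto
  note GF(1) [measurable]
  define k where "k j = (2 * ?m j) powr q * 2 powr q" for j
  have k0: "0 \<le> k j" for j by (simp add: k_def)
  let ?g = "\<lambda>j x. ?v j x powr q + C1 powr q * GF j x"
  let ?G = "\<lambda>x. \<Sum>j\<in>J. k j * ?g j x"
  have g0: "0 \<le> ?g j x" if "j \<in> J" for j x using GF(2)[OF that] by simp
  show thesis
  proof (rule that[of ?G])
    show "?G \<in> borel_measurable lebesgue" by measurable
    show "\<forall>x. 0 \<le> ?G x" using g0 k0 by (auto intro!: sum_nonneg mult_nonneg_nonneg)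
    have "AE x in lebesgue. \<forall>i\<in>I. \<forall>j\<in>J. cube (fst i) (snd i) \<subseteq> ?T j \<longrightarrow> x \<in> cube (fst i) (snd i) \<longrightarrow>
        rho (fst i) (snd i) x \<le> ?\<rho> j x + C1 * mean (fst i) (snd i) (?v j)"
    proof (intro AE_finite_allI I finJ)
      fix i j assume "i \<in> I" "j \<in> J"
      then show "AE x in lebesgue. cube (fst i) (snd i) \<subseteq> ?T j \<longrightarrow> x \<in> cube (fst i) (snd i) \<longrightarrow>
        rho (fst i) (snd i) x \<le> ?\<rho> j x + C1 * mean (fst i) (snd i) (?v j)"
        using rho_change_cube[of "snd i" "3 * snd j" "fst i"] I(2) posJ
        by (cases "cube (fst i) (snd i) \<subseteq> ?T j") auto
    qed
    then show "AE x in lebesgue. \<forall>(a, l)\<in>I. x \<in> cube a l \<longrightarrow> (rho a l x * mean a l u) powr q \<le> ?G x"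
    proof eventually_elim
      case (elim x)
      have "(rho a l x * mean a l u) powr q \<le> ?G x" if al: "(a, l) \<in> I" "x \<in> cube a l" for a l
      proof (cases "0 < mean a l u")
        case True
        then obtain j where j: "j \<in> J" "cube a l \<subseteq> ?T j" "mean a l u \<le> 2 * ?m j"
          using bspec[OF J(2) al(1)] by (auto simp: case_prod_beta)
        have xT: "x \<in> ?T j" using al j by auto
        have r: "rho a l x \<le> ?v j x + C1 * mean a l (?v j)"
          using bspec[OF bspec[OF elim al(1)] j(1)] j al xT by simp
        have "(rho a l x * mean a l u) powr q \<le> ((?v j x + C1 * mean a l (?v j)) * (2 * ?m j)) powr q"
          using r j(3) True q rho_nonneg[of a l x] order_trans[OF rho_nonneg r] by (intro powr_mono2 mult_mono) auto
        also have "\<dots> = (2 * ?m j) powr q * (?v j x + C1 * mean a l (?v j)) powr q"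
          using mean_nonneg order_trans[OF rho_nonneg r] by (subst powr_mult) auto
        also have "\<dots> \<le> (2 * ?m j) powr q * (2 powr q * (?v j x powr q + (C1 * mean a l (?v j)) powr q))"
          using v0 mean_nonneg C1_ge_1 q by (intro mult_left_mono powr_add_le) auto
        also have "(C1 * mean a l (?v j)) powr q = C1 powr q * mean a l (?v j) powr q"
          using mean_nonneg C1_ge_1 by (subst powr_mult) auto
        also have "(2 * ?m j) powr q * (2 powr q * (?v j x powr q + C1 powr q * mean a l (?v j) powr q)) \<le> k j * ?g j x"
          using bspec[OF GF(3)[OF j(1)] al(1)] al(2) unfolding k_def mult.assoc
          by (intro mult_left_mono add_left_mono) auto
        also have "\<dots> \<le> ?G x" using j(1) finJ g0 k0 by (intro member_le_sum) auto
        finally show ?thesis .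
      next
        case False
        then have "mean a l u = 0" using mean_nonneg[of a l u] by simp
        then show ?thesis using g0 k0 by (auto intro!: sum_nonneg mult_nonneg_nonneg)
      qed
      then show ?case by auto
    qed
    let ?c = "2 powr q * Kmom q * (1 + C1 powr q * Cmax q)"
    have c0: "0 \<le> ?c" using Cmax_nonneg[OF q] C1_ge_1 by (simp add: Kmom_nonneg)
    have "(\<integral>\<^sup>+x. ennreal (?G x) \<partial>\<mu>) = (\<integral>\<^sup>+x. (\<Sum>j\<in>J. ennreal (k j) * (ennreal (?v j x powr q) + ennreal (C1 powr q) * ennreal (GF j x))) \<partial>\<mu>)"
    proof (intro nn_integral_cong)
      fix x
      have "ennreal (?G x) = (\<Sum>j\<in>J. ennreal (k j * ?g j x))"
        using g0 k0 by (intro sum_ennreal[symmetric]) auto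
      also have "\<dots> = (\<Sum>j\<in>J. ennreal (k j) * (ennreal (?v j x powr q) + ennreal (C1 powr q) * ennreal (GF j x)))"
        using g0 k0 GF(2) by (intro sum.cong) (auto simp: ennreal_mult ennreal_plus)
      finally show "ennreal (?G x) = \<dots>" .
    qed
    also have "\<dots> = (\<Sum>j\<in>J. ennreal (k j) * (pow_int (?v j) q + ennreal (C1 powr q) * (\<integral>\<^sup>+x. ennreal (GF j x) \<partial>\<mu>)))"
      by (subst nn_integral_sum) (auto simp: nn_integral_cmult nn_integral_add intro!: sum.cong)
    also have "\<dots> \<le> (\<Sum>j\<in>J. ennreal ?c * (ennreal ((2 * ?m j) powr q) * emeasure \<mu> (?T j)))"
    proof (rule sum_mono)
      fix j assume j: "j \<in> J"
      have "ennreal (k j) * (pow_int (?v j) q + ennreal (C1 powr q) * (\<integral>\<^sup>+x. ennreal (GF j x) \<partial>\<mu>))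
          \<le> ennreal (k j) * (ennreal (Kmom q * ?V j) + ennreal (C1 powr q) * (ennreal (Cmax q) * ennreal (Kmom q * ?V j)))"
        using vq[OF j] GF(4)[OF j] by (intro mult_left_mono add_mono) auto
      also have "\<dots> = ennreal (k j * (Kmom q * ?V j + C1 powr q * (Cmax q * (Kmom q * ?V j))))"
        using Cmax_nonneg[OF q] k0 Kmom_nonneg[of q] W_nonneg
        by (simp add: ennreal_mult ennreal_plus)
      also have "k j * (Kmom q * ?V j + C1 powr q * (Cmax q * (Kmom q * ?V j))) = ?c * ((2 * ?m j) powr q * ?V j)"
        by (simp add: k_def algebra_simps)
      also have "ennreal \<dots> = ennreal ?c * (ennreal ((2 * ?m j) powr q) * emeasure \<mu> (?T j))"
        using c0 W_nonneg by (simp add: ennreal_mult emeasure_mu_cube)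
      finally show "ennreal (k j) * (pow_int (?v j) q + ennreal (C1 powr q) * (\<integral>\<^sup>+x. ennreal (GF j x) \<partial>\<mu>))
          \<le> ennreal ?c * (ennreal ((2 * ?m j) powr q) * emeasure \<mu> (?T j))" .
    qed
    also have "\<dots> = ennreal ?c * (\<Sum>j\<in>J. ennreal ((2 * ?m j) powr q) * emeasure \<mu> (?T j))"
      by (simp add: sum_distrib_left)
    also have "\<dots> \<le> ennreal ?c * (ennreal (Cmax q) * pow_int u q)"
      using J(3) by (intro mult_left_mono) (auto simp: case_prod_beta)
    also have "\<dots> = ennreal (Cosc q) * pow_int u q"
      unfolding Cosc_def ennreal_mult[OF c0 Cmax_nonneg[OF q]] by (simp only: mult.assoc)
    finally show "(\<integral>\<^sup>+x. ennreal (?G x) \<partial>\<mu>) \<le> ennreal (Cosc q) * pow_int u q" .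
  qed
qed

text \<open>Any exponent strictly between 1 and \<open>q\<close> serves: \<open>u\<close> to this power is still in some \<open>L\<^sup>s(\<mu>)\<close> with \<open>s > 1\<close>.\<close>

definition rq :: "real \<Rightarrow> real" where "rq q = (1 + q) / 2"

definition Cmean :: "real \<Rightarrow> real" where
  "Cmean q = (Kmom (rq q / (rq q - 1)) + 1) powr q * Cmax (q / rq q)"

lemma rq: "1 < q \<Longrightarrow> 1 < rq q" "1 < q \<Longrightarrow> 1 < q / rq q" "1 < q \<Longrightarrow> rq q \<le> q"
  by (auto simp: rq_def field_simps)

lemma Cmean_nonneg: "1 < q \<Longrightarrow> 0 \<le> Cmean q"
  using Cmax_nonneg[OF rq(2)] by (simp add: Cmean_def)

lemma powr_rq_integrable:
  assumes [measurable]: "u \<in> borel_measurable lebesgue" and u0: "\<And>x. 0 \<le> u x"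
    and q: "1 < q" and fin: "pow_int u q < \<infinity>"
  shows "(\<integral>\<^sup>+x. ennreal ((u x powr rq q) powr (q / rq q)) \<partial>\<mu>) = pow_int u q"
    "(\<integral>\<^sup>+x\<in>cube a l. ennreal (u x powr rq q) \<partial>\<mu>) < \<infinity>"
proof -
  show *: "(\<integral>\<^sup>+x. ennreal ((u x powr rq q) powr (q / rq q)) \<partial>\<mu>) = pow_int u q"
    using rq(1)[OF q] by (simp add: powr_powr)
  show "(\<integral>\<^sup>+x\<in>cube a l. ennreal (u x powr rq q) \<partial>\<mu>) < \<infinity>"
    using rq[OF q] by (intro powr_integrable_on_cube[of _ "q / rq q"]) (auto simp: * fin[simplified])
qed

text \<open>By Hoelder's inequality with the moments of \<open>\<rho>\<close> this is dominated by the maximal function of a power of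
\<open>u\<close>.\<close>

lemma finite_mean_rho_majorant:
  assumes I: "finite I" "\<forall>i\<in>I. 0 < snd i"
    and [measurable]: "u \<in> borel_measurable lebesgue" and u0: "\<And>x. 0 \<le> u x"
    and q: "1 < q" and fin: "pow_int u q < \<infinity>"
  obtains G :: "real ^ 'n \<Rightarrow> real" where "G \<in> borel_measurable lebesgue" "\<forall>x. 0 \<le> G x"
    "\<forall>(a, l)\<in>I. \<forall>x\<in>cube a l. mean a l (\<lambda>y. rho a l y * u y) powr q \<le> G x"
    "(\<integral>\<^sup>+x. ennreal (G x) \<partial>\<mu>) \<le> ennreal (Cmean q) * pow_int u q"
proof -
  let ?r = "rq q" and ?k = "Kmom (rq q / (rq q - 1)) + 1"
  have k0: "0 \<le> ?k" by (simp add: Kmom_nonneg)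
  have um: "(\<lambda>x. u x powr ?r) \<in> borel_measurable lebesgue" by measurable
  have u1: "0 \<le> u x powr ?r" for x by simp
  have fin': "(\<integral>\<^sup>+x. ennreal ((u x powr ?r) powr (q / ?r)) \<partial>\<mu>) < \<infinity>"
    using powr_rq_integrable(1)[OF assms(3) u0 q fin] fin by simp
  obtain G :: "real ^ 'n \<Rightarrow> real" where G: "G \<in> borel_measurable lebesgue" "\<forall>x. 0 \<le> G x"
    "\<forall>(a, l)\<in>I. \<forall>x\<in>cube a l. mean a l (\<lambda>x. u x powr ?r) powr (q / ?r) \<le> G x"
    "(\<integral>\<^sup>+x. ennreal (G x) \<partial>\<mu>) \<le> ennreal (Cmax (q / ?r)) * (\<integral>\<^sup>+x. ennreal ((u x powr ?r) powr (q / ?r)) \<partial>\<mu>)"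
    by (rule finite_maximal_majorant[OF I um u1 rq(2)[OF q] fin'])
  note G(1) [measurable]
  show thesis
  proof (rule that[of "\<lambda>x. ?k powr q * G x"])
    show "\<forall>x. 0 \<le> ?k powr q * G x" using G(2) by simp
    have "mean a l (\<lambda>y. rho a l y * u y) powr q \<le> ?k powr q * G x" if al: "(a, l) \<in> I" "x \<in> cube a l" for a l x
    proof -
      have l: "0 < l" using I(2) al by auto
      have "mean a l (\<lambda>y. rho a l y * u y) \<le> ?k * mean a l (\<lambda>x. u x powr ?r) powr (1 / ?r)"
        by (rule mean_rho_le[OF l assms(3) u0 rq(1)[OF q] powr_rq_integrable(2)[OF assms(3) u0 q fin]])
      then have "mean a l (\<lambda>y. rho a l y * u y) powr q \<le> (?k * mean a l (\<lambda>x. u x powr ?r) powr (1 / ?r)) powr q"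
        using q mean_nonneg by (intro powr_mono2) auto
      also have "\<dots> = ?k powr q * mean a l (\<lambda>x. u x powr ?r) powr (q / ?r)"
        using k0 by (subst powr_mult) (auto simp: powr_powr)
      also have "\<dots> \<le> ?k powr q * G x"
        using bspec[OF G(3) al(1)] al(2) by (intro mult_left_mono) auto
      finally show ?thesis .
    qed
    then show "\<forall>(a, l)\<in>I. \<forall>x\<in>cube a l. mean a l (\<lambda>y. rho a l y * u y) powr q \<le> ?k powr q * G x" by auto
    have "(\<integral>\<^sup>+x. ennreal (?k powr q * G x) \<partial>\<mu>) = ennreal (?k powr q) * (\<integral>\<^sup>+x. ennreal (G x) \<partial>\<mu>)"
      using G(2) by (subst nn_integral_cmult[symmetric]) (auto simp: ennreal_mult)
    also have "\<dots> \<le> ennreal (?k powr q) * (ennreal (Cmax (q / ?r)) * pow_int u q)"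
      using G(4) powr_rq_integrable(1)[OF assms(3) u0 q fin] by (intro mult_left_mono) auto
    also have "\<dots> = ennreal (Cmean q) * pow_int u q"
      unfolding Cmean_def using Cmax_nonneg[OF rq(2)[OF q]] by (simp add: ennreal_mult mult.assoc)
    finally show "(\<integral>\<^sup>+x. ennreal (?k powr q * G x) \<partial>\<mu>) \<le> ennreal (Cmean q) * pow_int u q" .
  qed measurable
qed

text \<open>Splitting \<open>b x - b y\<close> at the average of \<open>b\<close> over the cube bounds the commutator average by \<open>Z\<close>. The two
terms are expressed through \<open>\<mu>\<close>-means; the bound is measurable in \<open>x\<close> by inspection.\<close>

definition Z :: "real ^ 'n \<Rightarrow> real \<Rightarrow> (real ^ 'n \<Rightarrow> real) \<Rightarrow> real ^ 'n \<Rightarrow> real" where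
  "Z a l u x = \<bar>b x - average b (cube a l)\<bar> * (C1 * mean a l u) + W a l / l ^ CARD('n) * mean a l (\<lambda>y. rho a l y * u y)"

lemma Z_measurable [measurable]: "Z a l u \<in> borel_measurable lebesgue"
  unfolding Z_def by measurable

lemma Z_nonneg: "0 < l \<Longrightarrow> 0 \<le> Z a l u x"
  using C1_ge_1 by (simp add: Z_def mean_nonneg W_nonneg)

lemma commutator_average_le_Z:
  assumes l: "0 < l" and [measurable]: "u \<in> borel_measurable lebesgue" and u0: "\<And>x. 0 \<le> u x"
    and q: "1 < q" and fin: "pow_int u q < \<infinity>"
  shows "(\<integral>\<^sup>+y\<in>cube a l. ennreal (\<bar>b x - b y\<bar> * u y) \<partial>lebesgue) \<le> ennreal (Z a l u x * l ^ CARD('n))"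
proof -
  let ?m = "average b (cube a l)" and ?d = "\<bar>b x - average b (cube a l)\<bar>" and ?L = "l ^ CARD('n)"
  let ?\<rho>u = "mean a l (\<lambda>y. rho a l y * u y)"
  have "(\<integral>\<^sup>+y\<in>cube a l. ennreal (\<bar>b x - b y\<bar> * u y) \<partial>lebesgue)
      \<le> (\<integral>\<^sup>+y. ennreal ?d * (ennreal (u y) * indicator (cube a l) y) + ennreal (\<bar>b y - ?m\<bar> * u y) * indicator (cube a l) y \<partial>lebesgue)"
  proof (rule nn_integral_mono)
    fix y
    have "\<bar>b x - b y\<bar> * u y \<le> (?d + \<bar>b y - ?m\<bar>) * u y" using u0 by (intro mult_right_mono) auto
    then have "ennreal (\<bar>b x - b y\<bar> * u y) \<le> ennreal (?d * u y + \<bar>b y - ?m\<bar> * u y)"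
      by (intro ennreal_leI) (simp add: distrib_right)
    also have "\<dots> = ennreal ?d * ennreal (u y) + ennreal (\<bar>b y - ?m\<bar> * u y)"
      using u0 by (simp add: ennreal_plus ennreal_mult)
    finally show "ennreal (\<bar>b x - b y\<bar> * u y) * indicator (cube a l) y
       \<le> ennreal ?d * (ennreal (u y) * indicator (cube a l) y) + ennreal (\<bar>b y - ?m\<bar> * u y) * indicator (cube a l) y"
      by (auto simp: indicator_def)
  qed
  also have "\<dots> = ennreal ?d * (\<integral>\<^sup>+y\<in>cube a l. ennreal (u y) \<partial>lebesgue) + (\<integral>\<^sup>+y\<in>cube a l. ennreal (\<bar>b y - ?m\<bar> * u y) \<partial>lebesgue)"
    by (subst nn_integral_add) (auto simp: nn_integral_cmult)
  also have "(\<integral>\<^sup>+y\<in>cube a l. ennreal (\<bar>b y - ?m\<bar> * u y) \<partial>lebesgue) = (\<integral>\<^sup>+y\<in>cube a l. ennreal (rho a l y * u y) \<partial>\<mu>)"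
    using u0 by (intro nn_integral_osc_eq) auto
  also have "\<dots> = ennreal ?\<rho>u * ennreal (W a l)"
    by (rule mean_eq[symmetric, OF l mean_rho_finite[OF l assms(2) u0 rq(1)[OF q] powr_rq_integrable(2)[OF assms(2) u0 q fin]]])
  also have "\<dots> = ennreal (?\<rho>u * W a l)" by (simp add: ennreal_mult mean_nonneg W_nonneg)
  also have "ennreal ?d * (\<integral>\<^sup>+y\<in>cube a l. ennreal (u y) \<partial>lebesgue) \<le> ennreal ?d * ennreal (C1 * mean a l u * ?L)"
    using q by (intro mult_left_mono lebesgue_mean_le l powr_integrable_on_cube[OF _ u0 _ fin]) auto
  also have "\<dots> = ennreal (?d * (C1 * mean a l u * ?L))"
    using C1_ge_1 l by (simp add: ennreal_mult mean_nonneg)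
  finally have "(\<integral>\<^sup>+y\<in>cube a l. ennreal (\<bar>b x - b y\<bar> * u y) \<partial>lebesgue)
      \<le> ennreal (?d * (C1 * mean a l u * ?L)) + ennreal (?\<rho>u * W a l)" by simp
  also have "\<dots> = ennreal (?d * (C1 * mean a l u * ?L) + ?\<rho>u * W a l)"
    using C1_ge_1 l by (simp add: ennreal_plus mean_nonneg W_nonneg)
  also have "?d * (C1 * mean a l u * ?L) + ?\<rho>u * W a l = Z a l u x * ?L"
    using l by (simp add: Z_def field_simps)
  finally show ?thesis .
qed

lemma Z_over_w_le:
  assumes "0 < l"
  shows "AE x in lebesgue. x \<in> cube a l \<longrightarrow>
     Z a l u x / w x \<le> C1 * (rho a l x * mean a l u + mean a l (\<lambda>y. rho a l y * u y))"
  using w_pos W_le[OF assms, of a]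
proof eventually_elim
  case (elim x)
  show ?case
  proof
    assume "x \<in> cube a l"
    then have "W a l / l ^ CARD('n) * mean a l (\<lambda>y. rho a l y * u y) \<le> C1 * w x * mean a l (\<lambda>y. rho a l y * u y)"
      using elim mean_nonneg by (intro mult_right_mono) auto
    then have "Z a l u x / w x \<le> (\<bar>b x - average b (cube a l)\<bar> * (C1 * mean a l u) + C1 * w x * mean a l (\<lambda>y. rho a l y * u y)) / w x"
      using elim unfolding Z_def by (intro divide_right_mono) auto
    also have "\<dots> = C1 * (rho a l x * mean a l u + mean a l (\<lambda>y. rho a l y * u y))"
      using elim by (simp add: rho_def field_simps)
    finally show "Z a l u x / w x \<le> \<dots>" .
  qed
qed

definition Ccomm :: "real \<Rightarrow> real" where "Ccomm q = (2 * C1) powr q * (Cosc q + Cmean q)"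

lemma Ccomm_nonneg: "1 < q \<Longrightarrow> 0 \<le> Ccomm q"
  using Cosc_nonneg Cmean_nonneg by (simp add: Ccomm_def)

text \<open>Divided by \<open>w\<close>, the two terms of \<open>Z\<close> are the two quantities with known majorants.\<close>

lemma finite_commutator_bound:
  assumes I: "finite I" "\<forall>i\<in>I. 0 < snd i"
    and [measurable]: "u \<in> borel_measurable lebesgue" and u0: "\<And>x. 0 \<le> u x"
    and q: "1 < q" and fin: "pow_int u q < \<infinity>"
  shows "(\<integral>\<^sup>+x. (SUP i\<in>I. ennreal ((Z (fst i) (snd i) u x / w x) powr q) * indicator (cube (fst i) (snd i)) x) \<partial>\<mu>)
     \<le> ennreal (Ccomm q) * pow_int u q"
proof -
  let ?U = "pow_int u q"
  obtain G1 :: "real ^ 'n \<Rightarrow> real" where G1: "G1 \<in> borel_measurable lebesgue" "\<forall>x. 0 \<le> G1 x"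
    "AE x in lebesgue. \<forall>(a, l)\<in>I. x \<in> cube a l \<longrightarrow> (rho a l x * mean a l u) powr q \<le> G1 x"
    "(\<integral>\<^sup>+x. ennreal (G1 x) \<partial>\<mu>) \<le> ennreal (Cosc q) * ?U"
    by (rule finite_rho_mean_majorant[OF I assms(3) u0 q fin])
  obtain G2 :: "real ^ 'n \<Rightarrow> real" where G2: "G2 \<in> borel_measurable lebesgue" "\<forall>x. 0 \<le> G2 x"
    "\<forall>(a, l)\<in>I. \<forall>x\<in>cube a l. mean a l (\<lambda>y. rho a l y * u y) powr q \<le> G2 x"
    "(\<integral>\<^sup>+x. ennreal (G2 x) \<partial>\<mu>) \<le> ennreal (Cmean q) * ?U"
    by (rule finite_mean_rho_majorant[OF I assms(3) u0 q fin])
  note G1(1) [measurable] G2(1) [measurable]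
  have "AE x in lebesgue. \<forall>i\<in>I. x \<in> cube (fst i) (snd i) \<longrightarrow>
     Z (fst i) (snd i) u x / w x \<le> C1 * (rho (fst i) (snd i) x * mean (fst i) (snd i) u + mean (fst i) (snd i) (\<lambda>y. rho (fst i) (snd i) y * u y))"
    using I by (intro AE_finite_allI Z_over_w_le) auto
  with G1(3) have "AE x in lebesgue. (SUP i\<in>I. ennreal ((Z (fst i) (snd i) u x / w x) powr q) * indicator (cube (fst i) (snd i)) x)
      \<le> ennreal ((2 * C1) powr q) * (ennreal (G1 x) + ennreal (G2 x))"
  proof eventually_elim
    case (elim x)
    show ?case
    proof (rule SUP_least)
      fix i assume i: "i \<in> I"
      obtain a l where al: "i = (a, l)" by (cases i)
      have l: "0 < l" using I(2) i al by auto
      show "ennreal ((Z (fst i) (snd i) u x / w x) powr q) * indicator (cube (fst i) (snd i)) x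
         \<le> ennreal ((2 * C1) powr q) * (ennreal (G1 x) + ennreal (G2 x))"
      proof (cases "x \<in> cube a l")
        case True
        let ?p = "rho a l x * mean a l u" and ?s = "mean a l (\<lambda>y. rho a l y * u y)"
        have p0: "0 \<le> ?p" "0 \<le> ?s" using rho_nonneg mean_nonneg by auto
        have "(Z a l u x / w x) powr q \<le> (C1 * (?p + ?s)) powr q"
          using elim(2) i al True Z_nonneg[OF l] w_nonneg q by (intro powr_mono2) auto
        also have "\<dots> = C1 powr q * (?p + ?s) powr q" using C1_ge_1 p0 by (subst powr_mult) auto
        also have "\<dots> \<le> C1 powr q * (2 powr q * (?p powr q + ?s powr q))"
          using p0 q by (intro mult_left_mono powr_add_le) auto
        also have "\<dots> \<le> C1 powr q * (2 powr q * (G1 x + G2 x))"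
          using elim(1) G2(3) i al True by (intro mult_left_mono add_mono) auto
        also have "\<dots> = (2 * C1) powr q * (G1 x + G2 x)" using C1_ge_1 by (simp add: powr_mult)
        finally have "ennreal ((Z a l u x / w x) powr q) \<le> ennreal ((2 * C1) powr q * (G1 x + G2 x))"
          by (rule ennreal_leI)
        then show ?thesis using True al G1(2) G2(2) by (simp add: ennreal_mult ennreal_plus)
      qed (simp add: al)
    qed
  qed
  then have "(\<integral>\<^sup>+x. (SUP i\<in>I. ennreal ((Z (fst i) (snd i) u x / w x) powr q) * indicator (cube (fst i) (snd i)) x) \<partial>\<mu>)
      \<le> (\<integral>\<^sup>+x. ennreal ((2 * C1) powr q) * (ennreal (G1 x) + ennreal (G2 x)) \<partial>\<mu>)"
    by (intro nn_integral_mono_AE AE_mu)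
  also have "\<dots> = ennreal ((2 * C1) powr q) * ((\<integral>\<^sup>+x. ennreal (G1 x) \<partial>\<mu>) + (\<integral>\<^sup>+x. ennreal (G2 x) \<partial>\<mu>))"
    by (simp add: nn_integral_cmult nn_integral_add)
  also have "\<dots> \<le> ennreal ((2 * C1) powr q) * (ennreal (Cosc q) * ?U + ennreal (Cmean q) * ?U)"
    using G1(4) G2(4) by (intro mult_left_mono add_mono) auto
  also have "\<dots> = ennreal (Ccomm q) * ?U"
    using Cosc_nonneg[OF q] Cmean_nonneg[OF q] by (simp add: Ccomm_def ennreal_mult ennreal_plus distrib_right mult.assoc)
  finally show ?thesis .
qed

text \<open>The one-function estimate behind both bilinear ones: the commutator maps \<open>L\<^sup>q(w)\<close> to
\<open>L\<^sup>q(w powr (1 - q))\<close>, because \<open>(z / w)\<^sup>q w = z\<^sup>q w powr (1 - q)\<close>.\<close>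

lemma commutator_majorant:
  assumes [measurable]: "u \<in> borel_measurable lebesgue" and u0: "\<And>x. 0 \<le> u x"
    and q: "1 < q" and fin: "pow_int u q < \<infinity>"
  obtains H where "H \<in> borel_measurable lebesgue"
    "(\<integral>\<^sup>+x. H x \<partial>\<mu>) \<le> ennreal ((4 ^ CARD('n)) powr q) * (ennreal (Ccomm q) * pow_int u q)"
    "controls w q (\<lambda>x y. \<bar>b x - b y\<bar> * u y) H"
  by (rule majorant_over_all_cubes[of "\<lambda>a l. Z a l u" w "\<lambda>x y. \<bar>b x - b y\<bar> * u y" q,
        OF _ _ _ _ commutator_average_le_Z[OF _ assms(1) u0 q fin] finite_commutator_bound[OF _ _ assms(1) u0 q fin]])
    (use w_nonneg Z_nonneg that in auto)

end

section \<open>Weighted norms of bilinear maximal operators\<close>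

lemma ennreal_power_ennreal [simp]: "0 \<le> x \<Longrightarrow> ennreal_power (ennreal x) q = ennreal (x powr q)"
  by (simp add: ennreal_power_def)

lemma ennreal_power_top [simp]: "ennreal_power top q = top"
  by (simp add: ennreal_power_def)

lemma ennreal_power_mono:
  assumes "0 < q" "s \<le> t"
  shows "ennreal_power s q \<le> ennreal_power t q"
proof (cases t)
  case (real y)
  then obtain x where "s = ennreal x" "0 \<le> x" using assms(2) by (cases s) (auto simp: top_unique)
  then show ?thesis using real assms by (auto simp: ennreal_le_iff intro!: ennreal_leI powr_mono2)
qed simp

lemma ennreal_power_inverse:
  assumes "0 < q"
  shows "ennreal_power (ennreal_power t (1 / q)) q = t" "ennreal_power (ennreal_power t q) (1 / q) = t"
  using assms by (cases t; simp add: powr_powr)+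

lemma ennreal_power_SUP_le:
  assumes "0 < q" "\<And>i. i \<in> A \<Longrightarrow> ennreal_power (t i) q \<le> c"
  shows "ennreal_power (SUP i\<in>A. t i) q \<le> c"
proof -
  have "t i \<le> ennreal_power c (1 / q)" if "i \<in> A" for i
    using ennreal_power_mono[OF _ assms(2)[OF that], of "1 / q"] assms(1) by (simp add: ennreal_power_inverse)
  then have "(SUP i\<in>A. t i) \<le> ennreal_power c (1 / q)" by (rule SUP_least)
  then have "ennreal_power (SUP i\<in>A. t i) q \<le> ennreal_power (ennreal_power c (1 / q)) q"
    using assms(1) by (intro ennreal_power_mono)
  then show ?thesis using assms(1) by (simp add: ennreal_power_inverse)
qed

lemma ennreal_power_add_le:
  assumes "0 < q"
  shows "ennreal_power (s + t) q \<le> ennreal (2 powr q) * (ennreal_power s q + ennreal_power t q)"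
proof (cases s; cases t)
  fix x y assume *: "s = ennreal x" "0 \<le> x" "t = ennreal y" "0 \<le> y"
  then have "ennreal_power (s + t) q = ennreal ((x + y) powr q)" by (simp flip: ennreal_plus)
  also have "\<dots> \<le> ennreal (2 powr q * (x powr q + y powr q))"
    using * assms by (intro ennreal_leI powr_add_le) auto
  finally show ?thesis using * by (simp add: ennreal_mult ennreal_plus)
qed (auto simp: ennreal_mult_top)

text \<open>The free scalings \<open>l1\<close> and \<open>l2\<close> take the place of a normalization of the two functions.\<close>

lemma scaled_young:
  fixes x y p p1 p2 l1 l2 :: real
  assumes "0 \<le> x" "0 \<le> y" "0 < p" "0 < p1" "0 < p2" "1 / p = 1 / p1 + 1 / p2" "0 < l1" "0 < l2"
  shows "(x * y) powr p \<le> (l1 * l2) powr p * (x powr p1 / l1 powr p1 + y powr p2 / l2 powr p2)"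
proof -
  have s: "p / p1 + p / p2 = 1"
  proof -
    have "p / p1 + p / p2 = p * (1 / p1 + 1 / p2)" by (simp add: distrib_left)
    then show ?thesis using assms(3) unfolding assms(6)[symmetric] by simp
  qed
  have "(x / l1 * (y / l2)) powr p = ((x / l1) powr p1) powr (p / p1) * ((y / l2) powr p2) powr (p / p2)"
    using assms by (subst powr_mult) (simp_all add: powr_powr)
  also have "\<dots> \<le> (x / l1) powr p1 + (y / l2) powr p2"
    using assms s by (intro powr_mult_powr_le_add) auto
  finally have "(l1 * l2) powr p * (x / l1 * (y / l2)) powr p \<le> (l1 * l2) powr p * ((x / l1) powr p1 + (y / l2) powr p2)"
    by (rule mult_left_mono) simp
  moreover have "(l1 * l2) powr p * (x / l1 * (y / l2)) powr p = (x * y) powr p"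
    using assms by (subst powr_mult[symmetric]) auto
  ultimately show ?thesis using assms by (simp add: powr_divide)
qed

text \<open>Optimizing the scalings recovers the product of the norms. They are taken slightly larger than optimal and a
limit is used, so that no function has to be assumed nonzero.\<close>

lemma le_of_all_scalings:
  fixes c1 c2 k p p1 p2 :: real and L :: ennreal
  assumes "0 \<le> c1" "0 \<le> c2" "0 \<le> k" "0 < p" "0 < p1" "0 < p2"
    and L: "\<And>l1 l2. 0 < l1 \<Longrightarrow> 0 < l2 \<Longrightarrow> L \<le> ennreal (k * ((l1 * l2) powr p * (c1 / l1 powr p1 + c2 / l2 powr p2)))"
  shows "L \<le> ennreal (2 * k * (c1 powr (1 / p1) * c2 powr (1 / p2)) powr p)"
proof -
  define \<alpha> \<beta> where "\<alpha> = c1 powr (1 / p1)" and "\<beta> = c2 powr (1 / p2)"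
  have ab: "0 \<le> \<alpha>" "0 \<le> \<beta>" "\<alpha> powr p1 = c1" "\<beta> powr p2 = c2"
    using assms by (auto simp: \<alpha>_def \<beta>_def powr_powr)
  have le: "L \<le> ennreal (2 * k * ((\<alpha> + e) * (\<beta> + e)) powr p)" if "0 < e" for e
  proof -
    have "\<alpha> powr p1 \<le> (\<alpha> + e) powr p1" "\<beta> powr p2 \<le> (\<beta> + e) powr p2"
      using ab assms that by (auto intro!: powr_mono2)
    then have "c1 / (\<alpha> + e) powr p1 \<le> 1" "c2 / (\<beta> + e) powr p2 \<le> 1"
      using ab that by (auto simp: divide_le_eq)
    then have "c1 / (\<alpha> + e) powr p1 + c2 / (\<beta> + e) powr p2 \<le> 2" by linarith
    then have "k * (((\<alpha> + e) * (\<beta> + e)) powr p * (c1 / (\<alpha> + e) powr p1 + c2 / (\<beta> + e) powr p2))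
        \<le> k * (((\<alpha> + e) * (\<beta> + e)) powr p * 2)"
      using assms by (intro mult_left_mono) auto
    then have "ennreal (k * (((\<alpha> + e) * (\<beta> + e)) powr p * (c1 / (\<alpha> + e) powr p1 + c2 / (\<beta> + e) powr p2)))
        \<le> ennreal (2 * k * ((\<alpha> + e) * (\<beta> + e)) powr p)"
      by (intro ennreal_leI) (simp add: mult_ac)
    with L[of "\<alpha> + e" "\<beta> + e"] ab that show ?thesis by (auto intro: order_trans)
  qed
  have "((\<lambda>e. ennreal (2 * k * ((\<alpha> + e) * (\<beta> + e)) powr p)) \<longlongrightarrow> ennreal (2 * k * ((\<alpha> + 0) * (\<beta> + 0)) powr p)) (at_right 0)"
    using ab assms(4)
    by (intro tendsto_ennrealI tendsto_mult tendsto_const tendsto_powr' tendsto_add tendsto_ident_at)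
      (auto simp: eventually_at_filter intro!: always_eventually mult_nonneg_nonneg)
  then have "L \<le> ennreal (2 * k * ((\<alpha> + 0) * (\<beta> + 0)) powr p)"
    by (rule tendsto_lowerbound) (auto simp: eventually_at_filter le)
  then show ?thesis by (simp add: \<alpha>_def \<beta>_def)
qed

text \<open>The double integral of a tensor product factors.\<close>

lemma sup_avg2_product:
  fixes g1 g2 :: "real ^ 'n \<Rightarrow> real"
  assumes [measurable]: "g1 \<in> borel_measurable lebesgue" "g2 \<in> borel_measurable lebesgue"
    and "\<And>y. 0 \<le> g1 y" "\<And>y. 0 \<le> g2 y"
  shows "sup_avg2 x (\<lambda>y1 y2. g1 y1 * g2 y2) = (SUP Q\<in>{Q. is_cube Q \<and> x \<in> Q}.
     (\<integral>\<^sup>+y\<in>Q. ennreal (g1 y) \<partial>lebesgue) * (\<integral>\<^sup>+y\<in>Q. ennreal (g2 y) \<partial>lebesgue) / (emeasure lebesgue Q)\<^sup>2)"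
  unfolding sup_avg2_def
proof (intro SUP_cong refl, clarify)
  fix Q :: "(real ^ 'n) set" assume "is_cube Q"
  then have [measurable]: "Q \<in> sets lebesgue" by (auto simp: is_cube_iff)
  have "(\<integral>\<^sup>+y1\<in>Q. ennreal (g1 y1 * g2 y2) \<partial>lebesgue) = (\<integral>\<^sup>+y1\<in>Q. ennreal (g1 y1) \<partial>lebesgue) * ennreal (g2 y2)" for y2
  proof -
    have "(\<integral>\<^sup>+y1\<in>Q. ennreal (g1 y1 * g2 y2) \<partial>lebesgue) = (\<integral>\<^sup>+y1. ennreal (g1 y1) * indicator Q y1 * ennreal (g2 y2) \<partial>lebesgue)"
      using assms by (intro nn_integral_cong) (auto simp: ennreal_mult indicator_def)
    then show ?thesis by (simp add: nn_integral_multc)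
  qed
  then show "(\<integral>\<^sup>+y2\<in>Q. (\<integral>\<^sup>+y1\<in>Q. ennreal (g1 y1 * g2 y2) \<partial>lebesgue) \<partial>lebesgue) / (emeasure lebesgue Q)\<^sup>2
      = (\<integral>\<^sup>+y\<in>Q. ennreal (g1 y) \<partial>lebesgue) * (\<integral>\<^sup>+y\<in>Q. ennreal (g2 y) \<partial>lebesgue) / (emeasure lebesgue Q)\<^sup>2"
    by (simp add: mult.assoc nn_integral_cmult)
qed

text \<open>The weight \<open>v\<close> absorbs the normalizations \<open>d1\<close> and \<open>d2\<close> of the two factors and leaves the density \<open>w\<close> of
\<open>\<mu>\<close>; this is where the exponents of the target weights come from.\<close>

lemma sup_avg2_power_le:
  fixes g1 g2 :: "real ^ 'n \<Rightarrow> real ^ 'n \<Rightarrow> real"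
  assumes [measurable]: "g1 x \<in> borel_measurable lebesgue" "g2 x \<in> borel_measurable lebesgue"
    and g0: "\<And>y. 0 \<le> g1 x y" "\<And>y. 0 \<le> g2 x y"
    and p: "0 < p" "0 < p1" "0 < p2" "1 / p = 1 / p1 + 1 / p2" "0 < l1" "0 < l2"
    and c: "controls d1 p1 g1 H1" "controls d2 p2 g2 H2" and d: "0 < d1 x" "0 < d2 x" "0 < w"
    and v: "v = w / (d1 x * d2 x) powr p"
  shows "ennreal_power (sup_avg2 x (\<lambda>y1 y2. g1 x y1 * g2 x y2)) p * ennreal v
     \<le> ennreal ((l1 * l2) powr p) * (ennreal (1 / l1 powr p1) * H1 x + ennreal (1 / l2 powr p2) * H2 x) * ennreal w"
proof -
  let ?R = "ennreal ((l1 * l2) powr p) * (ennreal (1 / l1 powr p1) * H1 x + ennreal (1 / l2 powr p2) * H2 x)"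
  have v0: "0 < v" using v d by simp
  have one: "ennreal_power ((\<integral>\<^sup>+y\<in>Q. ennreal (g1 x y) \<partial>lebesgue) * (\<integral>\<^sup>+y\<in>Q. ennreal (g2 x y) \<partial>lebesgue) / (emeasure lebesgue Q)\<^sup>2) p
      \<le> ennreal ((d1 x * d2 x) powr p) * ?R" if Q: "is_cube Q" "x \<in> Q" for Q
  proof -
    obtain a l where al: "0 < l" "Q = cube a l" using Q(1) by (auto simp: is_cube_iff)
    obtain z1 where z1: "0 \<le> z1" "(\<integral>\<^sup>+y\<in>Q. ennreal (g1 x y) \<partial>lebesgue) \<le> ennreal (z1 * l ^ CARD('n))" "ennreal ((z1 / d1 x) powr p1) \<le> H1 x"
      using c(1) al Q(2) unfolding controls_def by blast
    obtain z2 where z2: "0 \<le> z2" "(\<integral>\<^sup>+y\<in>Q. ennreal (g2 x y) \<partial>lebesgue) \<le> ennreal (z2 * l ^ CARD('n))" "ennreal ((z2 / d2 x) powr p2) \<le> H2 x"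
      using c(2) al Q(2) unfolding controls_def by blast
    have L: "0 < l ^ CARD('n)" using al by simp
    have "(\<integral>\<^sup>+y\<in>Q. ennreal (g1 x y) \<partial>lebesgue) * (\<integral>\<^sup>+y\<in>Q. ennreal (g2 x y) \<partial>lebesgue) / (emeasure lebesgue Q)\<^sup>2
        \<le> ennreal (z1 * l ^ CARD('n)) * ennreal (z2 * l ^ CARD('n)) / (emeasure lebesgue Q)\<^sup>2"
      by (intro divide_right_mono_ennreal mult_mono z1 z2) auto
    also have "\<dots> = ennreal (z1 * l ^ CARD('n) * (z2 * l ^ CARD('n)) / (l ^ CARD('n))\<^sup>2)"
      using al z1 z2 L by (simp add: emeasure_cube ennreal_power divide_ennreal flip: ennreal_mult)
    also have "z1 * l ^ CARD('n) * (z2 * l ^ CARD('n)) / (l ^ CARD('n))\<^sup>2 = z1 * z2"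
      using L al by (simp add: power2_eq_square)
    finally have "ennreal_power ((\<integral>\<^sup>+y\<in>Q. ennreal (g1 x y) \<partial>lebesgue) * (\<integral>\<^sup>+y\<in>Q. ennreal (g2 x y) \<partial>lebesgue) / (emeasure lebesgue Q)\<^sup>2) p
        \<le> ennreal_power (ennreal (z1 * z2)) p" using p by (intro ennreal_power_mono)
    also have "\<dots> = ennreal ((z1 * z2) powr p)" using z1 z2 by simp
    also have "(z1 * z2) powr p = (d1 x * d2 x) powr p * (z1 / d1 x * (z2 / d2 x)) powr p"
      using z1 z2 d by (subst powr_mult[symmetric]) auto
    also have "ennreal \<dots> \<le> ennreal ((d1 x * d2 x) powr p * ((l1 * l2) powr p * ((z1 / d1 x) powr p1 / l1 powr p1 + (z2 / d2 x) powr p2 / l2 powr p2)))"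
      using p z1 z2 d by (intro ennreal_leI mult_left_mono scaled_young) auto
    also have "\<dots> = ennreal ((d1 x * d2 x) powr p) * (ennreal ((l1 * l2) powr p) *
        (ennreal (1 / l1 powr p1) * ennreal ((z1 / d1 x) powr p1) + ennreal (1 / l2 powr p2) * ennreal ((z2 / d2 x) powr p2)))"
      by (simp flip: ennreal_mult ennreal_plus)
    also have "\<dots> \<le> ennreal ((d1 x * d2 x) powr p) * ?R"
      by (intro mult_left_mono add_mono z1 z2) auto
    finally show ?thesis .
  qed
  have "ennreal_power (sup_avg2 x (\<lambda>y1 y2. g1 x y1 * g2 x y2)) p \<le> ennreal ((d1 x * d2 x) powr p) * ?R"
    unfolding sup_avg2_product[OF assms(1,2) g0] using one p by (intro ennreal_power_SUP_le) auto
  then have "ennreal_power (sup_avg2 x (\<lambda>y1 y2. g1 x y1 * g2 x y2)) p * ennreal v \<le> ennreal ((d1 x * d2 x) powr p) * ?R * ennreal v"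
    by (rule mult_right_mono) simp
  also have "\<dots> = ?R * (ennreal ((d1 x * d2 x) powr p) * ennreal v)" by (simp add: mult_ac)
  also have "ennreal ((d1 x * d2 x) powr p) * ennreal v = ennreal w"
    using v v0 d by (simp flip: ennreal_mult)
  finally show ?thesis .
qed

context a1_weight begin

lemma nn_integral_power_mu:
  assumes [measurable]: "f \<in> borel_measurable lebesgue"
  shows "(\<integral>\<^sup>+x. ennreal_power (ennreal \<bar>f x\<bar>) q * ennreal (w x) \<partial>lebesgue) = (\<integral>\<^sup>+x. ennreal (\<bar>f x\<bar> powr q) \<partial>\<mu>)"
  by (subst nn_integral_mu) (auto simp: mult.commute)

text \<open>Hoelder's inequality in the form of a family of scaled pointwise bounds.\<close>

lemma Lq_norm_le_of_majorants:
  fixes T :: "real ^ 'n \<Rightarrow> ennreal"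
  assumes [measurable]: "H1 \<in> borel_measurable lebesgue" "H2 \<in> borel_measurable lebesgue"
    and H: "(\<integral>\<^sup>+x. H1 x \<partial>\<mu>) \<le> ennreal c1" "(\<integral>\<^sup>+x. H2 x \<partial>\<mu>) \<le> ennreal c2"
    and c: "0 \<le> c1" "0 \<le> c2" "0 \<le> k" and p: "0 < p" "0 < p1" "0 < p2"
    and T: "\<And>l1 l2. 0 < l1 \<Longrightarrow> 0 < l2 \<Longrightarrow> AE x in lebesgue. ennreal_power (T x) p * ennreal (v x)
       \<le> ennreal k * (ennreal ((l1 * l2) powr p) * (ennreal (1 / l1 powr p1) * H1 x + ennreal (1 / l2 powr p2) * H2 x)) * ennreal (w x)"
  shows "Lq_norm p v T \<le> ennreal ((2 * k) powr (1 / p) * (c1 powr (1 / p1) * c2 powr (1 / p2)))"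
proof -
  have "(\<integral>\<^sup>+x. ennreal_power (T x) p * ennreal (v x) \<partial>lebesgue) \<le> ennreal (2 * k * (c1 powr (1 / p1) * c2 powr (1 / p2)) powr p)"
  proof (rule le_of_all_scalings[OF c p])
    fix l1 l2 :: real assume l: "0 < l1" "0 < l2"
    let ?h = "\<lambda>x. ennreal (1 / l1 powr p1) * H1 x + ennreal (1 / l2 powr p2) * H2 x"
    have "(\<integral>\<^sup>+x. ennreal_power (T x) p * ennreal (v x) \<partial>lebesgue)
        \<le> (\<integral>\<^sup>+x. ennreal (w x) * (ennreal k * (ennreal ((l1 * l2) powr p) * ?h x)) \<partial>lebesgue)"
      using T[OF l] by (intro nn_integral_mono_AE) (auto simp: mult_ac elim: eventually_mono)
    also have "\<dots> = (\<integral>\<^sup>+x. ennreal k * (ennreal ((l1 * l2) powr p) * ?h x) \<partial>\<mu>)"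
      by (rule nn_integral_mu[symmetric]) simp
    also have "\<dots> = ennreal k * (ennreal ((l1 * l2) powr p) *
        (ennreal (1 / l1 powr p1) * (\<integral>\<^sup>+x. H1 x \<partial>\<mu>) + ennreal (1 / l2 powr p2) * (\<integral>\<^sup>+x. H2 x \<partial>\<mu>)))"
      by (simp add: nn_integral_cmult nn_integral_add)
    also have "\<dots> \<le> ennreal k * (ennreal ((l1 * l2) powr p) *
        (ennreal (1 / l1 powr p1) * ennreal c1 + ennreal (1 / l2 powr p2) * ennreal c2))"
      by (intro mult_left_mono add_mono H) auto
    also have "\<dots> = ennreal (k * ((l1 * l2) powr p * (c1 / l1 powr p1 + c2 / l2 powr p2)))"
      using c by (simp flip: ennreal_mult ennreal_plus)
    finally show "(\<integral>\<^sup>+x. ennreal_power (T x) p * ennreal (v x) \<partial>lebesgue) \<le> \<dots>" .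
  qed
  then have "Lq_norm p v T \<le> ennreal_power (ennreal (2 * k * (c1 powr (1 / p1) * c2 powr (1 / p2)) powr p)) (1 / p)"
    unfolding Lq_norm_def using p by (intro ennreal_power_mono) auto
  also have "\<dots> = ennreal ((2 * k) powr (1 / p) * (c1 powr (1 / p1) * c2 powr (1 / p2)))"
    using c p by (simp add: powr_mult powr_powr)
  finally show ?thesis .
qed

lemma Lq_spaceD:
  assumes "f \<in> Lq_space q w" "0 < q"
  obtains N where "f \<in> borel_measurable lebesgue" "0 \<le> N" "(\<integral>\<^sup>+x. ennreal (\<bar>f x\<bar> powr q) \<partial>\<mu>) = ennreal N"
    "Lq_norm q w (\<lambda>x. ennreal \<bar>f x\<bar>) = ennreal (N powr (1 / q))"
proof -
  have f: "f \<in> borel_measurable lebesgue" and fin: "Lq_norm q w (\<lambda>x. ennreal \<bar>f x\<bar>) < \<infinity>"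
    using assms(1) by (auto simp: Lq_space_def)
  show thesis
  proof (cases "\<integral>\<^sup>+x. ennreal (\<bar>f x\<bar> powr q) \<partial>\<mu>")
    case (real N)
    then have "Lq_norm q w (\<lambda>x. ennreal \<bar>f x\<bar>) = ennreal (N powr (1 / q))"
      unfolding Lq_norm_def nn_integral_power_mu[OF f] by simp
    then show thesis using f real by (intro that)
  next
    case top
    then have "Lq_norm q w (\<lambda>x. ennreal \<bar>f x\<bar>) = \<infinity>"
      unfolding Lq_norm_def nn_integral_power_mu[OF f] by simp
    then show thesis using fin by simp
  qed
qed

end

section \<open>Oscillation bounds imply boundedness\<close>

context bmo_weight begin

definition Cmaj :: "real \<Rightarrow> real" where
  "Cmaj q = (4 ^ CARD('n)) powr q * (Ccomm q + C1 powr q * Cmax q)"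

lemma Cmaj_nonneg: "1 < q \<Longrightarrow> 0 \<le> Cmaj q"
  using Ccomm_nonneg Cmax_nonneg by (simp add: Cmaj_def)

text \<open>The sum of the majorants of the commutator and of the maximal function serves for both, so that the
same \<open>H\<close> can be used wherever \<open>f\<close> occurs.\<close>

lemma joint_majorant:
  assumes f: "f \<in> borel_measurable lebesgue" and q: "1 < q" and N: "0 \<le> N"
    "(\<integral>\<^sup>+x. ennreal (\<bar>f x\<bar> powr q) \<partial>\<mu>) = ennreal N"
  obtains H where "H \<in> borel_measurable lebesgue" "(\<integral>\<^sup>+x. H x \<partial>\<mu>) \<le> ennreal (Cmaj q * N)"
    "controls w q (\<lambda>x y. \<bar>b x - b y\<bar> * \<bar>f y\<bar>) H" "controls (\<lambda>_. 1) q (\<lambda>x y. \<bar>f y\<bar>) H"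
proof -
  have um: "(\<lambda>x. \<bar>f x\<bar>) \<in> borel_measurable lebesgue" using f by measurable
  have u0: "0 \<le> \<bar>f x\<bar>" for x by simp
  have fin: "(\<integral>\<^sup>+x. ennreal (\<bar>f x\<bar> powr q) \<partial>\<mu>) < \<infinity>" using N by simp
  let ?U = "\<integral>\<^sup>+x. ennreal (\<bar>f x\<bar> powr q) \<partial>\<mu>" and ?k = "ennreal ((4 ^ CARD('n)) powr q)"
  obtain H1 where H1: "H1 \<in> borel_measurable lebesgue" "(\<integral>\<^sup>+x. H1 x \<partial>\<mu>) \<le> ?k * (ennreal (Ccomm q) * ?U)"
    "controls w q (\<lambda>x y. \<bar>b x - b y\<bar> * \<bar>f y\<bar>) H1"
    by (rule commutator_majorant[OF um u0 q fin])
  obtain H2 where H2: "H2 \<in> borel_measurable lebesgue" "(\<integral>\<^sup>+x. H2 x \<partial>\<mu>) \<le> ?k * (ennreal (C1 powr q * Cmax q) * ?U)"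
    "controls (\<lambda>_. 1) q (\<lambda>x y. \<bar>f y\<bar>) H2"
    by (rule maximal_majorant[OF um u0 q fin])
  note H1(1) [measurable] H2(1) [measurable]
  show thesis
  proof (rule that[of "\<lambda>x. H1 x + H2 x"])
    have "(\<integral>\<^sup>+x. H1 x + H2 x \<partial>\<mu>) = (\<integral>\<^sup>+x. H1 x \<partial>\<mu>) + (\<integral>\<^sup>+x. H2 x \<partial>\<mu>)"
      by (rule nn_integral_add) auto
    also have "\<dots> \<le> ?k * (ennreal (Ccomm q) * ?U) + ?k * (ennreal (C1 powr q * Cmax q) * ?U)"
      by (intro add_mono H1 H2)
    also have "\<dots> = ?k * (ennreal (Ccomm q) + ennreal (C1 powr q * Cmax q)) * ennreal N"
      unfolding N(2) by (simp add: distrib_left distrib_right mult.assoc)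
    also have "\<dots> = ennreal (Cmaj q * N)"
    proof -
      have "0 \<le> Ccomm q" "0 \<le> C1 powr q * Cmax q" using Ccomm_nonneg[OF q] Cmax_nonneg[OF q] by auto
      then show ?thesis using N(1) unfolding Cmaj_def by (simp flip: ennreal_mult ennreal_plus)
    qed
    finally show "(\<integral>\<^sup>+x. H1 x + H2 x \<partial>\<mu>) \<le> ennreal (Cmaj q * N)" .
    show "controls w q (\<lambda>x y. \<bar>b x - b y\<bar> * \<bar>f y\<bar>) (\<lambda>x. H1 x + H2 x)" by (rule controls_mono[OF H1(3)]) simp
    show "controls (\<lambda>_. 1) q (\<lambda>x y. \<bar>f y\<bar>) (\<lambda>x. H1 x + H2 x)" by (rule controls_mono[OF H2(3)]) simp
  qed measurable
qed

text \<open>Reduces boundedness to a pointwise bound in terms of the majorants of the two functions.\<close>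

lemma bounded_pair_opI:
  fixes T :: "(real ^ 'n \<Rightarrow> real) \<Rightarrow> (real ^ 'n \<Rightarrow> real) \<Rightarrow> real ^ 'n \<Rightarrow> ennreal"
  assumes p: "1 < p1" "1 < p2" "0 < p" and k: "0 \<le> k"
    and T: "\<And>f1 f2 H1 H2 l1 l2. f1 \<in> borel_measurable lebesgue \<Longrightarrow> f2 \<in> borel_measurable lebesgue \<Longrightarrow>
       controls w p1 (\<lambda>x y. \<bar>b x - b y\<bar> * \<bar>f1 y\<bar>) H1 \<Longrightarrow> controls (\<lambda>_. 1) p1 (\<lambda>x y. \<bar>f1 y\<bar>) H1 \<Longrightarrow>
       controls w p2 (\<lambda>x y. \<bar>b x - b y\<bar> * \<bar>f2 y\<bar>) H2 \<Longrightarrow> controls (\<lambda>_. 1) p2 (\<lambda>x y. \<bar>f2 y\<bar>) H2 \<Longrightarrow>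
       0 < l1 \<Longrightarrow> 0 < l2 \<Longrightarrow> AE x in lebesgue. ennreal_power (T f1 f2 x) p * ennreal (v x)
       \<le> ennreal k * (ennreal ((l1 * l2) powr p) * (ennreal (1 / l1 powr p1) * H1 x + ennreal (1 / l2 powr p2) * H2 x)) * ennreal (w x)"
  shows "bounded_pair_op T p1 p2 w p v"
proof -
  let ?C = "(2 * k) powr (1 / p) * (Cmaj p1 powr (1 / p1) * Cmaj p2 powr (1 / p2))"
  have "Lq_norm p v (T f1 f2) \<le> ennreal ?C * Lq_norm p1 w (\<lambda>x. ennreal \<bar>f1 x\<bar>) * Lq_norm p2 w (\<lambda>x. ennreal \<bar>f2 x\<bar>)"
    if f: "f1 \<in> Lq_space p1 w" "f2 \<in> Lq_space p2 w" for f1 f2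
  proof -
    have p0: "0 < p1" "0 < p2" using p by auto
    obtain N1 where N1: "f1 \<in> borel_measurable lebesgue" "0 \<le> N1" "(\<integral>\<^sup>+x. ennreal (\<bar>f1 x\<bar> powr p1) \<partial>\<mu>) = ennreal N1"
      "Lq_norm p1 w (\<lambda>x. ennreal \<bar>f1 x\<bar>) = ennreal (N1 powr (1 / p1))" by (rule Lq_spaceD[OF f(1) p0(1)])
    obtain N2 where N2: "f2 \<in> borel_measurable lebesgue" "0 \<le> N2" "(\<integral>\<^sup>+x. ennreal (\<bar>f2 x\<bar> powr p2) \<partial>\<mu>) = ennreal N2"
      "Lq_norm p2 w (\<lambda>x. ennreal \<bar>f2 x\<bar>) = ennreal (N2 powr (1 / p2))" by (rule Lq_spaceD[OF f(2) p0(2)])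
    obtain H1 where H1: "H1 \<in> borel_measurable lebesgue" "(\<integral>\<^sup>+x. H1 x \<partial>\<mu>) \<le> ennreal (Cmaj p1 * N1)"
      "controls w p1 (\<lambda>x y. \<bar>b x - b y\<bar> * \<bar>f1 y\<bar>) H1" "controls (\<lambda>_. 1) p1 (\<lambda>x y. \<bar>f1 y\<bar>) H1"
      by (rule joint_majorant[OF N1(1) p(1) N1(2,3)])
    obtain H2 where H2: "H2 \<in> borel_measurable lebesgue" "(\<integral>\<^sup>+x. H2 x \<partial>\<mu>) \<le> ennreal (Cmaj p2 * N2)"
      "controls w p2 (\<lambda>x y. \<bar>b x - b y\<bar> * \<bar>f2 y\<bar>) H2" "controls (\<lambda>_. 1) p2 (\<lambda>x y. \<bar>f2 y\<bar>) H2"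
      by (rule joint_majorant[OF N2(1) p(2) N2(2,3)])
    have c: "0 \<le> Cmaj p1 * N1" "0 \<le> Cmaj p2 * N2" using Cmaj_nonneg p N1(2) N2(2) by auto
    have "Lq_norm p v (T f1 f2) \<le> ennreal ((2 * k) powr (1 / p) * ((Cmaj p1 * N1) powr (1 / p1) * (Cmaj p2 * N2) powr (1 / p2)))"
      by (rule Lq_norm_le_of_majorants[OF H1(1) H2(1) H1(2) H2(2) c k p(3) p0 T[OF N1(1) N2(1) H1(3,4) H2(3,4)]])
    also have "\<dots> = ennreal (?C * N1 powr (1 / p1) * N2 powr (1 / p2))"
      using Cmaj_nonneg[OF p(1)] Cmaj_nonneg[OF p(2)] N1(2) N2(2) by (simp add: powr_mult mult_ac)
    also have "\<dots> = ennreal ?C * Lq_norm p1 w (\<lambda>x. ennreal \<bar>f1 x\<bar>) * Lq_norm p2 w (\<lambda>x. ennreal \<bar>f2 x\<bar>)"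
      unfolding N1(4) N2(4) by (simp flip: ennreal_mult)
    finally show ?thesis .
  qed
  then show ?thesis unfolding bounded_pair_op_def by blast
qed

theorem bounded_M_Sigma:
  assumes p: "1 < p1" "1 < p2" "0 < p" "1 / p = 1 / p1 + 1 / p2"
  shows "bounded_pair_op (M_Sigma b) p1 p2 w p (\<lambda>x. w x powr (1 - p))"
proof (rule bounded_pair_opI[OF p(1-3), of "2 * 2 powr p"])
  fix f1 f2 :: "real ^ 'n \<Rightarrow> real" and H1 H2 and l1 l2 :: real
  assume [measurable]: "f1 \<in> borel_measurable lebesgue" "f2 \<in> borel_measurable lebesgue"
    and c: "controls w p1 (\<lambda>x y. \<bar>b x - b y\<bar> * \<bar>f1 y\<bar>) H1" "controls (\<lambda>_. 1) p1 (\<lambda>x y. \<bar>f1 y\<bar>) H1"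
      "controls w p2 (\<lambda>x y. \<bar>b x - b y\<bar> * \<bar>f2 y\<bar>) H2" "controls (\<lambda>_. 1) p2 (\<lambda>x y. \<bar>f2 y\<bar>) H2"
    and l: "0 < l1" "0 < l2"
  show "AE x in lebesgue. ennreal_power (M_Sigma b f1 f2 x) p * ennreal (w x powr (1 - p))
       \<le> ennreal (2 * 2 powr p) * (ennreal ((l1 * l2) powr p) * (ennreal (1 / l1 powr p1) * H1 x + ennreal (1 / l2 powr p2) * H2 x)) * ennreal (w x)"
    using w_pos
  proof eventually_elim
    case (elim x)
    let ?R = "ennreal ((l1 * l2) powr p) * (ennreal (1 / l1 powr p1) * H1 x + ennreal (1 / l2 powr p2) * H2 x)"
    let ?v = "w x powr (1 - p)"
    have v: "?v = w x / (w x * 1) powr p" "?v = w x / (1 * w x) powr p" using elim by (simp_all add: powr_diff)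
    have p0: "0 < p1" "0 < p2" using p by auto
    have "ennreal_power (sup_avg2 x (\<lambda>y1 y2. (\<bar>b x - b y1\<bar> * \<bar>f1 y1\<bar>) * \<bar>f2 y2\<bar>)) p * ennreal ?v \<le> ?R * ennreal (w x)"
      by (rule sup_avg2_power_le[where ?g1.0 = "\<lambda>x y. \<bar>b x - b y\<bar> * \<bar>f1 y\<bar>" and ?g2.0 = "\<lambda>x y. \<bar>f2 y\<bar>", OF _ _ _ _ p(3) p0 p(4) l c(1,4) _ _ elim v(1)])
        (use elim in auto)
    then have 1: "ennreal_power (M_lin1 b f1 f2 x) p * ennreal ?v \<le> ?R * ennreal (w x)"
      by (simp add: M_lin1_def mult.assoc)
    have "ennreal_power (sup_avg2 x (\<lambda>y1 y2. \<bar>f1 y1\<bar> * (\<bar>b x - b y2\<bar> * \<bar>f2 y2\<bar>))) p * ennreal ?v \<le> ?R * ennreal (w x)"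
      by (rule sup_avg2_power_le[where ?g1.0 = "\<lambda>x y. \<bar>f1 y\<bar>" and ?g2.0 = "\<lambda>x y. \<bar>b x - b y\<bar> * \<bar>f2 y\<bar>", OF _ _ _ _ p(3) p0 p(4) l c(2,3) _ _ elim v(2)])
        (use elim in auto)
    moreover have "M_lin2 b f1 f2 x = sup_avg2 x (\<lambda>y1 y2. \<bar>f1 y1\<bar> * (\<bar>b x - b y2\<bar> * \<bar>f2 y2\<bar>))"
      unfolding M_lin2_def by (intro arg_cong[where f = "sup_avg2 x"] ext) (simp add: mult_ac)
    ultimately have 2: "ennreal_power (M_lin2 b f1 f2 x) p * ennreal ?v \<le> ?R * ennreal (w x)" by simp
    have "ennreal_power (M_Sigma b f1 f2 x) p * ennreal ?v
        \<le> ennreal (2 powr p) * (ennreal_power (M_lin1 b f1 f2 x) p + ennreal_power (M_lin2 b f1 f2 x) p) * ennreal ?v"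
      unfolding M_Sigma_def by (intro mult_right_mono ennreal_power_add_le p) simp
    also have "\<dots> = ennreal (2 powr p) * (ennreal_power (M_lin1 b f1 f2 x) p * ennreal ?v + ennreal_power (M_lin2 b f1 f2 x) p * ennreal ?v)"
      by (simp add: distrib_right mult.assoc)
    also have "\<dots> \<le> ennreal (2 powr p) * (?R * ennreal (w x) + ?R * ennreal (w x))"
      by (intro mult_left_mono add_mono 1 2) simp
    also have "\<dots> = ennreal (2 powr p) * 2 * (?R * ennreal (w x))"
      by (simp only: mult_2[symmetric] mult.assoc)
    also have "ennreal (2 powr p) * 2 = ennreal (2 * 2 powr p)" by (simp add: ennreal_mult mult.commute)
    finally show ?case by (simp only: mult.assoc)
  qed
qed simp

theorem bounded_M_Pi:
  assumes p: "1 < p1" "1 < p2" "0 < p" "1 / p = 1 / p1 + 1 / p2"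
  shows "bounded_pair_op (M_Pi b) p1 p2 w p (\<lambda>x. w x powr (1 - 2 * p))"
proof (rule bounded_pair_opI[OF p(1-3), of 1])
  fix f1 f2 :: "real ^ 'n \<Rightarrow> real" and H1 H2 and l1 l2 :: real
  assume [measurable]: "f1 \<in> borel_measurable lebesgue" "f2 \<in> borel_measurable lebesgue"
    and c: "controls w p1 (\<lambda>x y. \<bar>b x - b y\<bar> * \<bar>f1 y\<bar>) H1" "controls w p2 (\<lambda>x y. \<bar>b x - b y\<bar> * \<bar>f2 y\<bar>) H2"
    and l: "0 < l1" "0 < l2"
  show "AE x in lebesgue. ennreal_power (M_Pi b f1 f2 x) p * ennreal (w x powr (1 - 2 * p))
       \<le> ennreal 1 * (ennreal ((l1 * l2) powr p) * (ennreal (1 / l1 powr p1) * H1 x + ennreal (1 / l2 powr p2) * H2 x)) * ennreal (w x)"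
    using w_pos
  proof eventually_elim
    case (elim x)
    have v: "w x powr (1 - 2 * p) = w x / (w x * w x) powr p"
      using elim by (simp add: powr_diff powr_mult flip: powr_add)
    have p0: "0 < p1" "0 < p2" using p by auto
    have "ennreal_power (sup_avg2 x (\<lambda>y1 y2. (\<bar>b x - b y1\<bar> * \<bar>f1 y1\<bar>) * (\<bar>b x - b y2\<bar> * \<bar>f2 y2\<bar>))) p * ennreal (w x powr (1 - 2 * p))
        \<le> ennreal ((l1 * l2) powr p) * (ennreal (1 / l1 powr p1) * H1 x + ennreal (1 / l2 powr p2) * H2 x) * ennreal (w x)"
      by (rule sup_avg2_power_le[where ?g1.0 = "\<lambda>x y. \<bar>b x - b y\<bar> * \<bar>f1 y\<bar>" and ?g2.0 = "\<lambda>x y. \<bar>b x - b y\<bar> * \<bar>f2 y\<bar>", OF _ _ _ _ p(3) p0 p(4) l c _ _ elim v])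
        (use elim in auto)
    then show ?case by (simp add: M_Pi_def)
  qed
qed simp

end

section \<open>Boundedness implies oscillation bounds\<close>

text \<open>The mean of \<open>\<bar>t - b\<bar>\<close> over the cube. As a function of the real number \<open>t\<close> it is Lipschitz, which makes
\<open>osc_from b a l (b x)\<close> measurable in \<open>x\<close>.\<close>

definition osc_from :: "(real ^ 'n \<Rightarrow> real) \<Rightarrow> real ^ 'n \<Rightarrow> real \<Rightarrow> real \<Rightarrow> real" where
  "osc_from b a l t = enn2real (\<integral>\<^sup>+y\<in>cube a l. ennreal \<bar>t - b y\<bar> \<partial>lebesgue) / l ^ CARD('n)"

lemma osc_from_nonneg: "0 \<le> l \<Longrightarrow> 0 \<le> osc_from b a l t"
  by (simp add: osc_from_def)

lemma osc_from_eq: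
  fixes b :: "real ^ 'n \<Rightarrow> real"
  assumes "0 < l" and [measurable]: "b \<in> borel_measurable lebesgue" and b: "set_integrable lebesgue (cube a l) b"
  shows "(\<integral>\<^sup>+y\<in>cube a l. ennreal \<bar>t - b y\<bar> \<partial>lebesgue) = ennreal (osc_from b a l t * l ^ CARD('n))"
proof -
  have "set_integrable lebesgue (cube a l) (\<lambda>y. t - b y)"
    by (intro set_integral_diff set_integrable_const_cube b)
  then have "(\<integral>\<^sup>+y\<in>cube a l. ennreal \<bar>t - b y\<bar> \<partial>lebesgue) < \<infinity>"
    by (subst (asm) set_integrable_cube_iff) auto
  then show ?thesis using assms(1) by (simp add: osc_from_def less_top)
qed

lemma osc_from_le:
  fixes b :: "real ^ 'n \<Rightarrow> real"
  assumes l: "0 < l" and [measurable]: "b \<in> borel_measurable lebesgue" and b: "set_integrable lebesgue (cube a l) b"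
  shows "osc_from b a l t \<le> \<bar>t - s\<bar> + osc_from b a l s"
proof -
  have "ennreal (osc_from b a l t * l ^ CARD('n)) \<le> (\<integral>\<^sup>+y. ennreal \<bar>t - s\<bar> * indicator (cube a l) y + ennreal \<bar>s - b y\<bar> * indicator (cube a l) y \<partial>lebesgue)"
    unfolding osc_from_eq[OF l assms(2) b, symmetric]
    by (intro nn_integral_mono) (auto simp: indicator_def simp flip: ennreal_plus intro!: ennreal_leI)
  also have "\<dots> = ennreal \<bar>t - s\<bar> * emeasure lebesgue (cube a l) + (\<integral>\<^sup>+y\<in>cube a l. ennreal \<bar>s - b y\<bar> \<partial>lebesgue)"
    by (subst nn_integral_add) (auto simp: nn_integral_cmult)
  also have "\<dots> = ennreal (\<bar>t - s\<bar> * l ^ CARD('n) + osc_from b a l s * l ^ CARD('n))"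
    using l osc_from_nonneg[of l b a s] by (simp add: osc_from_eq[OF l assms(2) b] emeasure_cube flip: ennreal_mult ennreal_plus)
  finally have "osc_from b a l t * l ^ CARD('n) \<le> (\<bar>t - s\<bar> + osc_from b a l s) * l ^ CARD('n)"
    using l osc_from_nonneg[of l b a s] by (subst (asm) ennreal_le_iff) (auto simp: distrib_right)
  then show ?thesis using l by simp
qed

lemma osc_from_measurable [measurable]:
  fixes b :: "real ^ 'n \<Rightarrow> real"
  assumes l: "0 < l" and b: "b \<in> borel_measurable lebesgue" "set_integrable lebesgue (cube a l) b"
  shows "(\<lambda>x. osc_from b a l (b x)) \<in> borel_measurable lebesgue"
proof -
  have "continuous_on UNIV (osc_from b a l)"
    unfolding continuous_on_iff
  proof (intro ballI allI impI)
    fix s e :: real assume "0 < e"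
    moreover have "\<bar>osc_from b a l t - osc_from b a l s\<bar> \<le> \<bar>t - s\<bar>" for t
      using osc_from_le[OF l b, of t s] osc_from_le[OF l b, of s t] by linarith
    ultimately show "\<exists>d>0. \<forall>t\<in>UNIV. dist t s < d \<longrightarrow> dist (osc_from b a l t) (osc_from b a l s) < e"
      unfolding dist_real_def by (meson order.strict_trans1)
  qed
  then have "osc_from b a l \<in> borel_measurable borel" by (rule borel_measurable_continuous_onI)
  then show ?thesis using b(1) by measurable
qed

context a1_weight begin

text \<open>A single well-chosen point controls the mean oscillation. Write \<open>V = \<mu>(Q)/|Q|\<close>. The function
\<open>D\<^sup>s w powr (1 - s) + w\<close> has mean at most \<open>(C + 1) V\<close>, so it is at most \<open>(C + 2) V\<close> at some point
where also \<open>V \<le> C\<^sub>1 w\<close>. There \<open>D\<^sup>s\<close> is at most \<open>(C + 2) V w powr (s - 1)\<close>. For \<open>s \<ge> 1\<close> the upper bound of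
\<open>w\<close> is used, for \<open>s < 1\<close> the lower one, and in both cases \<open>D\<close> is at most a constant times \<open>V\<close>.\<close>

lemma osc_bound_from_power_integral:
  fixes b :: "real ^ 'n \<Rightarrow> real"
  assumes [measurable]: "b \<in> borel_measurable lebesgue" and b: "\<And>a l. set_integrable lebesgue (cube a l) b"
    and s: "0 < s" and C: "0 \<le> C"
    and hyp: "\<And>a l. 0 < l \<Longrightarrow> (\<integral>\<^sup>+x\<in>cube a l. ennreal (osc_from b a l (b x) powr s * w x powr (1 - s)) \<partial>lebesgue) \<le> ennreal (C * W a l)"
  shows "\<exists>B>0. \<forall>a l. 0 < l \<longrightarrow> (\<integral>\<^sup>+x\<in>cube a l. ennreal \<bar>b x - average b (cube a l)\<bar> \<partial>lebesgue) \<le> ennreal (B * W a l)"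
proof -
  define M where "M = max (C + 2) (((C + 2) * C1 powr (1 - s)) powr (1 / s))"
  have M: "0 < M" using C by (simp add: M_def)
  have "(\<integral>\<^sup>+x\<in>cube a l. ennreal \<bar>b x - average b (cube a l)\<bar> \<partial>lebesgue) \<le> ennreal (2 * M * W a l)" if l: "0 < l" for a l
  proof -
    define V where "V = W a l / l ^ CARD('n)"
    let ?D = "\<lambda>x. osc_from b a l (b x)"
    let ?h = "\<lambda>x. ?D x powr s * w x powr (1 - s)"
    have [measurable]: "?D \<in> borel_measurable lebesgue" by (rule osc_from_measurable[OF l assms(1) b])
    have V: "0 < V" using W_pos[OF l] l by (simp add: V_def)
    have VL: "V * l ^ CARD('n) = W a l" using l by (simp add: V_def)
    have "\<exists>x\<in>cube a l. 0 < w x \<and> V \<le> C1 * w x \<and> ?h x + w x \<le> (C + 2) * V"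
    proof (rule ccontr)
      assume no: "\<not> ?thesis"
      have big: "AE x in lebesgue. ennreal ((C + 2) * V) * indicator (cube a l) x
          \<le> ennreal (?h x) * indicator (cube a l) x + ennreal (w x) * indicator (cube a l) x"
        using w_pos W_le[OF l, of a]
      proof eventually_elim
        case (elim x)
        show ?case
        proof (cases "x \<in> cube a l")
          case True
          then have "(C + 2) * V \<le> ?h x + w x" using no elim by (force simp: V_def)
          then have "ennreal ((C + 2) * V) \<le> ennreal (?h x + w x)" by (rule ennreal_leI)
          then show ?thesis using True w_nonneg[of x] by simp
        qed simp
      qed
      have "ennreal ((C + 2) * V) * ennreal (l ^ CARD('n)) = (\<integral>\<^sup>+x\<in>cube a l. ennreal ((C + 2) * V) \<partial>lebesgue)"
        using l by (simp add: nn_integral_cmult emeasure_cube)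
      also have "\<dots> \<le> (\<integral>\<^sup>+x. ennreal (?h x) * indicator (cube a l) x + ennreal (w x) * indicator (cube a l) x \<partial>lebesgue)"
        by (rule nn_integral_mono_AE[OF big])
      also have "\<dots> = (\<integral>\<^sup>+x\<in>cube a l. ennreal (?h x) \<partial>lebesgue) + (\<integral>\<^sup>+x\<in>cube a l. ennreal (w x) \<partial>lebesgue)"
        by (rule nn_integral_add) auto
      also have "\<dots> \<le> ennreal (C * W a l) + ennreal (W a l)"
        using emeasure_mu_cube[of a l] by (intro add_mono hyp l) (simp add: emeasure_mu)
      finally have "(C + 2) * V * l ^ CARD('n) \<le> C * W a l + W a l"
        using C V l W_nonneg[of a l] by (simp add: ennreal_le_iff flip: ennreal_mult ennreal_plus)
      then have "(C + 2) * W a l \<le> C * W a l + W a l" by (simp add: mult.assoc VL)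
      then show False using W_pos[OF l, of a] by (simp add: distrib_right)
    qed
    then obtain x where x: "x \<in> cube a l" "0 < w x" "V \<le> C1 * w x" "?h x + w x \<le> (C + 2) * V" by blast
    have D0: "0 \<le> ?D x" using l by (intro osc_from_nonneg) auto
    have wx: "w x \<le> (C + 2) * V"
    proof -
      have "0 \<le> ?h x" by simp
      then show ?thesis using x(4) by linarith
    qed
    have "?h x \<le> (C + 2) * V" using x by linarith
    then have "?h x * w x powr (s - 1) \<le> (C + 2) * V * w x powr (s - 1)" by (intro mult_right_mono) auto
    moreover have "w x powr (1 - s) * w x powr (s - 1) = 1" using x(2) by (simp flip: powr_add)
    ultimately have Ds: "?D x powr s \<le> (C + 2) * V * w x powr (s - 1)" by (simp add: mult.assoc)
    have "?D x \<le> M * V"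
    proof (cases "1 \<le> s")
      case True
      have "w x powr (s - 1) \<le> ((C + 2) * V) powr (s - 1)" using wx x(2) True by (intro powr_mono2) auto
      then have "(C + 2) * V * w x powr (s - 1) \<le> (C + 2) * V * ((C + 2) * V) powr (s - 1)"
        using C V by (intro mult_left_mono) auto
      also have "\<dots> = ((C + 2) * V) powr s" using C V by (simp add: powr_diff)
      finally have "?D x powr s \<le> ((C + 2) * V) powr s" using Ds by linarith
      then have "(?D x powr s) powr (1 / s) \<le> (((C + 2) * V) powr s) powr (1 / s)"
        by (rule powr_mono2[rotated 2]) (use s in auto)
      then have "?D x \<le> (C + 2) * V" using D0 C V s by (simp add: powr_powr)
      also have "\<dots> \<le> M * V" using V by (intro mult_right_mono) (auto simp: M_def)
      finally show ?thesis .
    next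
      case False
      have "V / C1 \<le> w x" using x(3) C1_ge_1 by (simp add: field_simps)
      then have "w x powr (s - 1) \<le> (V / C1) powr (s - 1)" using False V C1_ge_1 by (intro powr_mono2') auto
      also have "\<dots> = V powr (s - 1) * C1 powr (1 - s)"
        using V C1_ge_1 powr_minus[of C1 "s - 1"] by (subst powr_divide) (auto simp: divide_inverse)
      finally have "(C + 2) * V * w x powr (s - 1) \<le> (C + 2) * V * (V powr (s - 1) * C1 powr (1 - s))"
        using C V by (intro mult_left_mono) auto
      also have "\<dots> = ((C + 2) * C1 powr (1 - s)) * V powr s" using V by (simp add: powr_diff)
      finally have "?D x powr s \<le> ((C + 2) * C1 powr (1 - s)) * V powr s" using Ds by linarith
      then have "(?D x powr s) powr (1 / s) \<le> (((C + 2) * C1 powr (1 - s)) * V powr s) powr (1 / s)"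
        by (rule powr_mono2[rotated 2]) (use s in auto)
      also have "\<dots> = ((C + 2) * C1 powr (1 - s)) powr (1 / s) * V"
        using C V s by (subst powr_mult) (auto simp: powr_powr)
      also have "\<dots> \<le> M * V" using V by (intro mult_right_mono) (auto simp: M_def)
      finally show ?thesis using D0 s by (simp add: powr_powr)
    qed
    then have DW: "?D x * l ^ CARD('n) \<le> M * W a l"
      using l mult_right_mono[of "?D x" "M * V" "l ^ CARD('n)"] by (simp add: mult.assoc VL)
    let ?m = "average b (cube a l)"
    have eqD: "(\<integral>\<^sup>+y\<in>cube a l. ennreal \<bar>b y - b x\<bar> \<partial>lebesgue) = ennreal (?D x * l ^ CARD('n))"
      using osc_from_eq[OF l assms(1) b, where a = a and t = "b x"] by (simp add: abs_minus_commute)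
    have "(\<integral>\<^sup>+y\<in>cube a l. ennreal \<bar>b y - ?m\<bar> \<partial>lebesgue)
        \<le> (\<integral>\<^sup>+y. ennreal \<bar>b y - b x\<bar> * indicator (cube a l) y + ennreal \<bar>?m - b x\<bar> * indicator (cube a l) y \<partial>lebesgue)"
      by (intro nn_integral_mono) (auto simp: indicator_def simp flip: ennreal_plus intro!: ennreal_leI)
    also have "\<dots> = (\<integral>\<^sup>+y\<in>cube a l. ennreal \<bar>b y - b x\<bar> \<partial>lebesgue) + ennreal \<bar>?m - b x\<bar> * emeasure lebesgue (cube a l)"
      by (subst nn_integral_add) (auto simp: nn_integral_cmult)
    also have "\<dots> \<le> ennreal (?D x * l ^ CARD('n)) + ennreal (?D x * l ^ CARD('n))"
      using average_diff_le[OF l b, where a = a and c = "b x"] l by (intro add_mono) (auto simp: eqD emeasure_cube)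
    also have "\<dots> = ennreal (2 * (?D x * l ^ CARD('n)))" using D0 l by (simp flip: ennreal_plus)
    also have "\<dots> \<le> ennreal (2 * M * W a l)" using DW by (intro ennreal_leI) simp
    finally show ?thesis .
  qed
  then show ?thesis using M by (intro exI[of _ "2 * M"]) auto
qed

lemma Lq_norm_indicator_cube:
  assumes q: "0 < q"
  shows "indicat_real (cube a l) \<in> Lq_space q w"
    "Lq_norm q w (\<lambda>x. ennreal \<bar>indicat_real (cube a l) x\<bar>) = ennreal (W a l powr (1 / q))"
proof -
  have m: "indicat_real (cube a l) \<in> borel_measurable lebesgue" by simp
  have "(\<integral>\<^sup>+x. ennreal (\<bar>indicat_real (cube a l) x\<bar> powr q) \<partial>\<mu>) = (\<integral>\<^sup>+x. indicator (cube a l) x \<partial>\<mu>)"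
    by (intro nn_integral_cong) (auto simp: indicator_def)
  then have "(\<integral>\<^sup>+x. ennreal (\<bar>indicat_real (cube a l) x\<bar> powr q) \<partial>\<mu>) = ennreal (W a l)"
    by (simp add: emeasure_mu_cube)
  then show *: "Lq_norm q w (\<lambda>x. ennreal \<bar>indicat_real (cube a l) x\<bar>) = ennreal (W a l powr (1 / q))"
    unfolding Lq_norm_def nn_integral_power_mu[OF m] by (simp add: W_nonneg)
  show "indicat_real (cube a l) \<in> Lq_space q w" unfolding Lq_space_def using * m by simp
qed

text \<open>Testing on indicators of cubes; \<open>k\<close> is the number of commutator factors, 1 or 2.\<close>

lemma osc_bound_from_bounded_op:
  fixes b :: "real ^ 'n \<Rightarrow> real" and T :: "(real ^ 'n \<Rightarrow> real) \<Rightarrow> (real ^ 'n \<Rightarrow> real) \<Rightarrow> real ^ 'n \<Rightarrow> ennreal"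
  assumes bm: "b \<in> borel_measurable lebesgue" and b: "\<And>a l. set_integrable lebesgue (cube a l) b"
    and p: "1 < p1" "1 < p2" "0 < p" "1 / p = 1 / p1 + 1 / p2" and k: "0 < k"
    and T: "\<And>a l x. 0 < l \<Longrightarrow> x \<in> cube a l \<Longrightarrow>
       ennreal (osc_from b a l (b x) powr k) \<le> T (indicat_real (cube a l)) (indicat_real (cube a l)) x"
    and bdd: "bounded_pair_op T p1 p2 w p (\<lambda>x. w x powr (1 - k * p))"
  shows "\<exists>B>0. \<forall>a l. 0 < l \<longrightarrow> (\<integral>\<^sup>+x\<in>cube a l. ennreal \<bar>b x - average b (cube a l)\<bar> \<partial>lebesgue) \<le> ennreal (B * W a l)"
proof -
  obtain C where C: "\<And>f1 f2. f1 \<in> Lq_space p1 w \<Longrightarrow> f2 \<in> Lq_space p2 w \<Longrightarrow> Lq_norm p (\<lambda>x. w x powr (1 - k * p)) (T f1 f2)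
      \<le> ennreal C * Lq_norm p1 w (\<lambda>x. ennreal \<bar>f1 x\<bar>) * Lq_norm p2 w (\<lambda>x. ennreal \<bar>f2 x\<bar>)"
    using bdd unfolding bounded_pair_op_def by blast
  let ?C = "max 0 C"
  show ?thesis
  proof (rule osc_bound_from_power_integral[OF bm b, of "k * p" "?C powr p"])
    fix a :: "real ^ 'n" and l :: real assume l: "0 < l"
    let ?I = "indicat_real (cube a l)" and ?v = "\<lambda>x. w x powr (1 - k * p)"
    have "Lq_norm p ?v (T ?I ?I) \<le> ennreal C * ennreal (W a l powr (1 / p1)) * ennreal (W a l powr (1 / p2))"
      using C[of ?I ?I] Lq_norm_indicator_cube[of p1 a l] Lq_norm_indicator_cube[of p2 a l] p by simp
    also have "ennreal C = ennreal ?C" by (simp add: max_def ennreal_neg)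
    also have "ennreal ?C * ennreal (W a l powr (1 / p1)) * ennreal (W a l powr (1 / p2)) = ennreal (?C * W a l powr (1 / p))"
      unfolding p(4) by (simp add: powr_add mult.assoc flip: ennreal_mult)
    finally have "ennreal_power (Lq_norm p ?v (T ?I ?I)) p \<le> ennreal_power (ennreal (?C * W a l powr (1 / p))) p"
      using p by (intro ennreal_power_mono)
    also have "\<dots> = ennreal (?C powr p * W a l)" using p(3) W_nonneg[of a l] by (simp add: powr_mult powr_powr)
    finally have "(\<integral>\<^sup>+x. ennreal_power (T ?I ?I x) p * ennreal (?v x) \<partial>lebesgue) \<le> ennreal (?C powr p * W a l)"
      using p(3) unfolding Lq_norm_def by (simp add: ennreal_power_inverse)
    moreover have "(\<integral>\<^sup>+x\<in>cube a l. ennreal (osc_from b a l (b x) powr (k * p) * ?v x) \<partial>lebesgue)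
        \<le> (\<integral>\<^sup>+x. ennreal_power (T ?I ?I x) p * ennreal (?v x) \<partial>lebesgue)"
    proof (intro nn_integral_mono)
      fix x
      show "ennreal (osc_from b a l (b x) powr (k * p) * ?v x) * indicator (cube a l) x \<le> ennreal_power (T ?I ?I x) p * ennreal (?v x)"
      proof (cases "x \<in> cube a l")
        case True
        have "ennreal (osc_from b a l (b x) powr (k * p)) = ennreal_power (ennreal (osc_from b a l (b x) powr k)) p"
          by (simp add: powr_powr)
        also have "\<dots> \<le> ennreal_power (T ?I ?I x) p" using T[OF l True] p by (intro ennreal_power_mono)
        finally have "ennreal (osc_from b a l (b x) powr (k * p)) * ennreal (?v x) \<le> ennreal_power (T ?I ?I x) p * ennreal (?v x)"
          by (rule mult_right_mono) simp
        then show ?thesis using True by (simp add: ennreal_mult)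
      qed simp
    qed
    ultimately show "(\<integral>\<^sup>+x\<in>cube a l. ennreal (osc_from b a l (b x) powr (k * p) * w x powr (1 - k * p)) \<partial>lebesgue) \<le> ennreal (?C powr p * W a l)"
      by (rule order_trans[rotated])
  qed (use p k in auto)
qed

end

lemma sup_avg2_product_ge:
  fixes g1 g2 :: "real ^ 'n \<Rightarrow> real"
  assumes "g1 \<in> borel_measurable lebesgue" "g2 \<in> borel_measurable lebesgue"
    and "\<And>y. 0 \<le> g1 y" "\<And>y. 0 \<le> g2 y" and l: "0 < l" "x \<in> cube a l"
    and z: "0 \<le> z1" "0 \<le> z2"
      "(\<integral>\<^sup>+y\<in>cube a l. ennreal (g1 y) \<partial>lebesgue) = ennreal (z1 * l ^ CARD('n))"
      "(\<integral>\<^sup>+y\<in>cube a l. ennreal (g2 y) \<partial>lebesgue) = ennreal (z2 * l ^ CARD('n))"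
  shows "ennreal (z1 * z2) \<le> sup_avg2 x (\<lambda>y1 y2. g1 y1 * g2 y2)"
proof -
  have L: "0 < l ^ CARD('n)" using l by simp
  have "z1 * z2 = z1 * l ^ CARD('n) * (z2 * l ^ CARD('n)) / (l ^ CARD('n))\<^sup>2"
    using L l by (simp add: power2_eq_square)
  then have "ennreal (z1 * z2) = ennreal (z1 * l ^ CARD('n)) * ennreal (z2 * l ^ CARD('n)) / (emeasure lebesgue (cube a l))\<^sup>2"
    using l z L by (simp add: emeasure_cube ennreal_power divide_ennreal flip: ennreal_mult)
  also have "\<dots> \<le> sup_avg2 x (\<lambda>y1 y2. g1 y1 * g2 y2)"
    unfolding sup_avg2_product[OF assms(1-4)] z(3,4)[symmetric]
    using l by (intro SUP_upper2[of "cube a l"]) (auto simp: is_cube_iff)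
  finally show ?thesis .
qed

lemma M_Sigma_indicator_ge:
  fixes b :: "real ^ 'n \<Rightarrow> real"
  assumes [measurable]: "b \<in> borel_measurable lebesgue" and b: "set_integrable lebesgue (cube a l) b"
    and l: "0 < l" "x \<in> cube a l"
  shows "ennreal (osc_from b a l (b x) powr 1) \<le> M_Sigma b (indicat_real (cube a l)) (indicat_real (cube a l)) x"
proof -
  let ?I = "indicat_real (cube a l)"
  have "ennreal (osc_from b a l (b x) * 1) \<le> sup_avg2 x (\<lambda>y1 y2. \<bar>b x - b y1\<bar> * ?I y1 * ?I y2)"
  proof (rule sup_avg2_product_ge[OF _ _ _ _ l])
    have "(\<integral>\<^sup>+y\<in>cube a l. ennreal (\<bar>b x - b y\<bar> * ?I y) \<partial>lebesgue) = (\<integral>\<^sup>+y\<in>cube a l. ennreal \<bar>b x - b y\<bar> \<partial>lebesgue)"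
      by (intro nn_integral_cong) (auto simp: indicator_def)
    then show "(\<integral>\<^sup>+y\<in>cube a l. ennreal (\<bar>b x - b y\<bar> * ?I y) \<partial>lebesgue) = ennreal (osc_from b a l (b x) * l ^ CARD('n))"
      using osc_from_eq[OF l(1) assms(1) b] by simp
    have "(\<integral>\<^sup>+y\<in>cube a l. ennreal (?I y) \<partial>lebesgue) = (\<integral>\<^sup>+y. indicator (cube a l) y \<partial>lebesgue)"
      by (intro nn_integral_cong) (auto simp: indicator_def)
    then show "(\<integral>\<^sup>+y\<in>cube a l. ennreal (?I y) \<partial>lebesgue) = ennreal (1 * l ^ CARD('n))"
      using l by (simp add: emeasure_cube)
  qed (use l osc_from_nonneg[of l b a "b x"] in auto)
  also have "\<dots> = M_lin1 b ?I ?I x" by (simp add: M_lin1_def mult.assoc)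
  also have "\<dots> \<le> M_Sigma b ?I ?I x" by (simp add: M_Sigma_def)
  finally show ?thesis using osc_from_nonneg[of l b a "b x"] l by simp
qed

lemma M_Pi_indicator_ge:
  fixes b :: "real ^ 'n \<Rightarrow> real"
  assumes [measurable]: "b \<in> borel_measurable lebesgue" and b: "set_integrable lebesgue (cube a l) b"
    and l: "0 < l" "x \<in> cube a l"
  shows "ennreal (osc_from b a l (b x) powr 2) \<le> M_Pi b (indicat_real (cube a l)) (indicat_real (cube a l)) x"
proof -
  let ?I = "indicat_real (cube a l)"
  have *: "(\<integral>\<^sup>+y\<in>cube a l. ennreal (\<bar>b x - b y\<bar> * ?I y) \<partial>lebesgue) = ennreal (osc_from b a l (b x) * l ^ CARD('n))"
  proof -
    have "(\<integral>\<^sup>+y\<in>cube a l. ennreal (\<bar>b x - b y\<bar> * ?I y) \<partial>lebesgue) = (\<integral>\<^sup>+y\<in>cube a l. ennreal \<bar>b x - b y\<bar> \<partial>lebesgue)"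
      by (intro nn_integral_cong) (auto simp: indicator_def)
    then show ?thesis using osc_from_eq[OF l(1) assms(1) b] by simp
  qed
  have "ennreal (osc_from b a l (b x) * osc_from b a l (b x)) \<le> sup_avg2 x (\<lambda>y1 y2. (\<bar>b x - b y1\<bar> * ?I y1) * (\<bar>b x - b y2\<bar> * ?I y2))"
    by (rule sup_avg2_product_ge[OF _ _ _ _ l _ _ * *]) (use l osc_from_nonneg[of l b a "b x"] in auto)
  also have "\<dots> = M_Pi b ?I ?I x" by (simp add: M_Pi_def)
  finally show ?thesis using osc_from_nonneg[of l b a "b x"] l by (simp add: power2_eq_square)
qed

section \<open>The equivalence\<close>

text \<open>Cutting off to growing cubes gives integrable functions with limit \<open>f\<close>.\<close>

lemma locally_integrable_measurable:
  fixes f :: "real ^ 'n \<Rightarrow> real"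
  assumes "locally_integrable f"
  shows "f \<in> borel_measurable lebesgue"
proof (rule borel_measurable_LIMSEQ_real)
  let ?Q = "\<lambda>m::nat. cube (\<chi> i. - real m :: real ^ 'n) (2 * real m)"
  show "(\<lambda>x. indicator (?Q m) x *\<^sub>R f x) \<in> borel_measurable lebesgue" for m
    using assms unfolding locally_integrable_def set_integrable_def by (auto intro: borel_measurable_integrable)
  fix x :: "real ^ 'n"
  obtain m0 :: nat where m0: "norm x \<le> real m0" using real_arch_simple by blast
  have "x \<in> ?Q m" if "m0 \<le> m" for m
    unfolding mem_cube
  proof
    fix i
    have "\<bar>x $ i\<bar> \<le> real m" using component_le_norm_cart[of x i] m0 that by linarith
    then show "(\<chi> i. - real m) $ i \<le> x $ i \<and> x $ i \<le> (\<chi> i. - real m) $ i + 2 * real m" by auto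
  qed
  then have "\<forall>\<^sub>F m in sequentially. indicator (?Q m) x *\<^sub>R f x = f x"
    unfolding eventually_sequentially by (intro exI[of _ m0]) auto
  then show "(\<lambda>m. indicator (?Q m) x *\<^sub>R f x) \<longlonglongrightarrow> f x" by (rule tendsto_eventually)
qed

lemma locally_integrable_cube: "locally_integrable f \<Longrightarrow> set_integrable lebesgue (cube a l) f"
  by (simp add: locally_integrable_def)

lemma set_integral_cube_eq_enn2real:
  fixes f :: "real ^ 'n \<Rightarrow> real"
  assumes [measurable]: "f \<in> borel_measurable lebesgue" and "\<And>x. 0 \<le> f x"
  shows "(LINT x:cube a l|lebesgue. f x) = enn2real (\<integral>\<^sup>+x\<in>cube a l. ennreal (f x) \<partial>lebesgue)"
proof -
  have "(LINT x:cube a l|lebesgue. f x) = enn2real (\<integral>\<^sup>+x. ennreal (indicator (cube a l) x *\<^sub>R f x) \<partial>lebesgue)"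
    unfolding set_lebesgue_integral_def using assms(2) by (intro integral_eq_nn_integral) auto
  also have "(\<integral>\<^sup>+x. ennreal (indicator (cube a l) x *\<^sub>R f x) \<partial>lebesgue) = (\<integral>\<^sup>+x\<in>cube a l. ennreal (f x) \<partial>lebesgue)"
    by (intro nn_integral_cong) (auto simp: indicator_def)
  finally show ?thesis .
qed

text \<open>The supremum in the definition is attained along a sequence, so countably many null sets suffice.\<close>

lemma AE_ess_inf_le: "AE x in lebesgue. x \<in> Q \<longrightarrow> ess_inf w Q \<le> ennreal (w x)"
proof -
  let ?A = "{c. AE x in lebesgue. x \<in> Q \<longrightarrow> c \<le> ennreal (w x)}"
  have "0 \<in> ?A" by simp
  then obtain c :: "nat \<Rightarrow> ennreal" where c: "range c \<subseteq> ?A" "Sup ?A = (SUP i. c i)"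
    using ennreal_Sup_countable_SUP[of ?A] by blast
  have "AE x in lebesgue. \<forall>i. x \<in> Q \<longrightarrow> c i \<le> ennreal (w x)"
    using c(1) by (subst AE_all_countable) auto
  then show ?thesis
    unfolding ess_inf_def c(2) by eventually_elim (auto intro: SUP_least)
qed

text \<open>The constant is enlarged to be at least 1, which simplifies the later estimates.\<close>

lemma A1_weight_imp_a1_weight:
  fixes w :: "real ^ 'n \<Rightarrow> real"
  assumes "A1_weight w"
  obtains C1 where "a1_weight w C1"
proof -
  from assms obtain C where w: "locally_integrable w" "\<And>x. 0 \<le> w x" "AE x in lebesgue. 0 < w x"
    and C: "0 < C" "\<And>Q. is_cube Q \<Longrightarrow> ennreal (average w Q) \<le> ennreal C * ess_inf w Q"
    unfolding A1_weight_def weight_def by blast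
  have m: "w \<in> borel_measurable lebesgue" by (rule locally_integrable_measurable[OF w(1)])
  show thesis
  proof (rule that[of "max 1 C"], unfold_locales)
    show "w \<in> borel_measurable lebesgue" "\<And>x. 0 \<le> w x" "AE x in lebesgue. 0 < w x" "1 \<le> max 1 C"
      using m w by auto
    show "(\<integral>\<^sup>+x\<in>cube a l. ennreal (w x) \<partial>lebesgue) < \<infinity>" for a l
      using locally_integrable_cube[OF w(1), of a l] w(2) by (subst (asm) set_integrable_cube_iff[OF m]) simp
    fix l :: real and a :: "real ^ 'n" assume l: "0 < l"
    let ?v = "enn2real (\<integral>\<^sup>+x\<in>cube a l. ennreal (w x) \<partial>lebesgue)"
    have av: "average w (cube a l) = ?v / l ^ CARD('n)"
      using l by (simp add: average_def set_integral_cube_eq_enn2real[OF m w(2)] measure_cube)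
    show "AE x in lebesgue. x \<in> cube a l \<longrightarrow> ?v \<le> max 1 C * w x * l ^ CARD('n)"
      using AE_ess_inf_le[of "cube a l" w]
    proof eventually_elim
      case (elim x)
      show ?case
      proof
        assume x: "x \<in> cube a l"
        have "ennreal (?v / l ^ CARD('n)) \<le> ennreal C * ess_inf w (cube a l)"
          using C(2)[of "cube a l"] l by (auto simp: is_cube_iff av)
        also have "\<dots> \<le> ennreal C * ennreal (w x)" using elim x by (intro mult_left_mono) auto
        also have "\<dots> = ennreal (C * w x)" using C(1) w(2) by (simp add: ennreal_mult)
        finally have "?v / l ^ CARD('n) \<le> C * w x"
          using C(1) w(2)[of x] l by (simp add: ennreal_le_iff)
        also have "\<dots> \<le> max 1 C * w x" using w(2)[of x] by (intro mult_right_mono) auto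
        finally show "?v \<le> max 1 C * w x * l ^ CARD('n)" using l by (simp add: pos_divide_le_eq)
      qed
    qed
  qed
qed

lemma (in a1_weight) BMO_iff:
  fixes b :: "real ^ 'n \<Rightarrow> real"
  assumes b: "locally_integrable b"
  shows "b \<in> BMO w \<longleftrightarrow>
    (\<exists>B>0. \<forall>a l. 0 < l \<longrightarrow> (\<integral>\<^sup>+x\<in>cube a l. ennreal \<bar>b x - average b (cube a l)\<bar> \<partial>lebesgue) \<le> ennreal (B * W a l))"
proof -
  have bm [measurable]: "b \<in> borel_measurable lebesgue" by (rule locally_integrable_measurable[OF b])
  define Ob where "Ob a l = (\<integral>\<^sup>+x\<in>cube a l. ennreal \<bar>b x - average b (cube a l)\<bar> \<partial>lebesgue)" for a l
  have fin: "Ob a l < \<infinity>" for a l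
  proof -
    have "set_integrable lebesgue (cube a l) (\<lambda>x. b x - average b (cube a l))"
      by (intro set_integral_diff set_integrable_const_cube locally_integrable_cube[OF b])
    then show ?thesis unfolding Ob_def by (subst (asm) set_integrable_cube_iff) auto
  qed
  have term_eq: "(LINT y:cube a l|lebesgue. \<bar>b y - average b (cube a l)\<bar>) / (LINT y:cube a l|lebesgue. w y) = enn2real (Ob a l) / W a l" for a l
    by (subst (1 2) set_integral_cube_eq_enn2real) (auto simp: Ob_def W_eq w_nonneg)
  have le_iff: "Ob a l \<le> ennreal (B * W a l) \<longleftrightarrow> enn2real (Ob a l) / W a l \<le> B" if "0 < l" "0 \<le> B" for a l B
  proof -
    obtain r where r: "Ob a l = ennreal r" "0 \<le> r" using fin[of a l] by (cases "Ob a l") auto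
    have "W a l > 0" using W_pos that by simp
    then show ?thesis using r that by (simp add: ennreal_le_iff pos_divide_le_eq)
  qed
  have norm: "BMO_norm w b = (SUP Q\<in>{Q. is_cube Q}. ennreal ((LINT y:Q|lebesgue. \<bar>b y - average b Q\<bar>) / (LINT y:Q|lebesgue. w y)))"
    by (simp add: BMO_norm_def)
  show ?thesis
  proof
    assume "b \<in> BMO w"
    then have "BMO_norm w b < \<infinity>" by (simp add: BMO_def)
    then obtain r where r: "BMO_norm w b = ennreal r" "0 \<le> r" by (cases "BMO_norm w b") auto
    have "Ob a l \<le> ennreal ((r + 1) * W a l)" if l: "0 < l" for a l
    proof -
      have "ennreal (enn2real (Ob a l) / W a l) \<le> ennreal r"
        unfolding r(1)[symmetric] norm term_eq[symmetric] using l by (intro SUP_upper) (auto simp: is_cube_iff)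
      then have "enn2real (Ob a l) / W a l \<le> r" using r by (simp add: ennreal_le_iff)
      then show ?thesis using r l by (subst le_iff) auto
    qed
    then show "\<exists>B>0. \<forall>a l. 0 < l \<longrightarrow> (\<integral>\<^sup>+x\<in>cube a l. ennreal \<bar>b x - average b (cube a l)\<bar> \<partial>lebesgue) \<le> ennreal (B * W a l)"
      using r unfolding Ob_def by (intro exI[of _ "r + 1"]) auto
  next
    assume "\<exists>B>0. \<forall>a l. 0 < l \<longrightarrow> (\<integral>\<^sup>+x\<in>cube a l. ennreal \<bar>b x - average b (cube a l)\<bar> \<partial>lebesgue) \<le> ennreal (B * W a l)"
    then obtain B where B: "0 < B" "\<And>a l. 0 < l \<Longrightarrow> Ob a l \<le> ennreal (B * W a l)" unfolding Ob_def by blast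
    have "BMO_norm w b \<le> ennreal B"
      unfolding norm
    proof (rule SUP_least, clarify)
      fix Q :: "(real ^ 'n) set" assume "is_cube Q"
      then obtain a l where al: "0 < l" "Q = cube a l" by (auto simp: is_cube_iff)
      show "ennreal ((LINT y:Q|lebesgue. \<bar>b y - average b Q\<bar>) / (LINT y:Q|lebesgue. w y)) \<le> ennreal B"
        unfolding al(2) term_eq using le_iff[OF al(1), of B a] B al(1) by (intro ennreal_leI) auto
    qed
    then show "b \<in> BMO w" using b by (auto simp: BMO_def intro: order.strict_trans1)
  qed
qed

theorem theorem1p1:
  fixes w b :: "real ^ 'n \<Rightarrow> real" and p p1 p2 :: real
  assumes "1 < p1" and "1 < p2" and "1 / p = 1 / p1 + 1 / p2"
    and "A1_weight w" and "locally_integrable b"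
  shows "(b \<in> BMO w \<longleftrightarrow>
            bounded_pair_op (M_Sigma b) p1 p2 w p (\<lambda>x. w x powr (1 - p))) \<and>
         (b \<in> BMO w \<longleftrightarrow>
            bounded_pair_op (M_Pi b) p1 p2 w p (\<lambda>x. w x powr (1 - 2 * p)))"
proof -
  obtain C1 where "a1_weight w C1" by (rule A1_weight_imp_a1_weight[OF assms(4)])
  then interpret a1_weight w C1 .
  have bm: "b \<in> borel_measurable lebesgue" by (rule locally_integrable_measurable[OF assms(5)])
  have bi: "set_integrable lebesgue (cube a l) b" for a l by (rule locally_integrable_cube[OF assms(5)])
  have p: "0 < p"
  proof -
    have "0 < 1 / p" unfolding assms(3) using assms(1,2) by (intro add_pos_pos) auto
    then show ?thesis by simp
  qed
  have up: "bounded_pair_op (M_Sigma b) p1 p2 w p (\<lambda>x. w x powr (1 - p)) \<and>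
      bounded_pair_op (M_Pi b) p1 p2 w p (\<lambda>x. w x powr (1 - 2 * p))" if bmo: "b \<in> BMO w"
  proof -
    obtain B where B: "0 < B" "\<And>a l. 0 < l \<Longrightarrow>
        (\<integral>\<^sup>+x\<in>cube a l. ennreal \<bar>b x - average b (cube a l)\<bar> \<partial>lebesgue) \<le> ennreal (B * W a l)"
      using bmo BMO_iff[OF assms(5)] by blast
    interpret bmo_weight w C1 b B
      by unfold_locales (use bm bi B in auto)
    show ?thesis using bounded_M_Sigma bounded_M_Pi assms(1-3) p by blast
  qed
  have "b \<in> BMO w" if bdd: "bounded_pair_op (M_Sigma b) p1 p2 w p (\<lambda>x. w x powr (1 - p))"
    unfolding BMO_iff[OF assms(5)]
  proof (rule osc_bound_from_bounded_op[OF bm bi assms(1,2) p assms(3) zero_less_one])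
    show "bounded_pair_op (M_Sigma b) p1 p2 w p (\<lambda>x. w x powr (1 - 1 * p))" using bdd by simp
  qed (rule M_Sigma_indicator_ge[OF bm bi])
  moreover have "b \<in> BMO w" if bdd: "bounded_pair_op (M_Pi b) p1 p2 w p (\<lambda>x. w x powr (1 - 2 * p))"
    unfolding BMO_iff[OF assms(5)]
    by (rule osc_bound_from_bounded_op[OF bm bi assms(1,2) p assms(3) zero_less_numeral _ bdd])
      (rule M_Pi_indicator_ge[OF bm bi])
  ultimately show ?thesis using up by blast
qed
end
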